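(* Let $\theta>0$ and suppose that for each mesh $\mathcal{T}\in\mathcal{U}_\theta$ a dual Raviart-Thomas basis is chosen such that the Interpolation Hypothesis of the context holds, with constants $A,B,D,E$. There is a constant $F>0$ depending only on $\theta$ with the Lifting Property of the context; let $F$ be such a constant. Then the following discrete stability holds for the Petrov-Galerkin mixed formulation: there exists $\beta>0$ such that for all $\mathcal{T}\in\mathcal{U}_\theta$ and all $\xi\in V_{\mathcal{T}}$ with $\|\xi\|_V=1$, there exists $\eta\in V^\star_{\mathcal{T}}$ with $\|\eta\|_V\le1$ and $$\gamma(\xi,\eta)\ge\beta .$$ More precisely, $\beta>0$ may be chosen as any number such that $$\sqrt{1-\frac{B+2D}{A}\,\beta-\beta^2}\;\ge\;\Bigl(1+F\Bigl(1+\sqrt{\tfrac{B+2D}{A}}\Bigr)\Bigr)\sqrt{\beta}$$ (the quantity under the left-hand root being nonnegative).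
   Context: $\Omega\subset\mathbb{R}^2$ is a fixed bounded convex domain with polygonal boundary. $(\cdot,\cdot)$ and $\|\cdot\|_0$ are the scalar product and norm of $L^2(\Omega)$. $H(\mathrm{div},\Omega)=\{q\in L^2(\Omega)^2:\mathrm{div}\,q\in L^2(\Omega)\}$ with $\|q\|^2_{H(\mathrm{div},\Omega)}=\|q\|_0^2+\|\mathrm{div}\,q\|_0^2$. $V=L^2(\Omega)\times H(\mathrm{div},\Omega)$ with $\|(u,p)\|_V^2=\|u\|_0^2+\|p\|_0^2+\|\mathrm{div}\,p\|_0^2$, and $$\gamma\bigl((u,p),(v,q)\bigr)=(p,q)+(u,\mathrm{div}\,q)+(\mathrm{div}\,p,v).$$ A mesh $\mathcal{T}$ is a conforming triangulation of $\Omega$ with edge set $\mathcal{A}_{\mathcal{T}}$ (boundary edges included). For a triangle $K$, $h_K$ is its diameter and $\rho_K$ the diameter of its inscribed disc; $\mathcal{U}_\theta$ is the family of meshes with $h_K/\rho_K\le\theta$ for all triangles $K$. $L^2_{\mathcal{T}}(\Omega)$ is the space of functions constant on each triangle. Each edge $a$ carries a unit normal $n_a$ (outward if $a\subset\partial\Omega$). If $a=[S,N]$ is shared by $K=(S,N,W)$ and $L=(N,S,E)$ with $n_a$ pointing from $K$ to $L$, the lowest-order Raviart-Thomas function is $\varphi_a(x)=\frac{1}{2|K|}(x-W)$ on $K$, $-\frac{1}{2|L|}(x-E)$ on $L$, $0$ elsewhere ($L$ absent if $a\subset\partial\Omega$). $H_{\mathcal{T}}(\mathrm{div},\Omega)=\mathrm{span}\{\varphi_a\}$.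 A dual Raviart-Thomas basis is a family $(\varphi^\star_a)_{a\in\mathcal{A}_{\mathcal{T}}}$ in $H(\mathrm{div},\Omega)$ with $(\varphi_a,\varphi^\star_b)=\delta_{a,b}$; $H^\star_{\mathcal{T}}(\mathrm{div},\Omega)=\mathrm{span}\{\varphi^\star_a\}$. $V_{\mathcal{T}}=L^2_{\mathcal{T}}(\Omega)\times H_{\mathcal{T}}(\mathrm{div},\Omega)$ and $V^\star_{\mathcal{T}}=L^2_{\mathcal{T}}(\Omega)\times H^\star_{\mathcal{T}}(\mathrm{div},\Omega)$. Interpolation Hypothesis: there are constants $A,B,D,E>0$ depending only on $\theta$ such that for every $\mathcal{T}\in\mathcal{U}_\theta$ there is a linear map $\Pi:H_{\mathcal{T}}(\mathrm{div},\Omega)\to H^\star_{\mathcal{T}}(\mathrm{div},\Omega)$ with, for all $q\in H_{\mathcal{T}}(\mathrm{div},\Omega)$: $A\|q\|_0^2\le(q,\Pi q)$; $\|\Pi q\|_0\le B\|q\|_0$; $\|\mathrm{div}\,\Pi q\|_0\le D\|\mathrm{div}\,q\|_0$; $(\mathrm{div}\,q,\mathrm{div}\,\Pi q)\ge E\|\mathrm{div}\,q\|_0^2$. Lifting Property of $F$: for every $\mathcal{T}\in\mathcal{U}_\theta$ and every $u\in L^2_{\mathcal{T}}(\Omega)$ there is $q\in H^\star_{\mathcal{T}}(\mathrm{div},\Omega)$ with $\|q\|_{H(\mathrm{div},\Omega)}\le F\|u\|_0$ and $(u,\mathrm{div}\,q)\ge\|u\|_0^2$. *)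

theory Defs
  imports "HOL-Analysis.Analysis"
begin

type_synonym plane = "real^2"
type_synonym triangle = "plane set"
type_synonym edge = "plane set"
type_synonym mesh = "triangle set"
type_synonym scalar_field = "plane \<Rightarrow> real"
type_synonym vector_field = "plane \<Rightarrow> plane"

definition convex_polygonal_domain :: "plane set \<Rightarrow> bool" where
  "convex_polygonal_domain \<Omega> \<longleftrightarrow>
     open \<Omega> \<and> \<Omega> \<noteq> {} \<and> bounded \<Omega> \<and> convex \<Omega> \<and>
     (\<exists>S. finite S \<and> frontier \<Omega> = (\<Union>(x, y)\<in>S. closed_segment x y))"


text \<open>Elements of \<open>L\<^sup>2(\<Omega>)\<close> are represented by functions on the plane; values outside \<open>\<Omega>\<close> and
  on null sets are irrelevant, since everything enters through integrals over \<open>\<Omega>\<close>. The type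
  \<open>'b\<close> is \<open>real\<close> for scalar fields and \<open>plane\<close> for vector fields.\<close>

definition L2 :: "plane set \<Rightarrow> (plane \<Rightarrow> 'b::euclidean_space) set" where
  "L2 \<Omega> = {f. f \<in> borel_measurable (lebesgue_on \<Omega>) \<and>
               integrable (lebesgue_on \<Omega>) (\<lambda>x. (norm (f x))\<^sup>2)}"

definition ip :: "plane set \<Rightarrow> (plane \<Rightarrow> 'b::euclidean_space) \<Rightarrow> (plane \<Rightarrow> 'b) \<Rightarrow> real" where
  "ip \<Omega> f g = (LINT x|lebesgue_on \<Omega>. f x \<bullet> g x)"

definition norm0 :: "plane set \<Rightarrow> (plane \<Rightarrow> 'b::euclidean_space) \<Rightarrow> real" where
  "norm0 \<Omega> f = sqrt (ip \<Omega> f f)"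

primrec Ck :: "nat \<Rightarrow> scalar_field \<Rightarrow> bool" where
  "Ck 0 f \<longleftrightarrow> continuous_on UNIV f"
| "Ck (Suc k) f \<longleftrightarrow> (\<exists>G. (\<forall>x. GDERIV f x :> G x) \<and> (\<forall>i. Ck k (\<lambda>x. G x $ i)))"

definition test_function :: "plane set \<Rightarrow> scalar_field \<Rightarrow> bool" where
  "test_function \<Omega> \<psi> \<longleftrightarrow>
     (\<forall>k. Ck k \<psi>) \<and> compact (closure {x. \<psi> x \<noteq> 0}) \<and> closure {x. \<psi> x \<noteq> 0} \<subseteq> \<Omega>"

definition has_weak_div :: "plane set \<Rightarrow> vector_field \<Rightarrow> scalar_field \<Rightarrow> bool" where
  "has_weak_div \<Omega> q g \<longleftrightarrow>
     (\<forall>\<psi> G. test_function \<Omega> \<psi> \<and> (\<forall>x. GDERIV \<psi> x :> G x) \<longrightarrow> ip \<Omega> q G = - ip \<Omega> g \<psi>)"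

definition Hdiv :: "plane set \<Rightarrow> vector_field set" where
  "Hdiv \<Omega> = {q \<in> L2 \<Omega>. \<exists>g\<in>L2 \<Omega>. has_weak_div \<Omega> q g}"

text \<open>The weak divergence is unique only up to null sets; \<open>wdiv\<close> picks a representative.\<close>

definition wdiv :: "plane set \<Rightarrow> vector_field \<Rightarrow> scalar_field" where
  "wdiv \<Omega> q = (SOME g. g \<in> L2 \<Omega> \<and> has_weak_div \<Omega> q g)"

definition norm_Hdiv :: "plane set \<Rightarrow> vector_field \<Rightarrow> real" where
  "norm_Hdiv \<Omega> q = sqrt ((norm0 \<Omega> q)\<^sup>2 + (norm0 \<Omega> (wdiv \<Omega> q))\<^sup>2)"

definition norm_V :: "plane set \<Rightarrow> scalar_field \<times> vector_field \<Rightarrow> real" where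
  "norm_V \<Omega> = (\<lambda>(u, p). sqrt ((norm0 \<Omega> u)\<^sup>2 + (norm0 \<Omega> p)\<^sup>2 + (norm0 \<Omega> (wdiv \<Omega> p))\<^sup>2))"

definition \<gamma> :: "plane set \<Rightarrow> scalar_field \<times> vector_field \<Rightarrow> scalar_field \<times> vector_field \<Rightarrow> real" where
  "\<gamma> \<Omega> = (\<lambda>(u, p) (v, q). ip \<Omega> p q + ip \<Omega> u (wdiv \<Omega> q) + ip \<Omega> (wdiv \<Omega> p) v)"


text \<open>Meshes consist of closed triangles; conformity (two triangles meet in a common face,
  possibly empty) is part of the library predicate \<open>triangulation\<close>.\<close>

definition is_mesh :: "plane set \<Rightarrow> mesh \<Rightarrow> bool" where
  "is_mesh \<Omega> T \<longleftrightarrow> triangulation T \<and> (\<forall>K\<in>T. 2 simplex K) \<and> \<Union>T = closure \<Omega>"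

definition edges :: "mesh \<Rightarrow> edge set" where
  "edges T = {a. \<exists>K\<in>T. a edge_of K}"

text \<open>The inscribed disc of a triangle is the largest disc contained in it.\<close>

definition inscribed_diameter :: "triangle \<Rightarrow> real" where
  "inscribed_diameter K = Sup {diameter (cball c r) | c r. cball c r \<subseteq> K}"

definition regular_meshes :: "plane set \<Rightarrow> real \<Rightarrow> mesh set" where
  "regular_meshes \<Omega> \<theta> = {T. is_mesh \<Omega> T \<and> (\<forall>K\<in>T. diameter K / inscribed_diameter K \<le> \<theta>)}"

definition L2_mesh :: "plane set \<Rightarrow> mesh \<Rightarrow> scalar_field set" where
  "L2_mesh \<Omega> T = {u \<in> L2 \<Omega>. \<forall>K\<in>T. \<exists>c. \<forall>x\<in>interior K. u x = c}"

definition unit_normal :: "edge \<Rightarrow> plane \<Rightarrow> bool" where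
  "unit_normal a n \<longleftrightarrow> norm n = 1 \<and> (\<forall>x\<in>a. \<forall>y\<in>a. n \<bullet> (x - y) = 0)"

text \<open>The vector \<open>n\<close> points out of the convex set \<open>C\<close> across \<open>a\<close>; used with \<open>C\<close> a triangle or
  the (convex) domain and \<open>n\<close> a unit normal to \<open>a\<close>.\<close>

definition points_out :: "plane set \<Rightarrow> edge \<Rightarrow> plane \<Rightarrow> bool" where
  "points_out C a n \<longleftrightarrow> (\<forall>x\<in>C. \<forall>y\<in>a. n \<bullet> (x - y) \<le> 0)"

definition mesh_normals :: "plane set \<Rightarrow> mesh \<Rightarrow> (edge \<Rightarrow> plane) \<Rightarrow> bool" where
  "mesh_normals \<Omega> T n \<longleftrightarrow>
     (\<forall>a\<in>edges T. unit_normal a (n a) \<and> (a \<subseteq> frontier \<Omega> \<longrightarrow> points_out \<Omega> a (n a)))"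

definition opposite_vertex :: "triangle \<Rightarrow> edge \<Rightarrow> plane" where
  "opposite_vertex K a = (THE W. W extreme_point_of K \<and> W \<notin> a)"

text \<open>At most one summand is nonzero at a given point. The sign is positive on the triangle that
  the normal of \<open>a\<close> leaves and negative on the one it enters; on the triangle boundaries (a
  null set) the value is 0.\<close>

definition raviart_thomas :: "mesh \<Rightarrow> (edge \<Rightarrow> plane) \<Rightarrow> edge \<Rightarrow> vector_field" where
  "raviart_thomas T n a x =
     (\<Sum>K\<in>{K \<in> T. a edge_of K \<and> x \<in> interior K}.
        ((if points_out K a (n a) then 1 else - 1) / (2 * measure lebesgue K))
          *\<^sub>R (x - opposite_vertex K a))"

definition field_span :: "edge set \<Rightarrow> (edge \<Rightarrow> vector_field) \<Rightarrow> vector_field set" where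
  "field_span I \<phi> = {\<lambda>x. \<Sum>a\<in>I. c a *\<^sub>R \<phi> a x | c. True}"

definition H_mesh :: "mesh \<Rightarrow> (edge \<Rightarrow> plane) \<Rightarrow> vector_field set" where
  "H_mesh T n = field_span (edges T) (raviart_thomas T n)"

definition dual_rt_basis :: "plane set \<Rightarrow> mesh \<Rightarrow> (edge \<Rightarrow> plane) \<Rightarrow> (edge \<Rightarrow> vector_field) \<Rightarrow> bool" where
  "dual_rt_basis \<Omega> T n \<phi>s \<longleftrightarrow>
     (\<forall>a\<in>edges T. \<phi>s a \<in> Hdiv \<Omega>) \<and>
     (\<forall>a\<in>edges T. \<forall>b\<in>edges T. ip \<Omega> (raviart_thomas T n a) (\<phi>s b) = (if a = b then 1 else 0))"

definition H_dual :: "mesh \<Rightarrow> (edge \<Rightarrow> vector_field) \<Rightarrow> vector_field set" where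
  "H_dual T \<phi>s = field_span (edges T) \<phi>s"

definition V_mesh :: "plane set \<Rightarrow> mesh \<Rightarrow> (edge \<Rightarrow> plane) \<Rightarrow> (scalar_field \<times> vector_field) set" where
  "V_mesh \<Omega> T n = L2_mesh \<Omega> T \<times> H_mesh T n"

definition V_dual :: "plane set \<Rightarrow> mesh \<Rightarrow> (edge \<Rightarrow> vector_field) \<Rightarrow> (scalar_field \<times> vector_field) set" where
  "V_dual \<Omega> T \<phi>s = L2_mesh \<Omega> T \<times> H_dual T \<phi>s"

definition linear_map_on :: "vector_field set \<Rightarrow> (vector_field \<Rightarrow> vector_field) \<Rightarrow> bool" where
  "linear_map_on H P \<longleftrightarrow>
     (\<forall>p\<in>H. \<forall>q\<in>H. P (\<lambda>x. p x + q x) = (\<lambda>x. P p x + P q x)) \<and>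
     (\<forall>c. \<forall>q\<in>H. P (\<lambda>x. c *\<^sub>R q x) = (\<lambda>x. c *\<^sub>R P q x))"


text \<open>Below, \<open>n\<close> and \<open>\<phi>s\<close> assign to each mesh its edge normals and its chosen dual family.\<close>

definition dual_choice ::
  "plane set \<Rightarrow> real \<Rightarrow> (mesh \<Rightarrow> edge \<Rightarrow> plane) \<Rightarrow> (mesh \<Rightarrow> edge \<Rightarrow> vector_field) \<Rightarrow> bool" where
  "dual_choice \<Omega> \<theta> n \<phi>s \<longleftrightarrow>
     (\<forall>T\<in>regular_meshes \<Omega> \<theta>. mesh_normals \<Omega> T (n T) \<and> dual_rt_basis \<Omega> T (n T) (\<phi>s T))"

definition interpolation_hypothesis ::
  "plane set \<Rightarrow> real \<Rightarrow> (mesh \<Rightarrow> edge \<Rightarrow> plane) \<Rightarrow> (mesh \<Rightarrow> edge \<Rightarrow> vector_field) \<Rightarrow>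
   real \<Rightarrow> real \<Rightarrow> real \<Rightarrow> real \<Rightarrow> bool" where
  "interpolation_hypothesis \<Omega> \<theta> n \<phi>s A B D E \<longleftrightarrow>
     (\<forall>T\<in>regular_meshes \<Omega> \<theta>.
        \<exists>P. P \<in> H_mesh T (n T) \<rightarrow> H_dual T (\<phi>s T) \<and> linear_map_on (H_mesh T (n T)) P \<and>
          (\<forall>q\<in>H_mesh T (n T).
             A * (norm0 \<Omega> q)\<^sup>2 \<le> ip \<Omega> q (P q) \<and>
             norm0 \<Omega> (P q) \<le> B * norm0 \<Omega> q \<and>
             norm0 \<Omega> (wdiv \<Omega> (P q)) \<le> D * norm0 \<Omega> (wdiv \<Omega> q) \<and>
             ip \<Omega> (wdiv \<Omega> q) (wdiv \<Omega> (P q)) \<ge> E * (norm0 \<Omega> (wdiv \<Omega> q))\<^sup>2))"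

definition lifting_property ::
  "plane set \<Rightarrow> real \<Rightarrow> (mesh \<Rightarrow> edge \<Rightarrow> vector_field) \<Rightarrow> real \<Rightarrow> bool" where
  "lifting_property \<Omega> \<theta> \<phi>s F \<longleftrightarrow>
     (\<forall>T\<in>regular_meshes \<Omega> \<theta>. \<forall>u\<in>L2_mesh \<Omega> T. \<exists>q\<in>H_dual T (\<phi>s T).
        norm_Hdiv \<Omega> q \<le> F * norm0 \<Omega> u \<and> ip \<Omega> u (wdiv \<Omega> q) \<ge> (norm0 \<Omega> u)\<^sup>2)"

definition discrete_stability ::
  "plane set \<Rightarrow> real \<Rightarrow> (mesh \<Rightarrow> edge \<Rightarrow> plane) \<Rightarrow> (mesh \<Rightarrow> edge \<Rightarrow> vector_field) \<Rightarrow> real \<Rightarrow> bool" where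
  "discrete_stability \<Omega> \<theta> n \<phi>s \<beta> \<longleftrightarrow>
     (\<forall>T\<in>regular_meshes \<Omega> \<theta>. \<forall>\<xi>\<in>V_mesh \<Omega> T (n T). norm_V \<Omega> \<xi> = 1 \<longrightarrow>
        (\<exists>\<eta>\<in>V_dual \<Omega> T (\<phi>s T). norm_V \<Omega> \<eta> \<le> 1 \<and> \<gamma> \<Omega> \<xi> \<eta> \<ge> \<beta>))"

end

theory Submission
  imports Defs "HOL-Complex_Analysis.Winding_Numbers"
begin

text \<open>Let \<open>u\<close> be piecewise constant. The field \<open>x \<mapsto> \<integral> u(y) (x - y) / (2\<pi>|x - y|\<^sup>2) dy\<close> over \<open>\<Omega>\<close> has
  divergence \<open>u\<close>, and its flux through an edge \<open>a\<close> is \<open>\<integral> u \<Theta>\<^sub>a\<close>, where \<open>\<Theta>\<^sub>a(y)\<close> is the oriented angle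
  under which \<open>a\<close> is seen from \<open>y\<close>, in units of \<open>2\<pi>\<close>. The Raviart-Thomas field \<open>q\<close> with these fluxes
  has divergence \<open>u\<close>, since the angles belonging to the three edges of a triangle add up to its
  indicator function (a winding number). As \<open>|\<Theta>\<^sub>a(y)| \<le> h\<^sub>K / |x - y|\<close> for \<open>x\<close> in a triangle \<open>K\<close>
  with edge \<open>a\<close>, the Cauchy-Schwarz inequality and the shape regularity of the mesh bound \<open>\<parallel>q\<parallel>\<close>
  by \<open>\<parallel>u\<parallel>\<close> times the supremum over \<open>y\<close> of \<open>\<integral> dx / |x - y|\<close>, without any elliptic regularity.
  Applying the interpolation operator to \<open>q / E\<close> gives the lifting.

  If the form is smaller than \<open>\<beta>\<close> on the unit ball, then testing with \<open>div p\<close>, with \<open>\<Pi> p\<close> and with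
  the lifting of \<open>u\<close> gives in turn \<open>\<parallel>div p\<parallel> \<le> \<beta>\<close>, \<open>A \<parallel>p\<parallel>\<^sup>2 \<le> (B + 2D) \<beta>\<close> and
  \<open>\<parallel>u\<parallel> \<le> F (\<beta> + \<parallel>p\<parallel>)\<close>, which is incompatible with \<open>\<parallel>(u, p)\<parallel> = 1\<close> for the admissible \<open>\<beta>\<close>.\<close>

subsection \<open>The inner product of square integrable fields\<close>

text \<open>\<open>H_mesh\<close> carries no boundary condition, so the Newtonian field of the zero
  extension of u is admissible although it ignores the boundary of \<open>\<Omega>\<close>. The
  field itself never enters: the edge fluxes are defined directly as integrals of u against angles,
  so neither traces nor the regularity of a potential have to be studied. The norm estimate is a
  Schur test for the kernel |\<Theta>_a(y)|: one half of the Cauchy-Schwarz inequality integrates it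
  in y for a fixed edge, the other sums it over all edges for fixed y, and both reduce to the same
  singular integral. The remaining obstacle is that \<open>wdiv\<close> is an arbitrary choice among
  the weak divergences. Hence uniqueness up to null sets is required, which takes a sufficient
  supply of test functions, and piecewise fields must be shown to have no jumps across interior
  edges. That cancellation is obtained without surface integrals: the mean of a test function over
  an edge is expressed by a volume integral over an adjacent triangle, and this integral turns out
  not to depend on which of the two triangles is taken.\<close>

lemma L2D:
  assumes "f \<in> L2 \<Omega>"
  shows "f \<in> borel_measurable (lebesgue_on \<Omega>)" "integrable (lebesgue_on \<Omega>) (\<lambda>x. (norm (f x))\<^sup>2)"
  using assms by (auto simp: L2_def)

lemma L2_integrable_inner:
  fixes f g :: "plane \<Rightarrow> 'b::euclidean_space"
  assumes "f \<in> L2 \<Omega>" "g \<in> L2 \<Omega>"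
  shows "integrable (lebesgue_on \<Omega>) (\<lambda>x. f x \<bullet> g x)"
proof (rule Bochner_Integration.integrable_bound)
  show "integrable (lebesgue_on \<Omega>) (\<lambda>x. (norm (f x))\<^sup>2 + (norm (g x))\<^sup>2)"
    using assms by (intro Bochner_Integration.integrable_add) (auto simp: L2_def)
  show "(\<lambda>x. f x \<bullet> g x) \<in> borel_measurable (lebesgue_on \<Omega>)"
    using assms by (auto simp: L2_def)
  have "\<bar>a \<bullet> b\<bar> \<le> (norm a)\<^sup>2 + (norm b)\<^sup>2" for a b :: 'b
  proof -
    have "\<bar>a \<bullet> b\<bar> \<le> norm a * norm b" by (rule Cauchy_Schwarz_ineq2)
    moreover have "2 * (norm a * norm b) \<le> (norm a)\<^sup>2 + (norm b)\<^sup>2"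
      using sum_squares_bound[of "norm a" "norm b"] by (simp add: mult.assoc)
    moreover have "0 \<le> norm a * norm b" by simp
    ultimately show ?thesis by linarith
  qed
  then show "AE x in lebesgue_on \<Omega>. norm (f x \<bullet> g x) \<le> norm ((norm (f x))\<^sup>2 + (norm (g x))\<^sup>2)"
    by auto
qed

lemma L2_add:
  assumes "f \<in> L2 \<Omega>" "g \<in> L2 \<Omega>"
  shows "(\<lambda>x. f x + g x) \<in> L2 \<Omega>"
proof -
  have "integrable (lebesgue_on \<Omega>) (\<lambda>x. (norm (f x))\<^sup>2 + 2 * (f x \<bullet> g x) + (norm (g x))\<^sup>2)"
    using assms L2_integrable_inner[OF assms] by (auto simp: L2_def)
  moreover have "(norm (f x + g x))\<^sup>2 = (norm (f x))\<^sup>2 + 2 * (f x \<bullet> g x) + (norm (g x))\<^sup>2" for x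
    by (simp add: power2_norm_eq_inner inner_add inner_commute)
  ultimately show ?thesis
    using assms by (auto simp: L2_def)
qed

lemma L2_scaleR:
  assumes "f \<in> L2 \<Omega>"
  shows "(\<lambda>x. c *\<^sub>R f x) \<in> L2 \<Omega>"
  using assms by (auto simp: L2_def power_mult_distrib)

lemma L2_zero: "(\<lambda>x. 0) \<in> L2 \<Omega>"
  by (auto simp: L2_def)

lemma L2_sum:
  assumes "\<And>i. i \<in> I \<Longrightarrow> f i \<in> L2 \<Omega>"
  shows "(\<lambda>x. \<Sum>i\<in>I. f i x) \<in> L2 \<Omega>"
  using assms by (induction I rule: infinite_finite_induct) (auto intro: L2_add L2_zero)

lemma L2_bounded:
  fixes f :: "plane \<Rightarrow> 'b::euclidean_space"
  assumes "\<Omega> \<in> lmeasurable" "f \<in> borel_measurable (lebesgue_on \<Omega>)" "\<And>x. x \<in> \<Omega> \<Longrightarrow> norm (f x) \<le> M"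
  shows "f \<in> L2 \<Omega>"
proof -
  have "integrable (lebesgue_on \<Omega>) (\<lambda>x. (norm (f x))\<^sup>2)"
  proof (rule Bochner_Integration.integrable_bound)
    show "integrable (lebesgue_on \<Omega>) (\<lambda>x. M\<^sup>2)"
      using assms(1) by (intro finite_measure.integrable_const finite_measure_lebesgue_on)
    show "(\<lambda>x. (norm (f x))\<^sup>2) \<in> borel_measurable (lebesgue_on \<Omega>)"
      using assms(2) by auto
    show "AE x in lebesgue_on \<Omega>. norm ((norm (f x))\<^sup>2) \<le> norm (M\<^sup>2)"
    proof (rule AE_I2)
      fix x assume "x \<in> space (lebesgue_on \<Omega>)"
      then have "norm (f x) \<le> M" using assms(3) by auto
      then show "norm ((norm (f x))\<^sup>2) \<le> norm (M\<^sup>2)" by (simp add: power_mono)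
    qed
  qed
  then show ?thesis using assms(2) by (auto simp: L2_def)
qed

lemma ip_commute: "ip \<Omega> f g = ip \<Omega> g f"
  by (simp add: ip_def inner_commute)

lemma ip_add_left:
  assumes "f \<in> L2 \<Omega>" "g \<in> L2 \<Omega>" "h \<in> L2 \<Omega>"
  shows "ip \<Omega> (\<lambda>x. f x + g x) h = ip \<Omega> f h + ip \<Omega> g h"
  using L2_integrable_inner[OF assms(1,3)] L2_integrable_inner[OF assms(2,3)]
  by (simp add: ip_def inner_add_left)

lemma ip_add_right:
  assumes "f \<in> L2 \<Omega>" "g \<in> L2 \<Omega>" "h \<in> L2 \<Omega>"
  shows "ip \<Omega> h (\<lambda>x. f x + g x) = ip \<Omega> h f + ip \<Omega> h g"
  using ip_add_left[OF assms] by (simp add: ip_commute[of \<Omega> h])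

lemma ip_scaleR_left: "ip \<Omega> (\<lambda>x. c *\<^sub>R f x) g = c * ip \<Omega> f g"
  by (simp add: ip_def)

lemma ip_scaleR_right: "ip \<Omega> f (\<lambda>x. c *\<^sub>R g x) = c * ip \<Omega> f g"
  by (simp add: ip_def)

lemma ip_zero_left: "ip \<Omega> (\<lambda>x. 0) g = 0"
  by (simp add: ip_def)

text \<open>Weak divergences are known only up to null sets; this is how an explicit representative
  replaces \<open>wdiv\<close> inside a scalar product.\<close>

lemma ip_cong_AE:
  assumes "f \<in> L2 \<Omega>" "f' \<in> L2 \<Omega>" "g \<in> L2 \<Omega>" "g' \<in> L2 \<Omega>"
    "AE x in lebesgue_on \<Omega>. f x = f' x" "AE x in lebesgue_on \<Omega>. g x = g' x"
  shows "ip \<Omega> f g = ip \<Omega> f' g'"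
  unfolding ip_def
proof (rule integral_cong_AE)
  show "(\<lambda>x. f x \<bullet> g x) \<in> borel_measurable (lebesgue_on \<Omega>)"
    "(\<lambda>x. f' x \<bullet> g' x) \<in> borel_measurable (lebesgue_on \<Omega>)"
    using assms by (auto simp: L2_def)
  show "AE x in lebesgue_on \<Omega>. f x \<bullet> g x = f' x \<bullet> g' x"
    using assms(5,6) by eventually_elim auto
qed

lemma ip_self_nonneg: "ip \<Omega> f f \<ge> 0"
  by (simp add: ip_def)

lemma norm0_nonneg: "norm0 \<Omega> f \<ge> 0"
  by (simp add: norm0_def ip_self_nonneg)

lemma norm0_power2: "(norm0 \<Omega> f)\<^sup>2 = ip \<Omega> f f"
  by (simp add: norm0_def ip_self_nonneg)

lemma norm0_scaleR: "norm0 \<Omega> (\<lambda>x. c *\<^sub>R f x) = \<bar>c\<bar> * norm0 \<Omega> f"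
  by (simp add: norm0_def ip_scaleR_left ip_scaleR_right real_sqrt_mult flip: mult.assoc)

lemma norm0_cong_AE:
  assumes "f \<in> L2 \<Omega>" "g \<in> L2 \<Omega>" "AE x in lebesgue_on \<Omega>. f x = g x"
  shows "norm0 \<Omega> f = norm0 \<Omega> g"
  using ip_cong_AE[OF assms(1,2,1,2,3,3)] by (simp add: norm0_def)

text \<open>\<open>ip\<close> acts on functions and not on classes, so it is only semidefinite, and
  the case \<open>ip \<Omega> g g = 0\<close> does not make \<open>g\<close> vanish. Both cases
  evaluate the same nonnegative quadratic form at suitable points.\<close>

lemma ip_Cauchy_Schwarz:
  assumes "f \<in> L2 \<Omega>" "g \<in> L2 \<Omega>"
  shows "\<bar>ip \<Omega> f g\<bar> \<le> norm0 \<Omega> f * norm0 \<Omega> g"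
proof -
  have exp: "0 \<le> s\<^sup>2 * ip \<Omega> f f + 2 * s * t * ip \<Omega> f g + t\<^sup>2 * ip \<Omega> g g" for s t
  proof -
    have L: "(\<lambda>x. s *\<^sub>R f x) \<in> L2 \<Omega>" "(\<lambda>x. t *\<^sub>R g x) \<in> L2 \<Omega>"
      using assms by (auto intro: L2_scaleR)
    have "0 \<le> ip \<Omega> (\<lambda>x. s *\<^sub>R f x + t *\<^sub>R g x) (\<lambda>x. s *\<^sub>R f x + t *\<^sub>R g x)"
      by (rule ip_self_nonneg)
    also have "\<dots> = s\<^sup>2 * ip \<Omega> f f + 2 * s * t * ip \<Omega> f g + t\<^sup>2 * ip \<Omega> g g"
      using L assms
      by (simp add: ip_add_left ip_add_right L2_add ip_scaleR_left ip_scaleR_right ip_commute[of \<Omega> g f] power2_eq_square algebra_simps)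
    finally show ?thesis .
  qed
  have "(ip \<Omega> f g)\<^sup>2 \<le> ip \<Omega> f f * ip \<Omega> g g"
  proof (cases "ip \<Omega> g g = 0")
    case True
    have "ip \<Omega> f g = 0"
    proof (rule ccontr)
      assume *: "ip \<Omega> f g \<noteq> 0"
      \<comment> \<open>With vanishing coefficient of t squared the form is affine in t, and this t
        gives it the value -1.\<close>
      show False
        using exp[of 1 "- (ip \<Omega> f f + 1) / (2 * ip \<Omega> f g)"] True * by (simp add: field_simps)
    qed
    then show ?thesis using True by simp
  next
    case False
    then have pos: "ip \<Omega> g g > 0" using ip_self_nonneg[of \<Omega> g] by linarith
    \<comment> \<open>This is the minimising choice, scaled by \<open>ip \<Omega> g g\<close> to
      avoid a division.\<close>
    have "0 \<le> ip \<Omega> g g * (ip \<Omega> g g * ip \<Omega> f f - (ip \<Omega> f g)\<^sup>2)"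
      using exp[of "ip \<Omega> g g" "- ip \<Omega> f g"] by (simp add: power2_eq_square algebra_simps)
    then show ?thesis using pos by (simp add: zero_le_mult_iff mult.commute)
  qed
  then have "sqrt ((ip \<Omega> f g)\<^sup>2) \<le> sqrt (ip \<Omega> f f * ip \<Omega> g g)" by (rule real_sqrt_le_mono)
  then show ?thesis by (simp add: norm0_def real_sqrt_mult)
qed

subsection \<open>Test functions and uniqueness of the weak divergence\<close>

lemma Ck_imp_continuous:
  assumes "Ck k f"
  shows "continuous_on UNIV f"
proof (cases k)
  case 0
  then show ?thesis using assms by simp
next
  case (Suc m)
  then obtain G where "\<And>x. GDERIV f x :> G x" using assms by auto
  then show ?thesis
    by (intro continuous_at_imp_continuous_on ballI)
      (auto simp: gderiv_def intro: has_derivative_continuous)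
qed

text \<open>The product and chain rules leave undifferentiated factors behind, which are needed in
  the lower class.\<close>

lemma Ck_SucD: "Ck (Suc k) f \<Longrightarrow> Ck k f"
proof (induction k arbitrary: f)
  case 0
  then show ?case using Ck_imp_continuous[of "Suc 0" f] by (simp del: Ck.simps(2))
next
  case (Suc k)
  then obtain G where G: "\<And>x. GDERIV f x :> G x" "\<And>i. Ck (Suc k) (\<lambda>x. G x $ i)"
    using Ck.simps(2)[of "Suc k" f] by blast
  then show ?case unfolding Ck.simps(2)[of k f] using Suc.IH by blast
qed

lemma Ck_const: "Ck k (\<lambda>x. c)"
proof (induction k arbitrary: c)
  case (Suc k)
  then show ?case by (auto intro!: exI[of _ "\<lambda>x. 0"] GDERIV_const)
qed auto

lemma Ck_add: "Ck k f \<Longrightarrow> Ck k g \<Longrightarrow> Ck k (\<lambda>x. f x + g x)"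
proof (induction k arbitrary: f g)
  case (Suc k)
  then obtain F G where "\<And>x. GDERIV f x :> F x" "\<And>i. Ck k (\<lambda>x. F x $ i)"
    "\<And>x. GDERIV g x :> G x" "\<And>i. Ck k (\<lambda>x. G x $ i)"
    by auto
  then show ?case using Suc.IH
    by (auto intro!: exI[of _ "\<lambda>x. F x + G x"] GDERIV_add)
qed (auto intro: continuous_on_add)

lemma Ck_mult: "Ck k f \<Longrightarrow> Ck k g \<Longrightarrow> Ck k (\<lambda>x. f x * g x)"
proof (induction k arbitrary: f g)
  case (Suc k)
  then obtain F G where *: "\<And>x. GDERIV f x :> F x" "\<And>i. Ck k (\<lambda>x. F x $ i)"
    "\<And>x. GDERIV g x :> G x" "\<And>i. Ck k (\<lambda>x. G x $ i)"
    by auto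
  have "Ck k f" "Ck k g" using Suc.prems by (auto intro: Ck_SucD simp del: Ck.simps)
  then show ?case using Suc.IH *
    by (auto intro!: exI[of _ "\<lambda>x. f x *\<^sub>R G x + g x *\<^sub>R F x"] GDERIV_mult Ck_add)
qed (auto intro: continuous_on_mult)

lemma Ck_prod:
  assumes "\<And>i. i \<in> I \<Longrightarrow> Ck k (f i)"
  shows "Ck k (\<lambda>x. \<Prod>i\<in>I. f i x)"
  using assms by (induction I rule: infinite_finite_induct) (auto intro: Ck_mult Ck_const)

lemma Ck_component: "Ck k (\<lambda>x. x $ i)"
proof (cases k)
  case 0
  then show ?thesis by (simp add: continuous_on_component)
next
  case (Suc m)
  have "GDERIV (\<lambda>x. x $ i) x :> axis i 1" for x :: plane
    by (auto simp: gderiv_def inner_axis intro!: derivative_eq_intros bounded_linear_imp_has_derivative bounded_linear_vec_nth)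
  then show ?thesis using Suc by (auto intro!: exI[of _ "\<lambda>x. axis i 1"] Ck_const)
qed

text \<open>Including the factor \<open>1 / t ^ n\<close> makes the family closed under differentiation up to linear
  combinations.\<close>

definition flat_exp :: "nat \<Rightarrow> real \<Rightarrow> real" where
  "flat_exp n t = (if t \<le> 0 then 0 else inverse t ^ n / exp (inverse t))"

lemma flat_exp_tendsto_0: "(flat_exp n \<longlongrightarrow> 0) (at 0)"
proof -
  have "((\<lambda>t. inverse t ^ n / exp (inverse t)) \<longlongrightarrow> (0::real)) (at_right 0)"
    by (rule filterlim_compose[OF tendsto_power_div_exp_0 filterlim_inverse_at_top_right])
  then have "(flat_exp n \<longlongrightarrow> 0) (at_right 0)"
    by (rule Lim_transform_eventually) (auto simp: flat_exp_def eventually_at_filter)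
  moreover have "(flat_exp n \<longlongrightarrow> 0) (at_left 0)"
    by (rule Lim_transform_eventually[OF tendsto_const]) (auto simp: flat_exp_def eventually_at_filter)
  ultimately show ?thesis by (simp add: filterlim_split_at)
qed

lemma flat_exp_deriv:
  "(flat_exp n has_real_derivative flat_exp (n + 2) t - real n * flat_exp (n + 1) t) (at t)"
proof -
  consider "t < 0" | "t = 0" | "t > 0" by linarith
  then show ?thesis
  proof cases
    case 1
    have "((\<lambda>t. 0) has_real_derivative 0) (at t)" by simp
    then have "(flat_exp n has_real_derivative 0) (at t)"
      by (rule has_field_derivative_transform_within_open[where S="{..<0}"])
        (use 1 in \<open>auto simp: flat_exp_def\<close>)
    then show ?thesis using 1 by (simp add: flat_exp_def)
  next
    case 2
    \<comment> \<open>At 0 the difference quotient only raises the power of 1/h by one, so it is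
      again a member of the family and its limit is known.\<close>
    have "(flat_exp n (0 + h) - flat_exp n 0) / h = flat_exp (n + 1) h" for h
      by (auto simp: flat_exp_def field_simps)
    then have "(flat_exp n has_real_derivative 0) (at 0)"
      using flat_exp_tendsto_0[of "n+1"] unfolding DERIV_def by simp
    then show ?thesis using 2 by (simp add: flat_exp_def)
  next
    case 3
    have "((\<lambda>t. inverse t ^ n * exp (- inverse t)) has_real_derivative
       flat_exp (n + 2) t - real n * flat_exp (n + 1) t) (at t)"
    proof (cases n)
      case (Suc m)
      have "inverse t * inverse t ^ (m - Suc 0) = inverse t ^ m" if "m \<noteq> 0"
        using that by (cases m) auto
      then show ?thesis using 3 Suc by (cases "m = 0") (auto intro!: derivative_eq_intros
          simp: flat_exp_def exp_minus power2_eq_square divide_inverse algebra_simps)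
    qed (use 3 in \<open>auto intro!: derivative_eq_intros
          simp: flat_exp_def exp_minus power2_eq_square divide_inverse algebra_simps\<close>)
    then show ?thesis
      by (rule has_field_derivative_transform_within_open[where S="{0<..}"])
        (use 3 in \<open>auto simp: flat_exp_def exp_minus divide_inverse\<close>)
  qed
qed

lemma Ck_flat_exp: "Ck k h \<Longrightarrow> Ck k (\<lambda>x. flat_exp n (h x))"
proof (induction k arbitrary: n)
  case 0
  have "continuous_on UNIV (flat_exp n)"
    by (auto intro!: continuous_at_imp_continuous_on DERIV_isCont[OF flat_exp_deriv])
  then show ?case using 0
    by (auto intro: continuous_on_compose2)
next
  case (Suc k)
  then obtain H where H: "\<And>x. GDERIV h x :> H x" "\<And>i. Ck k (\<lambda>x. H x $ i)"
    by auto
  have h: "Ck k h" using Suc.prems by (auto intro: Ck_SucD simp del: Ck.simps)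
  have "Ck k (\<lambda>x. (flat_exp (n + 2) (h x) + (- real n) * flat_exp (n + 1) (h x)) * H x $ i)" for i
    by (intro Ck_mult Ck_add Ck_const Suc.IH h H)
  then show ?case
    by (auto intro!: exI[of _ "\<lambda>x. (flat_exp (n + 2) (h x) - real n * flat_exp (n + 1) (h x)) *\<^sub>R H x"]
        GDERIV_DERIV_compose[OF H(1) flat_exp_deriv])
qed

lemma flat_exp_0_bounds: "0 \<le> flat_exp 0 t" "flat_exp 0 t \<le> 1"
  by (auto simp: flat_exp_def divide_simps)

lemma flat_exp_0_limit: "(\<lambda>k. flat_exp 0 (real k * c)) \<longlonglongrightarrow> (if c > 0 then 1 else 0)"
proof (cases "c > 0")
  case True
  have "(\<lambda>k. inverse (real k)) \<longlonglongrightarrow> 0" by (rule lim_inverse_n)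
  then have "(\<lambda>k. 1 / exp (inverse (real k) * inverse c)) \<longlonglongrightarrow> 1 / exp (0 * inverse c)"
    by (intro tendsto_intros) auto
  then have "(\<lambda>k. 1 / exp (inverse (real k) * inverse c)) \<longlonglongrightarrow> 1" by simp
  then have "(\<lambda>k. flat_exp 0 (real k * c)) \<longlonglongrightarrow> 1"
  proof (rule Lim_transform_eventually)
    show "\<forall>\<^sub>F k in sequentially. 1 / exp (inverse (real k) * inverse c) = flat_exp 0 (real k * c)"
      using eventually_gt_at_top[of 0]
    proof eventually_elim
      case (elim k)
      then have "real k * c > 0" using True by simp
      then show ?case by (simp add: flat_exp_def)
    qed
  qed
  then show ?thesis using True by simp
next
  case False
  then have "flat_exp 0 (real k * c) = 0" for k
    by (auto simp: flat_exp_def mult_le_0_iff)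
  then show ?thesis using False by simp
qed

text \<open>Each factor is exp(-1/(k s)) for s > 0 and 0 otherwise, with s the distance to a side.
  As k grows these smooth functions converge boundedly to the indicator of the open box, while all
  their supports stay in the closed box.\<close>

definition box_bump :: "plane \<Rightarrow> plane \<Rightarrow> nat \<Rightarrow> scalar_field" where
  "box_bump a b k x =
     (\<Prod>i\<in>UNIV. flat_exp 0 (real k * (x $ i - a $ i)) * flat_exp 0 (real k * (b $ i - x $ i)))"

lemma box_bump_bounds: "\<bar>box_bump a b k x\<bar> \<le> 1"
proof -
  have "0 \<le> box_bump a b k x" unfolding box_bump_def
    by (intro prod_nonneg) (auto simp: flat_exp_0_bounds)
  moreover have "box_bump a b k x \<le> 1" unfolding box_bump_def
    by (intro prod_le_1 conjI mult_le_one mult_nonneg_nonneg flat_exp_0_bounds)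
  ultimately show ?thesis by simp
qed

lemma box_bump_limit: "(\<lambda>k. box_bump a b k x) \<longlonglongrightarrow> indicator (box a b) x"
proof -
  have "(\<lambda>k. box_bump a b k x) \<longlonglongrightarrow>
     (\<Prod>i\<in>UNIV. (if x $ i - a $ i > 0 then 1 else 0) * (if b $ i - x $ i > 0 then 1 else (0::real)))"
    unfolding box_bump_def by (intro tendsto_prod tendsto_mult flat_exp_0_limit)
  also have "(\<Prod>i\<in>UNIV. (if x $ i - a $ i > 0 then 1 else 0) * (if b $ i - x $ i > 0 then 1 else (0::real)))
      = indicator (box a b) x"
    by (auto simp: indicator_def mem_box_cart prod_eq_1_iff intro!: prod_zero prod.neutral)
  finally show ?thesis .
qed

lemma test_function_box_bump:
  assumes "cbox a b \<subseteq> \<Omega>"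
  shows "test_function \<Omega> (box_bump a b k)"
  unfolding test_function_def
proof (intro conjI allI)
  fix m
  \<comment> \<open>Differences are written as sums with constant multiples, to match the closure
    rules for \<open>Ck\<close>.\<close>
  have "Ck m (\<lambda>x. flat_exp 0 (real k * (x $ i + - a $ i)) * flat_exp 0 (real k * (b $ i + (-1) * x $ i)))" for i
    by (intro Ck_mult Ck_flat_exp Ck_add Ck_const Ck_component)
  then show "Ck m (box_bump a b k)"
    unfolding box_bump_def by (intro Ck_prod) simp
  have "x \<in> cbox a b" if "box_bump a b k x \<noteq> 0" for x
  proof -
    have "flat_exp 0 (real k * (x $ i - a $ i)) \<noteq> 0" "flat_exp 0 (real k * (b $ i - x $ i)) \<noteq> 0" for i
      using that by (auto simp: box_bump_def)
    then have "real k * (x $ i - a $ i) > 0" "real k * (b $ i - x $ i) > 0" for i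
      unfolding flat_exp_def by (metis not_le)+
    then show ?thesis by (auto simp: mem_box_cart zero_less_mult_iff less_imp_le)
  qed
  then have sub: "closure {x. box_bump a b k x \<noteq> 0} \<subseteq> cbox a b"
    by (intro closure_minimal) auto
  then show "compact (closure {x. box_bump a b k x \<noteq> 0})"
    by (meson bounded_cbox bounded_subset closed_closure compact_eq_bounded_closed)
  show "closure {x. box_bump a b k x \<noteq> 0} \<subseteq> \<Omega>"
    using sub assms by blast
qed

text \<open>Box bumps and dominated convergence show that \<open>f\<close> has integral 0 over every
  box whose closure lies in \<open>\<Omega>\<close>. By Lebesgue's differentiation theorem
  \<open>f x\<close> is, for almost every x, the limit of such averages over shrinking
  cubes.\<close>

lemma test_function_orthogonal_imp_AE_zero:
  fixes f :: scalar_field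
  assumes \<Omega>: "open \<Omega>" "\<Omega> \<in> lmeasurable" and f: "f \<in> L2 \<Omega>"
    and orth: "\<And>\<psi>. test_function \<Omega> \<psi> \<Longrightarrow> ip \<Omega> f \<psi> = 0"
  shows "AE x in lebesgue_on \<Omega>. f x = 0"
proof -
  \<comment> \<open>The zero extension is integrable on every box of the plane, as the
    differentiation theorem requires.\<close>
  define F where "F = (\<lambda>x. if x \<in> \<Omega> then f x else 0)"
  have \<Omega>s: "\<Omega> \<in> sets lebesgue" using \<Omega> by auto
  have 1: "(\<lambda>x. 1::real) \<in> L2 \<Omega>" by (rule L2_bounded[OF \<Omega>(2), where M=1]) auto
  have fi: "integrable (lebesgue_on \<Omega>) f"
    using L2_integrable_inner[OF f 1] by simp
  have "F = (\<lambda>x. indicat_real \<Omega> x *\<^sub>R f x)" by (auto simp: F_def)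
  then have "F absolutely_integrable_on UNIV"
    using fi \<Omega>s by (simp add: integrable_restrict_space set_integrable_def)
  then have F_int: "F integrable_on cbox a b" for a b
    using absolutely_integrable_on_subcbox[where f=F and S=UNIV and a=a and b=b] set_lebesgue_integral_eq_integral(1)[of "cbox a b" F]
    by simp
  have zero: "integral (cbox a b) F = 0" if "cbox a b \<subseteq> \<Omega>" for a b
  proof -
    have "box a b \<in> (\<inter>) \<Omega> ` sets lebesgue"
      using that box_subset_cbox[of a b] by (intro image_eqI[of _ _ "box a b"]) auto
    then have box_sets: "box a b \<in> sets (lebesgue_on \<Omega>)" by (simp only: sets_restrict_space)
    have bump: "box_bump a b k \<in> borel_measurable (lebesgue_on \<Omega>)" for k
    proof (rule continuous_imp_measurable_on_sets_lebesgue[OF _ \<Omega>s])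
      have "Ck 0 (box_bump a b k)"
        using test_function_box_bump[OF that, of k] unfolding test_function_def by (rule conjE) (rule spec)
      then show "continuous_on \<Omega> (box_bump a b k)" by (auto intro: continuous_on_subset)
    qed
    have fm: "(\<lambda>x. f x * indicator (box a b) x) \<in> borel_measurable (lebesgue_on \<Omega>)"
      by (intro borel_measurable_times borel_measurable_indicator box_sets L2D(1)[OF f])
    have "(\<lambda>k. LINT x|lebesgue_on \<Omega>. f x * box_bump a b k x)
        \<longlonglongrightarrow> (LINT x|lebesgue_on \<Omega>. f x * indicator (box a b) x)"
    proof (rule integral_dominated_convergence[where w="\<lambda>x. \<bar>f x\<bar>"])
      show "(\<lambda>x. f x * indicator (box a b) x) \<in> borel_measurable (lebesgue_on \<Omega>)"
        by (rule fm)
      show "(\<lambda>x. f x * box_bump a b k x) \<in> borel_measurable (lebesgue_on \<Omega>)" for k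
        using L2D(1)[OF f] bump by auto
      show "integrable (lebesgue_on \<Omega>) (\<lambda>x. \<bar>f x\<bar>)" using fi by auto
      show "AE x in lebesgue_on \<Omega>. (\<lambda>k. f x * box_bump a b k x) \<longlonglongrightarrow> f x * indicator (box a b) x"
        by (intro AE_I2 tendsto_intros box_bump_limit)
      show "AE x in lebesgue_on \<Omega>. norm (f x * box_bump a b k x) \<le> \<bar>f x\<bar>" for k
        by (rule AE_I2) (simp add: abs_mult mult_left_le box_bump_bounds)
    qed
    moreover have "(LINT x|lebesgue_on \<Omega>. f x * box_bump a b k x) = 0" for k
      using orth[OF test_function_box_bump[OF that]] by (simp add: ip_def)
    ultimately have "(LINT x|lebesgue_on \<Omega>. f x * indicator (box a b) x) = 0"
      by (simp add: LIMSEQ_const_iff)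
    moreover have "integrable (lebesgue_on \<Omega>) (\<lambda>x. f x * indicator (box a b) x)"
      by (rule Bochner_Integration.integrable_bound[OF fi fm]) (auto simp: indicator_def)
    ultimately have "integral \<Omega> (\<lambda>x. f x * indicator (box a b) x) = 0"
      using lebesgue_integral_eq_integral[OF _ \<Omega>s, of "\<lambda>x. f x * indicator (box a b) x"] by simp
    moreover have "integral \<Omega> (\<lambda>x. f x * indicator (box a b) x) = integral (\<Omega> \<inter> box a b) F"
    proof -
      have "integral \<Omega> (\<lambda>x. f x * indicator (box a b) x) = integral \<Omega> (\<lambda>x. if x \<in> box a b then F x else 0)"
        by (rule integral_cong) (auto simp: F_def)
      also have "\<dots> = integral (\<Omega> \<inter> box a b) F"
        using integral_restrict_Int[of \<Omega> "box a b" F] by (simp add: Int_commute[of \<Omega>])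
      finally show ?thesis .
    qed
    moreover have "\<Omega> \<inter> box a b = box a b" using that box_subset_cbox by blast
    ultimately show ?thesis by (simp add: integral_open_interval)
  qed
  obtain N where N: "negligible N"
    and lim: "\<And>x e. \<lbrakk>x \<notin> N; 0 < e\<rbrakk> \<Longrightarrow> \<exists>d>0. \<forall>h. 0 < h \<and> h < d \<longrightarrow>
       norm (integral (cbox x (x + h *\<^sub>R One)) F /\<^sub>R h ^ DIM(plane) - F x) < e"
    using integrable_ccontinuous_explicit[of F] F_int by blast
  have "f x = 0" if x: "x \<in> \<Omega>" "x \<notin> N" for x
  proof (rule ccontr)
    assume "f x \<noteq> 0"
    \<comment> \<open>The tolerance |f x| is chosen because an average equal to 0 differs from f x
      by exactly that amount, contradicting the strict inequality.\<close>
    then obtain d where d: "d > 0" "\<And>h. 0 < h \<Longrightarrow> h < d \<Longrightarrow>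
       norm (integral (cbox x (x + h *\<^sub>R One)) F /\<^sub>R h ^ DIM(plane) - F x) < \<bar>f x\<bar>"
      using lim[of x "\<bar>f x\<bar>"] x by auto
    obtain r where r: "r > 0" "cball x r \<subseteq> \<Omega>"
      using \<Omega>(1) x(1) open_contains_cball by blast
    \<comment> \<open>In two dimensions a cube of side h lies within distance 2 h of its corner,
      hence r/2.\<close>
    define h where "h = min (d/2) (r/2)"
    have h: "0 < h" "h < d" "2 * h \<le> r" using d(1) r(1) by (auto simp: h_def)
    have "cbox x (x + h *\<^sub>R One) \<subseteq> cball x r"
    proof
      fix y assume y: "y \<in> cbox x (x + h *\<^sub>R One)"
      have "\<bar>(y - x) \<bullet> b\<bar> \<le> h" if "b \<in> Basis" for b
      proof -
        have "x \<bullet> b \<le> y \<bullet> b" "y \<bullet> b \<le> x \<bullet> b + h * (One \<bullet> b)"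
          using y that by (auto simp: mem_box inner_add_left)
        moreover have "(One::plane) \<bullet> b = 1" using that by simp
        ultimately show ?thesis by (auto simp: inner_diff_left)
      qed
      then have "(\<Sum>b\<in>Basis. \<bar>(y - x) \<bullet> b\<bar>) \<le> of_nat (card (Basis::plane set)) * h"
        by (intro sum_bounded_above) auto
      then have "norm (y - x) \<le> 2 * h" using norm_le_l1[of "y - x"] by simp
      then show "y \<in> cball x r" using h by (simp add: dist_norm norm_minus_commute)
    qed
    then have "integral (cbox x (x + h *\<^sub>R One)) F = 0" using r zero by blast
    then show False using d(2)[OF h(1,2)] x(1) by (simp add: F_def)
  qed
  moreover have "AE x in lebesgue_on \<Omega>. x \<notin> N"
  proof -
    have "AE x in lebesgue. x \<notin> N" using N by (simp add: negligible_iff_null_sets AE_not_in)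
    then show ?thesis using \<Omega>s by (auto simp: AE_restrict_space_iff elim: eventually_mono)
  qed
  ultimately show ?thesis using AE_space by (auto elim!: eventually_elim2)
qed

lemma continuous_compact_support_bounded:
  fixes f :: "'a::euclidean_space \<Rightarrow> 'b::real_normed_vector"
  assumes "continuous_on UNIV f" "compact C" "\<And>x. x \<notin> C \<Longrightarrow> f x = 0"
  obtains M where "M \<ge> 0" "\<And>x. norm (f x) \<le> M"
proof -
  have "bounded (f ` C)"
    using assms by (intro compact_imp_bounded compact_continuous_image) (auto intro: continuous_on_subset)
  then obtain M where "M > 0" "\<And>x. x \<in> C \<Longrightarrow> norm (f x) \<le> M"
    by (auto simp: bounded_pos)
  with assms(3) that[of M] show thesis by force
qed

lemma GDERIV_unique: "GDERIV f x :> a \<Longrightarrow> GDERIV f x :> b \<Longrightarrow> a = b"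
  unfolding gderiv_def by (drule (1) has_derivative_unique) (metis inner_commute vector_eq_ldot)

text \<open>\<open>Ck\<close> provides only some continuous gradient; uniqueness of gradients
  transfers its continuity to the given \<open>G\<close>.\<close>

lemma test_function_gradient:
  assumes "test_function \<Omega> \<psi>" and G: "\<And>x. GDERIV \<psi> x :> G x"
  shows "continuous_on UNIV G" "x \<notin> closure {x. \<psi> x \<noteq> 0} \<Longrightarrow> G x = 0"
proof -
  have "Ck (Suc 0) \<psi>" using assms(1) by (auto simp: test_function_def)
  then obtain G' where G': "\<And>x. GDERIV \<psi> x :> G' x" "\<And>i. continuous_on UNIV (\<lambda>x. G' x $ i)"
    by auto
  have "G' = G" using GDERIV_unique[OF G' (1) G] by auto
  then have "continuous_on UNIV (\<lambda>x. \<chi> i. G x $ i)" using G'(2)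
    by (intro continuous_on_vec_lambda) auto
  then show "continuous_on UNIV G" by simp
  assume x: "x \<notin> closure {x. \<psi> x \<noteq> 0}"
  have "((\<lambda>y. 0) has_derivative (\<lambda>h. 0)) (at x)" by simp
  then have "(\<psi> has_derivative (\<lambda>h. 0)) (at x)"
    by (rule has_derivative_transform_within_open[of _ _ _ _ "- closure {x. \<psi> x \<noteq> 0}"])
      (use x closure_subset[of "{x. \<psi> x \<noteq> 0}"] in auto)
  then have "GDERIV \<psi> x :> 0" by (simp add: gderiv_def)
  then show "G x = 0" using GDERIV_unique[OF G] by blast
qed

lemma test_function_L2:
  assumes "test_function \<Omega> \<psi>" "\<And>x. GDERIV \<psi> x :> G x" "\<Omega> \<in> lmeasurable"
  shows "\<psi> \<in> L2 \<Omega>" "G \<in> L2 \<Omega>"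
proof -
  have \<Omega>s: "\<Omega> \<in> sets lebesgue" using assms(3) by auto
  have C: "compact (closure {x. \<psi> x \<noteq> 0})" and "Ck 0 \<psi>" using assms(1) by (auto simp: test_function_def)
  then have c: "continuous_on UNIV \<psi>" by simp
  obtain M where "\<And>x. norm (\<psi> x) \<le> M"
  proof (rule continuous_compact_support_bounded[OF c C])
    show "\<psi> x = 0" if "x \<notin> closure {x. \<psi> x \<noteq> 0}" for x
      using that closure_subset[of "{x. \<psi> x \<noteq> 0}"] by blast
  qed blast
  then show "\<psi> \<in> L2 \<Omega>"
    by (intro L2_bounded[OF assms(3)] continuous_imp_measurable_on_sets_lebesgue[OF _ \<Omega>s] continuous_on_subset[OF c]) auto
  note g = test_function_gradient[OF assms(1,2)]
  obtain M where "\<And>x. norm (G x) \<le> M"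
    using continuous_compact_support_bounded[OF g(1) C] g(2) by blast
  then show "G \<in> L2 \<Omega>"
    by (intro L2_bounded[OF assms(3)] continuous_imp_measurable_on_sets_lebesgue[OF _ \<Omega>s] continuous_on_subset[OF g(1)]) auto
qed

lemma test_function_has_gradient:
  assumes "test_function \<Omega> \<psi>"
  obtains G where "\<And>x. GDERIV \<psi> x :> G x"
proof -
  have "Ck (Suc 0) \<psi>" using assms by (auto simp: test_function_def)
  then show thesis using that by auto
qed

lemma has_weak_div_unique:
  assumes \<Omega>: "open \<Omega>" "\<Omega> \<in> lmeasurable" and "g \<in> L2 \<Omega>" "g' \<in> L2 \<Omega>"
    and "has_weak_div \<Omega> q g" "has_weak_div \<Omega> q g'"
  shows "AE x in lebesgue_on \<Omega>. g x = g' x"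
proof -
  have m: "(\<lambda>x. (-1) *\<^sub>R g' x) \<in> L2 \<Omega>" using assms(4) by (rule L2_scaleR)
  have "AE x in lebesgue_on \<Omega>. g x + (-1) *\<^sub>R g' x = 0"
  proof (rule test_function_orthogonal_imp_AE_zero[OF \<Omega>])
    show "(\<lambda>x. g x + (-1) *\<^sub>R g' x) \<in> L2 \<Omega>" using assms(3) m by (rule L2_add)
    fix \<psi> assume \<psi>: "test_function \<Omega> \<psi>"
    then obtain G where G: "\<And>x. GDERIV \<psi> x :> G x" using test_function_has_gradient by blast
    have "ip \<Omega> g \<psi> = ip \<Omega> g' \<psi>"
    proof -
      have "ip \<Omega> q G = - ip \<Omega> g \<psi>" "ip \<Omega> q G = - ip \<Omega> g' \<psi>"
        using assms(5,6) \<psi> G unfolding has_weak_div_def by blast+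
      then show ?thesis by simp
    qed
    then show "ip \<Omega> (\<lambda>x. g x + (-1) *\<^sub>R g' x) \<psi> = 0"
      unfolding ip_add_left[OF assms(3) m test_function_L2(1)[OF \<psi> G \<Omega>(2)]] ip_scaleR_left by simp
  qed
  then show ?thesis by simp
qed

section \<open>Linearity of the weak divergence and the chosen representative\<close>

lemma has_weak_div_scaleR:
  "has_weak_div \<Omega> q g \<Longrightarrow> has_weak_div \<Omega> (\<lambda>x. c *\<^sub>R q x) (\<lambda>x. c *\<^sub>R g x)"
  unfolding has_weak_div_def ip_scaleR_left by simp

lemma has_weak_div_add:
  assumes "\<Omega> \<in> lmeasurable" "q \<in> L2 \<Omega>" "q' \<in> L2 \<Omega>" "g \<in> L2 \<Omega>" "g' \<in> L2 \<Omega>"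
    "has_weak_div \<Omega> q g" "has_weak_div \<Omega> q' g'"
  shows "has_weak_div \<Omega> (\<lambda>x. q x + q' x) (\<lambda>x. g x + g' x)"
  unfolding has_weak_div_def
proof (intro allI impI)
  fix \<psi> G assume *: "test_function \<Omega> \<psi> \<and> (\<forall>x. GDERIV \<psi> x :> G x)"
  then have L: "\<psi> \<in> L2 \<Omega>" "G \<in> L2 \<Omega>" using test_function_L2[OF _ _ assms(1)] by blast+
  have "ip \<Omega> q G = - ip \<Omega> g \<psi>" "ip \<Omega> q' G = - ip \<Omega> g' \<psi>"
    using assms(6,7) * unfolding has_weak_div_def by blast+
  then show "ip \<Omega> (\<lambda>x. q x + q' x) G = - ip \<Omega> (\<lambda>x. g x + g' x) \<psi>"
    using L by (simp add: ip_add_left assms(2-5))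
qed

lemma has_weak_div_zero: "has_weak_div \<Omega> (\<lambda>x. 0) (\<lambda>x. 0)"
  by (simp add: has_weak_div_def ip_zero_left)

lemma wdiv_props:
  assumes "q \<in> Hdiv \<Omega>"
  shows "wdiv \<Omega> q \<in> L2 \<Omega>" "has_weak_div \<Omega> q (wdiv \<Omega> q)"
proof -
  have "\<exists>g. g \<in> L2 \<Omega> \<and> has_weak_div \<Omega> q g" using assms by (auto simp: Hdiv_def)
  then have "wdiv \<Omega> q \<in> L2 \<Omega> \<and> has_weak_div \<Omega> q (wdiv \<Omega> q)" unfolding wdiv_def by (rule someI_ex)
  then show "wdiv \<Omega> q \<in> L2 \<Omega>" "has_weak_div \<Omega> q (wdiv \<Omega> q)" by auto
qed

lemma Hdiv_L2: "q \<in> Hdiv \<Omega> \<Longrightarrow> q \<in> L2 \<Omega>"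
  by (simp add: Hdiv_def)

lemma Hdiv_scaleR: "q \<in> Hdiv \<Omega> \<Longrightarrow> (\<lambda>x. c *\<^sub>R q x) \<in> Hdiv \<Omega>"
  unfolding Hdiv_def by (blast intro: L2_scaleR has_weak_div_scaleR)

lemma Hdiv_sum:
  assumes "\<Omega> \<in> lmeasurable" "\<And>i. i \<in> I \<Longrightarrow> q i \<in> Hdiv \<Omega>"
  shows "(\<lambda>x. \<Sum>i\<in>I. q i x) \<in> Hdiv \<Omega>"
  using assms(2)
proof (induction I rule: infinite_finite_induct)
  case (insert i I)
  then have "q i \<in> Hdiv \<Omega>" "(\<lambda>x. \<Sum>i\<in>I. q i x) \<in> Hdiv \<Omega>" by auto
  then obtain g g' where g: "g \<in> L2 \<Omega>" "g' \<in> L2 \<Omega>" "has_weak_div \<Omega> (q i) g"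
    "has_weak_div \<Omega> (\<lambda>x. \<Sum>i\<in>I. q i x) g'" and L: "q i \<in> L2 \<Omega>" "(\<lambda>x. \<Sum>i\<in>I. q i x) \<in> L2 \<Omega>"
    by (auto simp: Hdiv_def)
  have "(\<lambda>x. q i x + (\<Sum>i\<in>I. q i x)) \<in> Hdiv \<Omega>"
    using has_weak_div_add[OF assms(1) L g] L2_add[OF L] L2_add[OF g(1,2)] by (auto simp: Hdiv_def)
  then show ?case using insert(1,2) by simp
qed (auto simp: Hdiv_def intro!: L2_zero bexI[of _ "\<lambda>x. 0"] has_weak_div_zero)

text \<open>The link between the choice made in \<open>wdiv\<close> and a divergence that has been
  computed explicitly.\<close>

lemma wdiv_AE_eq:
  assumes "open \<Omega>" "\<Omega> \<in> lmeasurable" "q \<in> L2 \<Omega>" "g \<in> L2 \<Omega>" "has_weak_div \<Omega> q g"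
  shows "AE x in lebesgue_on \<Omega>. wdiv \<Omega> q x = g x"
proof -
  have "q \<in> Hdiv \<Omega>" using assms by (auto simp: Hdiv_def)
  then show ?thesis using has_weak_div_unique[OF assms(1,2) _ assms(4) _ assms(5)] wdiv_props by blast
qed

subsection \<open>The divergence theorem on a triangle\<close>

lemma integrable_continuous_compact:
  fixes f :: "'a::euclidean_space \<Rightarrow> 'b::euclidean_space"
  assumes "compact K" "continuous_on K f"
  shows "integrable (lebesgue_on K) f" "f absolutely_integrable_on K" "f integrable_on K"
    "integral\<^sup>L (lebesgue_on K) f = integral K f"
proof -
  have K: "K \<in> lmeasurable" "K \<in> sets lebesgue" using assms(1) lmeasurable_compact by auto
  have "bounded (f ` K)" using assms compact_continuous_image compact_imp_bounded by blast
  then obtain M where "\<And>x. x \<in> K \<Longrightarrow> norm (f x) \<le> M" by (auto simp: bounded_iff)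
  then show 1: "integrable (lebesgue_on K) f"
    by (intro Bochner_Integration.integrable_bound[OF finite_measure.integrable_const[OF finite_measure_lebesgue_on[OF K(1)], of M]]
        continuous_imp_measurable_on_sets_lebesgue assms K(2)) (fastforce intro!: AE_I2)
  then show "f absolutely_integrable_on K"
    using K(2) by (simp add: integrable_restrict_space set_integrable_def)
  then show "f integrable_on K" using absolutely_integrable_on_def by blast
  show "integral\<^sup>L (lebesgue_on K) f = integral K f"
    using 1 K(2) by (rule lebesgue_integral_eq_integral)
qed

lemma integral_affine_image:
  fixes f :: "plane \<Rightarrow> real" and A :: "plane \<Rightarrow> plane"
  assumes A: "linear A" "inj A" and S: "compact S" and f: "continuous_on UNIV f"
  shows "integral ((\<lambda>x. c + A x) ` S) f = \<bar>det (matrix A)\<bar> * integral S (\<lambda>x. f (c + A x))"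
proof -
  let ?g = "\<lambda>x. c + A x"
  \<comment> \<open>The change of variables formula applied below concerns functions with values in
    a Cartesian power, so the scalar integrand passes through \<open>real^1\<close>.\<close>
  define F :: "plane \<Rightarrow> real^1" where "F = (\<lambda>x. vec (f x))"
  have cA: "continuous_on X A" for X using A(1) by (simp add: linear_continuous_on linear_linear)
  have cg: "continuous_on X ?g" for X by (intro continuous_intros cA)
  have F: "continuous_on X F" for X unfolding F_def vec_def
    by (intro continuous_on_vec_lambda continuous_on_subset[OF f]) auto
  have S': "S \<in> sets lebesgue" using S lmeasurable_compact by auto
  have gS: "compact (?g ` S)" using S cg by (rule compact_continuous_image[rotated])
  have "(\<lambda>x. \<bar>det (matrix A)\<bar> *\<^sub>R F (?g x)) absolutely_integrable_on S \<and>
      integral S (\<lambda>x. \<bar>det (matrix A)\<bar> *\<^sub>R F (?g x)) = integral (?g ` S) F"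
  proof (subst has_absolute_integral_change_of_variables[OF S', where g' = "\<lambda>x. A"])
    show "(?g has_derivative A) (at x within S)" for x
      using A(1) by (auto intro!: derivative_eq_intros bounded_linear_imp_has_derivative simp: linear_linear)
    show "inj_on ?g S" using A(2) by (auto simp: inj_on_def)
    show "F absolutely_integrable_on ?g ` S \<and> integral (?g ` S) F = integral (?g ` S) F"
      using integrable_continuous_compact(2)[OF gS F] by simp
  qed
  then have eq: "integral S (\<lambda>x. \<bar>det (matrix A)\<bar> *\<^sub>R F (?g x)) $ 1 = integral (?g ` S) F $ 1" by simp
  have "(\<lambda>x. \<bar>det (matrix A)\<bar> *\<^sub>R F (?g x)) integrable_on S"
    by (intro integrable_continuous_compact(3)[OF S] continuous_intros continuous_on_compose2[OF F[of UNIV] cg]) auto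
  moreover have "F integrable_on (?g ` S)"
    by (intro integrable_continuous_compact(3)[OF gS] F)
  ultimately have "integral S (\<lambda>x. \<bar>det (matrix A)\<bar> * f (?g x)) = integral (?g ` S) f"
    using eq by (subst (asm) (1 2) integral_component_eq_cart[symmetric]) (auto simp: F_def)
  then show ?thesis by simp
qed

lemma measure_affine_image:
  fixes A :: "plane \<Rightarrow> plane"
  assumes "linear A" "inj A" "compact S"
  shows "measure lebesgue ((\<lambda>x. c + A x) ` S) = \<bar>det (matrix A)\<bar> * measure lebesgue S"
proof -
  have "compact ((\<lambda>x. c + A x) ` S)"
    using assms by (intro compact_continuous_image continuous_intros linear_continuous_on) (auto simp: linear_linear)
  then have "(\<lambda>x. c + A x) ` S \<in> lmeasurable" "S \<in> lmeasurable"
    using assms(3) lmeasurable_compact by auto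
  then show ?thesis
    using integral_affine_image[OF assms, of "\<lambda>x. 1" c] by (simp add: lmeasure_integral)
qed

lemma det_matrix_scaleR_plane: "det (matrix ((*\<^sub>R) c :: plane \<Rightarrow> plane)) = c\<^sup>2"
  by (simp add: matrix_def det_2 axis_def power2_eq_square)

lemma GDERIV_imp_continuous_on: "(\<And>x. GDERIV f x :> G x) \<Longrightarrow> continuous_on X f"
  by (intro continuous_at_imp_continuous_on ballI) (auto simp: gderiv_def intro: has_derivative_continuous)

lemma GDERIV_Lipschitz:
  fixes f :: "'a::euclidean_space \<Rightarrow> real"
  assumes "convex K" "\<And>x. GDERIV f x :> G x" "\<And>x. x \<in> K \<Longrightarrow> norm (G x) \<le> B" "x \<in> K" "y \<in> K"
  shows "\<bar>f x - f y\<bar> \<le> B * norm (x - y)"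
proof -
  have "norm (f x - f y) \<le> B * norm (x - y)"
  proof (rule differentiable_bound[OF assms(1) _ _ assms(4,5)])
    show "(f has_derivative (\<lambda>h. h \<bullet> G z)) (at z within K)" for z
      using assms(2)[of z] by (simp add: gderiv_def has_derivative_at_withinI)
    show "onorm (\<lambda>h. h \<bullet> G z) \<le> B" if "z \<in> K" for z
    proof (rule onorm_le)
      fix h :: 'a
      have "norm (h \<bullet> G z) \<le> norm h * norm (G z)" by (simp add: Cauchy_Schwarz_ineq2)
      also have "\<dots> \<le> B * norm h" using assms(3)[OF that] by (simp add: mult.commute[of B] mult_left_mono)
      finally show "norm (h \<bullet> G z) \<le> B * norm h" .
    qed
  qed
  then show ?thesis by simp
qed

text \<open>The integral below is the derivative at \<open>\<lambda> = 1\<close> of the integral of \<open>f\<close> over the shrunken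
  cone \<open>W + \<lambda>(K - W)\<close>; as \<open>f\<close> vanishes on the base, the part cut off contributes
  \<open>O((1 - \<lambda>)\<^sup>2)\<close>.\<close>

lemma cone_divergence_integral_zero:
  fixes f :: "plane \<Rightarrow> real" and G :: "plane \<Rightarrow> plane"
  assumes f: "\<And>x. GDERIV f x :> G x" and G: "continuous_on UNIV G"
    and K: "compact K" "convex K" and a: "a \<subseteq> K"
    and cone: "\<And>x. x \<in> K \<Longrightarrow> \<exists>e\<in>a. \<exists>s\<in>{0..1}. x = W + s *\<^sub>R (e - W)"
    and W: "W \<in> K" and f0: "\<And>x. x \<in> a \<Longrightarrow> f x = 0"
  shows "integral K (\<lambda>x. (x - W) \<bullet> G x + 2 * f x) = 0"
proof -
  have cf: "continuous_on UNIV f"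
    using f by (rule GDERIV_imp_continuous_on)
  obtain B where B: "B \<ge> 0" "\<And>x. x \<in> K \<Longrightarrow> norm (G x) \<le> B"
  proof -
    have "bounded (G ` K)"
      using G K(1) by (intro compact_imp_bounded compact_continuous_image) (auto intro: continuous_on_subset)
    then obtain B where "B > 0" "\<And>x. x \<in> K \<Longrightarrow> norm (G x) \<le> B" by (auto simp: bounded_pos)
    then show thesis using that[of B] by auto
  qed
  obtain d where d: "d \<ge> 0" "\<And>x. x \<in> K \<Longrightarrow> norm (x - W) \<le> d"
  proof -
    have "bounded ((\<lambda>x. x - W) ` K)"
      using K(1) by (intro compact_imp_bounded compact_continuous_image continuous_intros)
    then obtain d where "d > 0" "\<And>x. x \<in> K \<Longrightarrow> norm (x - W) \<le> d" by (auto simp: bounded_pos)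
    then show thesis using that[of d] by auto
  qed
  have Lip: "\<bar>f x - f y\<bar> \<le> B * norm (x - y)" if "x \<in> K" "y \<in> K" for x y
    using GDERIV_Lipschitz[OF K(2) f B(2) that] by simp
  \<comment> \<open>A sequence tending to 1 from below that starts at 1/2: the scaling by
    \<open>l k\<close> has to be injective, and divisions by \<open>l k\<close> and
    \<open>l k - 1\<close> occur.\<close>
  define l where "l = (\<lambda>k. 1 - 1 / (real k + 2))"
  have l: "0 < l k" "l k < 1" for k by (auto simp: l_def field_simps)
  have "(\<lambda>k. 1 / (real k + 2)) \<longlonglongrightarrow> 0"
    using LIMSEQ_ignore_initial_segment[OF lim_inverse_n[where 'a=real], of 2]
    by (simp add: inverse_eq_divide add.commute)
  then have "l \<longlonglongrightarrow> 1 - 0" unfolding l_def by (intro tendsto_diff tendsto_const)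
  then have l_lim: "l \<longlonglongrightarrow> 1" by simp
  define g where "g = (\<lambda>t x. W + t *\<^sub>R (x - W))"
  have gK: "g (l k) x \<in> K" if "x \<in> K" for k x
  proof -
    have "(1 - l k) *\<^sub>R W + l k *\<^sub>R x \<in> K"
      using K(2) W that l[of k] by (intro convexD) auto
    then show ?thesis by (simp add: g_def algebra_simps)
  qed
  have cg: "continuous_on X (\<lambda>x. f (g t x))" for X t
    unfolding g_def by (intro continuous_on_compose2[OF cf] continuous_intros) auto
  define \<phi> where "\<phi> = (\<lambda>k. integral K (\<lambda>x. f (g (l k) x)))"
  define I where "I = integral K f"
  \<comment> \<open>Differentiation under the integral sign at t = 1; the Lipschitz constant
    \<open>B\<close> of \<open>f\<close> and the radius \<open>d\<close> of \<open>K\<close> about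
    \<open>W\<close> dominate the difference quotients.\<close>
  have quot: "(\<lambda>k. (\<phi> k - I) / (l k - 1)) \<longlonglongrightarrow> integral K (\<lambda>x. (x - W) \<bullet> G x)"
  proof -
    have "(\<lambda>k. LINT x|lebesgue_on K. (f (g (l k) x) - f x) / (l k - 1))
       \<longlonglongrightarrow> (LINT x|lebesgue_on K. (x - W) \<bullet> G x)"
    proof (rule integral_dominated_convergence[where w = "\<lambda>x. B * d"])
      have K': "K \<in> sets lebesgue" using K(1) lmeasurable_compact by auto
      show "(\<lambda>x. (x - W) \<bullet> G x) \<in> borel_measurable (lebesgue_on K)"
        by (intro continuous_imp_measurable_on_sets_lebesgue[OF _ K'] continuous_intros continuous_on_subset[OF G]) auto
      show "(\<lambda>x. (f (g (l k) x) - f x) / (l k - 1)) \<in> borel_measurable (lebesgue_on K)" for k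
        using l[of k]
        by (intro continuous_imp_measurable_on_sets_lebesgue[OF _ K'] continuous_intros cg continuous_on_subset[OF cf]) auto
      show "integrable (lebesgue_on K) (\<lambda>x. B * d)"
        by (intro integrable_continuous_compact K continuous_intros)
      show "AE x in lebesgue_on K. (\<lambda>k. (f (g (l k) x) - f x) / (l k - 1)) \<longlonglongrightarrow> (x - W) \<bullet> G x"
      proof (rule AE_I2)
        fix x
        have "((\<lambda>t. f (g t x)) has_derivative (\<lambda>h. (h *\<^sub>R (x - W)) \<bullet> G x)) (at 1)"
        proof -

          have "((\<lambda>t. g t x) has_derivative (\<lambda>h. h *\<^sub>R (x - W))) (at 1)"
            unfolding g_def by (auto intro!: derivative_eq_intros)
          moreover have "(f has_derivative (\<lambda>h. h \<bullet> G x)) (at (g 1 x))"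
            using f[of x] by (simp add: gderiv_def g_def)
          ultimately show ?thesis by (rule has_derivative_compose)
        qed
        then have "((\<lambda>t. f (g t x)) has_real_derivative (x - W) \<bullet> G x) (at 1)"
          by (simp add: has_field_derivative_def mult.commute[of _ "(x - W) \<bullet> G x"])
        then have "((\<lambda>t. (f (g t x) - f (g 1 x)) / (t - 1)) \<longlongrightarrow> (x - W) \<bullet> G x) (at 1)"
          by (simp add: has_field_derivative_iff)
        moreover have "filterlim l (at 1) sequentially"
          using l_lim l(2) by (auto simp: filterlim_at less_imp_neq)
        ultimately have "(\<lambda>k. (f (g (l k) x) - f (g 1 x)) / (l k - 1)) \<longlonglongrightarrow> (x - W) \<bullet> G x"
          by (rule filterlim_compose)
        then show "(\<lambda>k. (f (g (l k) x) - f x) / (l k - 1)) \<longlonglongrightarrow> (x - W) \<bullet> G x"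
          by (simp add: g_def)
      qed
      show "AE x in lebesgue_on K. norm ((f (g (l k) x) - f x) / (l k - 1)) \<le> B * d" for k
      proof (rule AE_I2)
        fix x assume "x \<in> space (lebesgue_on K)"
        then have x: "x \<in> K" by simp
        have "g (l k) x - x = (l k - 1) *\<^sub>R (x - W)" by (simp add: g_def algebra_simps)
        then have "\<bar>f (g (l k) x) - f x\<bar> \<le> B * ((1 - l k) * norm (x - W))"
          using Lip[OF gK[OF x, of k] x] l[of k] by simp
        also have "\<dots> \<le> B * ((1 - l k) * d)"
          using d(2)[OF x] B(1) l[of k] by (intro mult_left_mono) auto
        also have "\<dots> = (B * d) * (1 - l k)" by simp
        finally show "norm ((f (g (l k) x) - f x) / (l k - 1)) \<le> B * d"
          using l[of k] by (simp add: abs_minus_commute[of "l k" 1] pos_divide_le_eq)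
      qed
    qed
    moreover have "(LINT x|lebesgue_on K. (f (g (l k) x) - f x) / (l k - 1)) = (\<phi> k - I) / (l k - 1)" for k
      unfolding \<phi>_def I_def
      by (simp add: integrable_continuous_compact[OF K(1)] cg continuous_on_subset[OF cf])
    moreover have "(LINT x|lebesgue_on K. (x - W) \<bullet> G x) = integral K (\<lambda>x. (x - W) \<bullet> G x)"
      by (intro integrable_continuous_compact K continuous_intros continuous_on_subset[OF G]) auto
    ultimately show ?thesis using less_imp_neq[OF l(2)] by simp
  qed
  \<comment> \<open>Two small factors meet: the part cut off has the area fraction
    \<open>1 - (l k)\<^sup>2\<close>, and \<open>f\<close> is at most
    \<open>B * d * (1 - l k)\<close> on it, since each of its points is close to the base, where
    \<open>f\<close> vanishes.\<close>
  have cut: "\<bar>I - (l k)\<^sup>2 * \<phi> k\<bar> \<le> B * d * (1 - l k) * (measure lebesgue K * (1 - (l k)\<^sup>2))" for k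
  proof -
    have inj: "inj ((*\<^sub>R) (l k) :: plane \<Rightarrow> plane)" using l[of k] by (simp add: inj_on_def)
    have geq: "g (l k) = (\<lambda>x. (W - l k *\<^sub>R W) + l k *\<^sub>R x)" by (auto simp: g_def algebra_simps)
    define Kl where "Kl = g (l k) ` K"
    have sub: "Kl \<subseteq> K" using gK by (auto simp: Kl_def)
    have cKl: "compact Kl" unfolding Kl_def g_def
      by (intro compact_continuous_image continuous_intros K)
    have m: "K \<in> lmeasurable" "Kl \<in> lmeasurable" using K(1) cKl lmeasurable_compact by auto
    have iK: "f integrable_on K" "f integrable_on Kl"
      using K(1) cKl by (auto intro!: integrable_continuous_compact continuous_on_subset[OF cf])
    have int: "integral Kl f = (l k)\<^sup>2 * \<phi> k"
      unfolding Kl_def \<phi>_def geq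
      by (subst integral_affine_image[OF _ inj K(1) cf]) (auto simp: det_matrix_scaleR_plane linear_scaleR)
    have mKl: "measure lebesgue Kl = (l k)\<^sup>2 * measure lebesgue K"
      unfolding Kl_def geq
      by (subst measure_affine_image[OF _ inj K(1)]) (auto simp: det_matrix_scaleR_plane linear_scaleR)
    have bound: "norm (f x) \<le> B * d * (1 - l k)" if x: "x \<in> K - Kl" for x
    proof -
      obtain e s where e: "e \<in> a" "s \<in> {0..1}" "x = W + s *\<^sub>R (e - W)"
        using cone x by blast
      then have eK: "e \<in> K" using a by blast
      \<comment> \<open>A point with cone parameter s \<le> l k would be the image under the
        shrinking map of the point of \<open>K\<close> with parameter s / l k.\<close>
      have "s > l k"
      proof (rule ccontr)
        assume "\<not> l k < s"
        then have s: "0 \<le> s / l k" "s / l k \<le> 1" using e(2) l[of k] by auto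
        have "(1 - s / l k) *\<^sub>R W + (s / l k) *\<^sub>R e \<in> K"
          using K(2) W eK s by (intro convexD) auto
        moreover have "g (l k) ((1 - s / l k) *\<^sub>R W + (s / l k) *\<^sub>R e) = x"
        proof -
          have "(1 - s / l k) *\<^sub>R W + (s / l k) *\<^sub>R e - W = (s / l k) *\<^sub>R (e - W)" by (simp add: algebra_simps)
          then show ?thesis using l[of k] e(3) by (simp add: g_def)
        qed
        ultimately have "x \<in> Kl" unfolding Kl_def by force
        then show False using x by blast
      qed
      have "x - e = (s - 1) *\<^sub>R (e - W)" using e(3) by (simp add: algebra_simps)
      then have "norm (x - e) = (1 - s) * norm (e - W)" using e(2) by simp
      also have "\<dots> \<le> (1 - l k) * d"
        using \<open>s > l k\<close> d(2)[OF eK] e(2) l[of k] by (intro mult_mono) auto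
      finally have "B * norm (x - e) \<le> B * ((1 - l k) * d)" using B(1) by (rule mult_left_mono)
      moreover have "\<bar>f x - f e\<bar> \<le> B * norm (x - e)" using Lip x eK by blast
      ultimately show ?thesis using f0[OF e(1)] by (simp add: algebra_simps)
    qed
    have "integral (K - Kl) f = I - (l k)\<^sup>2 * \<phi> k"
      using sub by (subst integral_setdiff[OF iK]) (auto simp: int I_def Diff_eq_empty_iff[THEN iffD2])
    moreover have "norm (integral (K - Kl) f) \<le> integral (K - Kl) (\<lambda>x. B * d * (1 - l k))"
    proof (rule integral_norm_bound_integral[OF _ _ bound])
      show "f integrable_on K - Kl"
        using sub by (intro integrable_setdiff[OF integrable_integral integrable_integral] iK)
          (auto simp: Diff_eq_empty_iff[THEN iffD2])
      show "(\<lambda>x. B * d * (1 - l k)) integrable_on K - Kl"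
        using m by (intro integrable_on_const) auto
    qed
    moreover have "integral (K - Kl) (\<lambda>x. B * d * (1 - l k)) = B * d * (1 - l k) * measure lebesgue (K - Kl)"
      using m lmeasure_integral[of "K - Kl"] integral_mult_right[of "K - Kl" "B * d * (1 - l k)" "\<lambda>x. 1"]
      by (simp add: fmeasurable.Diff)
    moreover have "measure lebesgue (K - Kl) = measure lebesgue K * (1 - (l k)\<^sup>2)"
      using m sub by (subst measurable_measure_Diff) (auto simp: mKl algebra_simps)
    ultimately show ?thesis by (simp only: real_norm_def)
  qed
  have "(\<lambda>k. ((l k)\<^sup>2 * \<phi> k - I) / (l k - 1)) \<longlonglongrightarrow> 0"
  proof (rule Lim_null_comparison)
    show "(\<lambda>k. B * d * (measure lebesgue K * (1 - (l k)\<^sup>2))) \<longlonglongrightarrow> 0"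
      using l_lim by (auto intro!: tendsto_eq_intros)
    show "\<forall>\<^sub>F k in sequentially. norm (((l k)\<^sup>2 * \<phi> k - I) / (l k - 1))
        \<le> B * d * (measure lebesgue K * (1 - (l k)\<^sup>2))"
    proof (intro always_eventually allI)
      fix k
      show "norm (((l k)\<^sup>2 * \<phi> k - I) / (l k - 1)) \<le> B * d * (measure lebesgue K * (1 - (l k)\<^sup>2))"
      proof -
        have "norm (((l k)\<^sup>2 * \<phi> k - I) / (l k - 1)) = \<bar>I - (l k)\<^sup>2 * \<phi> k\<bar> / (1 - l k)"
          using l[of k] by (simp add: abs_minus_commute[of I] abs_divide)
        also have "\<dots> \<le> B * d * (measure lebesgue K * (1 - (l k)\<^sup>2))"
          using l[of k] cut[of k] by (subst pos_divide_le_eq) (simp_all add: mult_ac)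
        finally show ?thesis .
      qed
    qed
  qed
  \<comment> \<open>The same quotient again, now by the product rule for
    \<open>(l k)\<^sup>2 * \<phi> k\<close>: the derivative of the square at 1 contributes 2 I.
    Comparing the two limits gives the claim.\<close>
  moreover have "(\<lambda>k. ((l k)\<^sup>2 * \<phi> k - I) / (l k - 1)) \<longlonglongrightarrow> integral K (\<lambda>x. (x - W) \<bullet> G x) + 2 * I"
  proof -
    have "((l k)\<^sup>2 * \<phi> k - I) / (l k - 1) = (l k)\<^sup>2 * ((\<phi> k - I) / (l k - 1)) + (l k + 1) * I" for k
    proof -
      have ne: "l k - 1 \<noteq> 0" using l[of k] by simp
      have "(l k)\<^sup>2 * \<phi> k - I = (l k)\<^sup>2 * (\<phi> k - I) + (l k + 1) * I * (l k - 1)"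
        by (simp add: power2_eq_square algebra_simps)
      then show ?thesis using ne by (simp add: add_divide_distrib)
    qed
    moreover have "(\<lambda>k. (l k)\<^sup>2 * ((\<phi> k - I) / (l k - 1)) + (l k + 1) * I)
        \<longlonglongrightarrow> 1\<^sup>2 * integral K (\<lambda>x. (x - W) \<bullet> G x) + (1 + 1) * I"
      by (intro tendsto_intros l_lim quot)
    ultimately show ?thesis by simp
  qed
  ultimately have "integral K (\<lambda>x. (x - W) \<bullet> G x) + 2 * I = 0" using LIMSEQ_unique by blast
  moreover have "integral K (\<lambda>x. (x - W) \<bullet> G x + 2 * f x) = integral K (\<lambda>x. (x - W) \<bullet> G x) + 2 * I"
    unfolding I_def
    by (subst integral_add)
      (auto intro!: integrable_continuous_compact K continuous_intros continuous_on_subset[OF G] continuous_on_subset[OF cf])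
  ultimately show ?thesis by simp
qed

text \<open>Twice the signed area of the triangle spanned by \<open>u\<close> and \<open>v\<close>;
  orientation and nondegeneracy are expressed by its sign.\<close>

definition cross2 :: "plane \<Rightarrow> plane \<Rightarrow> real" where
  "cross2 u v = u $ 1 * v $ 2 - u $ 2 * v $ 1"

lemma cross2_diff_right: "cross2 u (v - v') = cross2 u v - cross2 u v'"
  and cross2_scaleR_left: "cross2 (c *\<^sub>R u) v = c * cross2 u v"
  and cross2_scaleR_right: "cross2 u (c *\<^sub>R v) = c * cross2 u v"
  and cross2_add_left: "cross2 (u + u') v = cross2 u v + cross2 u' v"
  and cross2_add_right: "cross2 u (v + v') = cross2 u v + cross2 u v'"
  and cross2_self: "cross2 u u = 0"
  and cross2_zero: "cross2 0 v = 0" "cross2 u 0 = 0"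
  and cross2_swap: "cross2 v u = - cross2 u v"
  by (simp_all add: cross2_def algebra_simps)

text \<open>Cramer's rule.\<close>

lemma plane_decomposition:
  assumes "cross2 u v \<noteq> 0"
  shows "y = (cross2 y v / cross2 u v) *\<^sub>R u + (cross2 u y / cross2 u v) *\<^sub>R v"
proof -
  have "cross2 u v *\<^sub>R y = cross2 y v *\<^sub>R u + cross2 u y *\<^sub>R v"
    by (simp add: vec_eq_iff forall_2 cross2_def algebra_simps)
  then have "(1 / cross2 u v) *\<^sub>R (cross2 u v *\<^sub>R y) =
      (1 / cross2 u v) *\<^sub>R (cross2 y v *\<^sub>R u + cross2 u y *\<^sub>R v)" by simp
  then show ?thesis using assms by (simp add: scaleR_add_right)
qed

lemma linear_map_on_basis:
  assumes "cross2 u v \<noteq> 0" "cross2 u' v' \<noteq> 0"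
  obtains A :: "plane \<Rightarrow> plane" where "linear A" "inj A" "A u = u'" "A v = v'"
proof
  define A where "A = (\<lambda>y. (cross2 y v / cross2 u v) *\<^sub>R u' + (cross2 u y / cross2 u v) *\<^sub>R v')"
  show lin: "linear A" unfolding A_def
    by (intro linearI) (simp_all add: cross2_add_left cross2_add_right cross2_scaleR_left
        cross2_scaleR_right add_divide_distrib scaleR_add_left scaleR_add_right)
  show "A u = u'" "A v = v'" using assms(1) by (simp_all add: A_def cross2_self)
  have "y = 0" if "A y = 0" for y
  proof -
    have "cross2 (A y) v' = 0" "cross2 u' (A y) = 0" using that by (simp_all add: cross2_zero)
    then have "cross2 y v = 0" "cross2 u y = 0"
      using assms by (simp_all add: A_def cross2_add_left cross2_add_right cross2_scaleR_left
        cross2_scaleR_right cross2_self)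
    then show "y = 0" using plane_decomposition[OF assms(1), of y] by simp
  qed
  then show "inj A" using lin by (simp add: linear_injective_0)
qed

section \<open>The flux through an edge as a volume integral\<close>

lemma triangle_cone:
  assumes "x \<in> convex hull {W, S, N}"
  shows "\<exists>e\<in>closed_segment S N. \<exists>s\<in>{0..1}. x = W + s *\<^sub>R (e - W)"
proof -
  obtain u v b where "u \<ge> 0" "v \<ge> 0" "u + v = 1" "b \<in> convex hull {S, N}" "x = u *\<^sub>R W + v *\<^sub>R b"
    using assms by (subst (asm) convex_hull_insert) auto
  moreover from this have "u = 1 - v" by simp
  ultimately show ?thesis
    by (intro bexI[of _ b] bexI[of _ v]) (auto simp: segment_convex_hull algebra_simps)
qed

text \<open>By the divergence theorem this is twice the mean value of \<open>\<psi>\<close> over the edge opposite to the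
  vertex \<open>W\<close> of the triangle \<open>K\<close>, where \<open>G\<close> is the gradient of \<open>\<psi>\<close>.\<close>

definition rt_flux :: "plane \<Rightarrow> plane set \<Rightarrow> scalar_field \<Rightarrow> vector_field \<Rightarrow> real" where
  "rt_flux W K \<psi> G = integral K (\<lambda>x. (x - W) \<bullet> G x + 2 * \<psi> x) / measure lebesgue K"

text \<open>By linearity this means that the flux depends only on the values of \<psi> on the edge.
  The triangle is the cone over that edge with apex \<open>W\<close>.\<close>

lemma rt_flux_zero:
  assumes \<psi>: "\<And>x. GDERIV \<psi> x :> G x" and G: "continuous_on UNIV G"
    and "\<And>x. x \<in> closed_segment S N \<Longrightarrow> \<psi> x = 0"
  shows "rt_flux W (convex hull {W, S, N}) \<psi> G = 0"
proof -
  have "integral (convex hull {W, S, N}) (\<lambda>x. (x - W) \<bullet> G x + 2 * \<psi> x) = 0"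
  proof (rule cone_divergence_integral_zero[OF \<psi> G _ _ _ triangle_cone])
    show "closed_segment S N \<subseteq> convex hull {W, S, N}"
      by (simp add: segment_convex_hull hull_mono)
    show "W \<in> convex hull {W, S, N}" by (simp add: hull_inc)
  qed (use assms(3) in \<open>auto simp: compact_convex_hull finite_imp_compact\<close>)
  then show ?thesis by (simp add: rt_flux_def)
qed

text \<open>Pulling back by the affine map \<open>L \<rightarrow> K\<close> that fixes \<open>[S, N]\<close> turns the flux over \<open>K\<close>
  into one over \<open>L\<close>, and the two functions on \<open>L\<close> agree on \<open>[S, N]\<close>.\<close>

lemma rt_flux_neighbour:
  assumes \<psi>: "\<And>x. GDERIV \<psi> x :> G x" and G: "continuous_on UNIV G"
    and K: "cross2 (S - W) (N - W) \<noteq> 0" and L: "cross2 (S - E) (N - E) \<noteq> 0"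
  shows "rt_flux W (convex hull {W, S, N}) \<psi> G = rt_flux E (convex hull {E, S, N}) \<psi> G"
proof -
  obtain A where A: "linear A" "inj A" "A (S - E) = S - W" "A (N - E) = N - W"
    using linear_map_on_basis[OF L K] .
  have bA: "bounded_linear A" using A(1) by (simp add: linear_linear)
  define T where "T = (\<lambda>y. (W - A E) + A y)"
  define L' where "L' = convex hull {E, S, N}"
  have T: "T E = W" "T S = S" "T N = N"
    using A(3,4) by (auto simp: T_def linear_diff[OF A(1)] algebra_simps)
  have cT: "continuous_on X T" for X
    unfolding T_def by (intro continuous_intros linear_continuous_on bA)
  have Timage: "convex hull {W, S, N} = T ` L'"
  proof -
    have "T ` L' = (+) (W - A E) ` A ` L'" by (auto simp: T_def image_image)
    also have "A ` L' = convex hull (A ` {E, S, N})"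
      unfolding L'_def by (rule convex_hull_linear_image[OF A(1)])
    also have "(+) (W - A E) ` \<dots> = convex hull ((+) (W - A E) ` A ` {E, S, N})"
      by (rule convex_hull_translation[symmetric])
    also have "(+) (W - A E) ` A ` {E, S, N} = {T E, T S, T N}" by (simp add: T_def)
    finally show ?thesis using T by simp
  qed
  have cL: "compact L'" by (simp add: L'_def compact_convex_hull finite_imp_compact)
  have c\<psi>: "continuous_on X \<psi>" for X using \<psi> by (rule GDERIV_imp_continuous_on)
  have cG: "continuous_on X G" for X using G continuous_on_subset by blast
  \<comment> \<open>The gradient of \<psi> composed with T; the adjoint moves the linear part of T
    from the position vector onto the gradient.\<close>
  define H where "H = (\<lambda>y. adjoint A (G (T y)))"
  have cadj: "bounded_linear (adjoint A)" using A(1) by (simp add: adjoint_linear linear_linear)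
  have cH: "continuous_on X H" for X unfolding H_def
    by (intro bounded_linear.continuous_on[OF cadj] continuous_on_compose2[OF cG[of UNIV] cT]) auto
  have H: "GDERIV (\<lambda>y. \<psi> (T y)) y :> H y" for y
  proof -
    have "(T has_derivative A) (at y)"
      unfolding T_def using bounded_linear_imp_has_derivative[OF bA] by (auto intro!: derivative_eq_intros)
    moreover have "(\<psi> has_derivative (\<lambda>h. h \<bullet> G (T y))) (at (T y))" using \<psi> by (simp add: gderiv_def)
    ultimately have "((\<lambda>y. \<psi> (T y)) has_derivative (\<lambda>h. A h \<bullet> G (T y))) (at y)"
      by (rule has_derivative_compose)
    then show ?thesis by (simp add: gderiv_def H_def adjoint_works[OF A(1)])
  qed
  have mK: "measure lebesgue (T ` L') = \<bar>det (matrix A)\<bar> * measure lebesgue L'"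
    unfolding T_def by (rule measure_affine_image[OF A(1,2) cL])
  have "det (matrix A) \<noteq> 0"
    using A(1,2) by (metis det_nz_iff_inj matrix_vector_mul(1) matrix_works ext)
  have "integral (T ` L') (\<lambda>x. (x - W) \<bullet> G x + 2 * \<psi> x)
      = \<bar>det (matrix A)\<bar> * integral L' (\<lambda>y. (T y - W) \<bullet> G (T y) + 2 * \<psi> (T y))"
    unfolding T_def by (intro integral_affine_image A cL continuous_intros c\<psi> cG)
  also have "(\<lambda>y. (T y - W) \<bullet> G (T y) + 2 * \<psi> (T y)) = (\<lambda>y. (y - E) \<bullet> H y + 2 * \<psi> (T y))"
  proof
    fix y
    have "T y - W = A (y - E)" by (simp add: T_def linear_diff[OF A(1)])
    then have "(T y - W) \<bullet> G (T y) = (y - E) \<bullet> H y"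
      by (simp add: H_def adjoint_works[OF A(1)])
    then show "(T y - W) \<bullet> G (T y) + 2 * \<psi> (T y) = (y - E) \<bullet> H y + 2 * \<psi> (T y)" by simp
  qed
  \<comment> \<open>The Jacobian enters the integral and the area alike and cancels in
    \<open>rt_flux\<close>.\<close>
  finally have 1: "rt_flux W (T ` L') \<psi> G = rt_flux E L' (\<lambda>y. \<psi> (T y)) H"
    using \<open>det (matrix A) \<noteq> 0\<close> by (simp add: rt_flux_def mK)
  have "rt_flux E L' (\<lambda>y. \<psi> (T y) - \<psi> y) (\<lambda>y. H y - G y) = 0"
    unfolding L'_def
  proof (rule rt_flux_zero)
    show "GDERIV (\<lambda>y. \<psi> (T y) - \<psi> y) x :> H x - G x" for x
      by (intro GDERIV_diff H \<psi>)
    show "continuous_on UNIV (\<lambda>y. H y - G y)" by (intro continuous_intros cH cG)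
    show "\<psi> (T x) - \<psi> x = 0" if x: "x \<in> closed_segment S N" for x
    proof -
      obtain s where "x = (1 - s) *\<^sub>R S + s *\<^sub>R N" using x by (auto simp: in_segment)
      have "T x = (W - A E) + ((1 - s) *\<^sub>R A S + s *\<^sub>R A N)"
        unfolding T_def \<open>x = _\<close> linear_add[OF A(1)] linear_scale[OF A(1)] ..
      also have "\<dots> = (1 - s) *\<^sub>R T S + s *\<^sub>R T N"
        by (simp add: T_def algebra_simps)
      finally have "T x = (1 - s) *\<^sub>R T S + s *\<^sub>R T N" .
      then show ?thesis using T \<open>x = _\<close> by simp
    qed
  qed
  moreover have "integral L' (\<lambda>y. (y - E) \<bullet> (H y - G y) + 2 * (\<psi> (T y) - \<psi> y))
      = integral L' (\<lambda>y. (y - E) \<bullet> H y + 2 * \<psi> (T y)) - integral L' (\<lambda>y. (y - E) \<bullet> G y + 2 * \<psi> y)"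
    by (subst integral_diff[symmetric])
      (auto intro!: integrable_continuous_compact cL continuous_intros cH cG c\<psi> continuous_on_compose2[OF c\<psi>[of UNIV] cT]
        simp: inner_diff_right algebra_simps)
  ultimately have "rt_flux E L' (\<lambda>y. \<psi> (T y)) H = rt_flux E L' \<psi> G"
    by (auto simp: rt_flux_def diff_divide_distrib)
  then show ?thesis using 1 Timage by (simp add: L'_def)
qed

subsection \<open>Triangles and edges of a mesh\<close>

lemma cross2_zero_imp_collinear:
  assumes "cross2 (S - W) (N - W) = 0"
  shows "collinear {W, S, N}"
proof (cases "S = W")
  case False
  define u where "u = S - W"
  define v where "v = N - W"
  have "u \<bullet> u \<noteq> 0" using False by (simp add: u_def)
  have "u $ 1 * v $ 2 = u $ 2 * v $ 1" using assms by (simp add: cross2_def u_def v_def)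
  \<comment> \<open>The difference of the two sides is \<open>cross2 u v\<close> times
    \<open>u\<close> turned by a right angle.\<close>
  then have "(u \<bullet> u) *\<^sub>R v = (u \<bullet> v) *\<^sub>R u"
    by (simp add: vec_eq_iff forall_2 inner_vec_def sum_2 algebra_simps)
  then have "(1 / (u \<bullet> u)) *\<^sub>R ((u \<bullet> u) *\<^sub>R v) = ((u \<bullet> v) / (u \<bullet> u)) *\<^sub>R u" by simp
  then have "v = ((u \<bullet> v) / (u \<bullet> u)) *\<^sub>R u" using \<open>u \<bullet> u \<noteq> 0\<close> by simp
  then have "N = W + ((u \<bullet> v) / (u \<bullet> u)) *\<^sub>R (S - W)" by (simp add: u_def v_def algebra_simps)
  moreover have "S = W + 1 *\<^sub>R (S - W)" "W = W + 0 *\<^sub>R (S - W)" by simp_all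
  ultimately show ?thesis unfolding collinear_alt by blast
qed simp

lemma collinear_imp_cross2_zero:
  assumes "collinear {W, S, N}"
  shows "cross2 (S - W) (N - W) = 0"
proof -
  obtain u v where *: "\<forall>x\<in>{W, S, N}. \<exists>c. x = u + c *\<^sub>R v" using assms by (auto simp: collinear_alt)
  then obtain a b c where "W = u + a *\<^sub>R v" "S = u + b *\<^sub>R v" "N = u + c *\<^sub>R v" by auto
  then show ?thesis by (simp add: cross2_def algebra_simps)
qed

lemma cross2_triangle_rotate: "cross2 (N - S) (W - S) = cross2 (S - W) (N - W)"
  by (simp add: cross2_def algebra_simps)

text \<open>Vertices are listed counterclockwise; the edge opposite to \<open>W\<close> then runs from \<open>S\<close> to \<open>N\<close>.\<close>

definition ccw_triangle :: "plane \<Rightarrow> plane \<Rightarrow> plane \<Rightarrow> triangle \<Rightarrow> bool" where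
  "ccw_triangle W S N K \<longleftrightarrow> K = convex hull {W, S, N} \<and> cross2 (S - W) (N - W) > 0"

lemma ccw_triangle_cross2:
  assumes "ccw_triangle W S N K"
  shows "cross2 (N - S) (W - S) > 0" "cross2 (W - S) (N - S) < 0"
proof -
  show *: "cross2 (N - S) (W - S) > 0"
    using assms by (simp only: ccw_triangle_def cross2_triangle_rotate[of N S W])
  show "cross2 (W - S) (N - S) < 0" using * cross2_swap[of "N - S" "W - S"] by simp
qed

text \<open>Statements are proved for the edge from \<open>S\<close> to \<open>N\<close> only;
  rotation carries them to the other two edges.\<close>

lemma ccw_triangle_rotate:
  assumes "ccw_triangle W S N K"
  shows "ccw_triangle S N W K"
proof -
  have "{W, S, N} = {S, N, W}" by auto
  then show ?thesis using assms ccw_triangle_cross2(1)[OF assms] unfolding ccw_triangle_def by simp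
qed

lemma ccw_triangle_affine_independent:
  assumes "ccw_triangle W S N K"
  shows "\<not> affine_dependent {W, S, N}" "W \<noteq> S" "W \<noteq> N" "S \<noteq> N"
proof -
  have "cross2 (S - W) (N - W) \<noteq> 0" using assms by (simp add: ccw_triangle_def)
  then have "\<not> collinear {W, S, N}" using collinear_imp_cross2_zero by blast
  then show "\<not> affine_dependent {W, S, N}" "W \<noteq> S" "W \<noteq> N" "S \<noteq> N"
    by (simp_all add: collinear_3_eq_affine_dependent)
qed

text \<open>Affine independence keeps \<open>W\<close> off the line through \<open>S\<close> and
  \<open>N\<close>, so their segment is a face, and \<open>W\<close> is the only extreme point
  outside it.\<close>

lemma ccw_triangle_edge_of:
  assumes K: "ccw_triangle W S N K"
  shows "closed_segment S N edge_of K" "opposite_vertex K (closed_segment S N) = W"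
proof -
  note ind = ccw_triangle_affine_independent[OF K]
  have W: "W \<notin> affine hull {S, N}"
  proof
    assume "W \<in> affine hull {S, N}"
    then have "collinear {S, N, W}" using ind(4) by (simp add: collinear_3_affine_hull)
    then have "collinear {W, S, N}" by (simp add: insert_commute)
    then show False using ind by (simp add: collinear_3_eq_affine_dependent)
  qed
  have "convex hull {S, N} face_of convex hull {W, S, N}"
  proof (rule face_of_convex_hulls)
    have "{W, S, N} - {S, N} = {W}" using ind by auto
    then show "affine hull {S, N} \<inter> convex hull ({W, S, N} - {S, N}) = {}" using W by simp
  qed auto
  then show "closed_segment S N edge_of K"
    using K ind(4) by (simp add: edge_of_def ccw_triangle_def segment_convex_hull aff_dim_convex_hull)
  have W': "W \<notin> closed_segment S N"
    using W convex_hull_subset_affine_hull[of "{S, N}"] unfolding segment_convex_hull by blast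
  show "opposite_vertex K (closed_segment S N) = W"
    unfolding opposite_vertex_def
  proof (rule the_equality)
    show "W extreme_point_of K \<and> W \<notin> closed_segment S N"
      using W' K by (simp add: ccw_triangle_def extreme_point_of_convex_hull_affine_independent[OF ind(1)])
    show "X = W" if "X extreme_point_of K \<and> X \<notin> closed_segment S N" for X
      using that K by (auto simp: ccw_triangle_def extreme_point_of_convex_hull_affine_independent[OF ind(1)])
  qed
qed

text \<open>A face of a convex hull is the hull of some of the vertices, and dimension one leaves
  exactly two of them.\<close>

lemma ccw_triangle_edge_of_iff:
  assumes K: "ccw_triangle W S N K"
  shows "a edge_of K \<longleftrightarrow> a \<in> {closed_segment S N, closed_segment N W, closed_segment W S}"
proof
  note ind = ccw_triangle_affine_independent[OF K]
  assume a: "a edge_of K"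
  then obtain C where C: "C \<subseteq> {W, S, N}" "a = convex hull C"
    using K face_of_convex_hull_subset[of "{W, S, N}" a]
    by (auto simp: edge_of_def ccw_triangle_def finite_imp_compact)
  have "\<not> affine_dependent C" using ind(1) C(1) affine_independent_subset by blast
  then have "int (card C) = aff_dim C + 1" using aff_dim_affine_independent by auto
  then have "card C = 2" using a C(2) by (simp add: edge_of_def aff_dim_convex_hull)
  then obtain x y where "C = {x, y}" "x \<noteq> y" by (meson card_2_iff)
  then show "a \<in> {closed_segment S N, closed_segment N W, closed_segment W S}"
    using C by (auto simp: segment_convex_hull insert_commute)
next
  assume "a \<in> {closed_segment S N, closed_segment N W, closed_segment W S}"
  then show "a edge_of K"
    using ccw_triangle_edge_of(1)[OF K] ccw_triangle_edge_of(1)[OF ccw_triangle_rotate[OF K]]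
      ccw_triangle_edge_of(1)[OF ccw_triangle_rotate[OF ccw_triangle_rotate[OF K]]] by blast
qed

lemma simplex_2_ccw_triangle:
  assumes "2 simplex K"
  obtains W S N where "ccw_triangle W S N K"
proof -
  obtain C where C: "\<not> affine_dependent C" "int (card C) = 2 + 1" "K = convex hull C"
    using assms by (auto simp: simplex_def)
  then have "card C = 3" by simp
  then obtain W S N where WSN: "C = {W, S, N}" "W \<noteq> S" "W \<noteq> N" "S \<noteq> N"
    by (auto simp: card_3_iff)
  then have "\<not> collinear {W, S, N}" using C(1) by (simp add: collinear_3_eq_affine_dependent)
  then have ne: "cross2 (S - W) (N - W) \<noteq> 0" using cross2_zero_imp_collinear by blast
  show thesis
  proof (cases "cross2 (S - W) (N - W) > 0")
    case True
    then show thesis using that[of W S N] C(3) WSN by (simp add: ccw_triangle_def)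
  next
    case False
    then have "cross2 (N - W) (S - W) > 0" using ne cross2_swap[of "S - W"] by simp
    then show thesis using that[of W N S] C(3) WSN by (simp add: ccw_triangle_def insert_commute)
  qed
qed

lemma simplex_2_edge_ccw_triangle:
  assumes "2 simplex K" "a edge_of K"
  obtains S N where "ccw_triangle (opposite_vertex K a) S N K" "a = closed_segment S N"
proof -
  obtain W S N where K: "ccw_triangle W S N K" using simplex_2_ccw_triangle[OF assms(1)] .
  note R = ccw_triangle_rotate[OF K]
  note RR = ccw_triangle_rotate[OF R]
  have "a \<in> {closed_segment S N, closed_segment N W, closed_segment W S}"
    using assms(2) ccw_triangle_edge_of_iff[OF K] by blast
  then show thesis
    using that[of S N] that[of N W] that[of W S] K R RR
      ccw_triangle_edge_of(2)[OF K] ccw_triangle_edge_of(2)[OF R] ccw_triangle_edge_of(2)[OF RR]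
    by auto
qed

lemma finite_edges_of_simplex:
  fixes K :: triangle
  assumes "2 simplex K"
  shows "finite {a. a edge_of K}"
proof -
  obtain W S N where "ccw_triangle W S N K" using simplex_2_ccw_triangle[OF assms] .
  then show ?thesis by (simp add: ccw_triangle_edge_of_iff)
qed

lemma sum_edges_of_ccw_triangle:
  assumes K: "ccw_triangle W S N K"
  shows "(\<Sum>a | a edge_of K. h a) = h (closed_segment S N) + h (closed_segment N W) + h (closed_segment W S)"
proof -
  note ind = ccw_triangle_affine_independent[OF K]
  have "{a. a edge_of K} = {closed_segment S N, closed_segment N W, closed_segment W S}"
    using ccw_triangle_edge_of_iff[OF K] by blast
  moreover have "closed_segment S N \<noteq> closed_segment N W" "closed_segment S N \<noteq> closed_segment W S"
    "closed_segment N W \<noteq> closed_segment W S"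
    using ind by (auto simp: doubleton_eq_iff)
  ultimately show ?thesis by (simp add: add.assoc)
qed

lemma card_edges_of_simplex:
  fixes K :: triangle
  assumes "2 simplex K"
  shows "card {a. a edge_of K} = 3"
proof -
  obtain W S N where "ccw_triangle W S N K" using simplex_2_ccw_triangle[OF assms] .
  from sum_edges_of_ccw_triangle[OF this, of "\<lambda>_. 1::nat"] show ?thesis by simp
qed

lemma orthogonal_to_basis_zero:
  assumes "cross2 u v \<noteq> 0" "n \<bullet> u = 0" "n \<bullet> v = 0"
  shows "n = 0"
proof -
  have "n \<bullet> n = n \<bullet> ((cross2 n v / cross2 u v) *\<^sub>R u + (cross2 u n / cross2 u v) *\<^sub>R v)"
    using plane_decomposition[OF assms(1), of n] by simp
  also have "\<dots> = 0" by (simp add: inner_add_right assms(2,3))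
  finally show ?thesis by simp
qed

text \<open>The linear form given by \<open>n\<close> is constant along the base, so on
  \<open>K\<close> its value relative to \<open>S\<close> is a multiple, with factor in [0,1], of
  the value at \<open>W\<close>. The side on which \<open>W\<close> lies thus decides
  everything.\<close>

lemma ccw_triangle_normal:
  assumes K: "ccw_triangle W S N K" and n: "n \<noteq> 0" "n \<bullet> (N - S) = 0"
  shows "n \<bullet> (W - S) \<noteq> 0"
    "points_out K (closed_segment S N) n \<longleftrightarrow> n \<bullet> (W - S) < 0"
    "x \<in> K \<Longrightarrow> n \<bullet> (W - S) < 0 \<Longrightarrow> n \<bullet> (x - S) \<le> 0"
proof -
  have c: "cross2 (N - S) (W - S) \<noteq> 0" using ccw_triangle_cross2(1)[OF K] by simp
  show ne: "n \<bullet> (W - S) \<noteq> 0" using orthogonal_to_basis_zero[OF c n(2)] n(1) by blast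
  have xS: "\<exists>s\<in>{0..1}. n \<bullet> (x - S) = s * (n \<bullet> (W - S))" if xK: "x \<in> K" for x
  proof -
    obtain e s where es: "e \<in> closed_segment S N" "s \<in> {0..1}" "x = W + s *\<^sub>R (e - W)"
      using triangle_cone[of x W S N] xK K unfolding ccw_triangle_def by blast
    then obtain t where e: "e = (1 - t) *\<^sub>R S + t *\<^sub>R N" by (auto simp: in_segment)
    have "x - S = (1 - s) *\<^sub>R (W - S) + (s * t) *\<^sub>R (N - S)"
      unfolding es(3) e by (simp add: algebra_simps)
    then have "n \<bullet> (x - S) = (1 - s) * (n \<bullet> (W - S))"
      by (simp add: inner_add_right n(2))
    then show ?thesis using es(2) by (intro bexI[of _ "1 - s"]) auto
  qed
  show "n \<bullet> (x - S) \<le> 0" if "x \<in> K" "n \<bullet> (W - S) < 0" for x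
    using xS[OF that(1)] that(2) by (auto simp: mult_nonneg_nonpos)
  show "points_out K (closed_segment S N) n \<longleftrightarrow> n \<bullet> (W - S) < 0"
  proof
    assume "points_out K (closed_segment S N) n"
    moreover have "W \<in> K" using K by (simp add: ccw_triangle_def hull_inc)
    ultimately have "n \<bullet> (W - S) \<le> 0" by (simp add: points_out_def)
    then show "n \<bullet> (W - S) < 0" using ne by simp
  next
    assume neg: "n \<bullet> (W - S) < 0"
    show "points_out K (closed_segment S N) n"
      unfolding points_out_def
    proof (intro ballI)
      fix x y assume "x \<in> K" "y \<in> closed_segment S N"
      obtain s where s: "s \<in> {0..1}" "n \<bullet> (x - S) = s * (n \<bullet> (W - S))" using xS \<open>x \<in> K\<close> by blast
      obtain t where "y = (1 - t) *\<^sub>R S + t *\<^sub>R N" using \<open>y \<in> _\<close> by (auto simp: in_segment)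
      then have "x - y = (x - S) - t *\<^sub>R (N - S)" by (simp add: algebra_simps)
      then have "n \<bullet> (x - y) = n \<bullet> (x - S) - n \<bullet> (t *\<^sub>R (N - S))"
        by (simp only: inner_diff_right[of n "x - S"])
      then have "n \<bullet> (x - y) = n \<bullet> (x - S)" using n(2) by simp
      then show "n \<bullet> (x - y) \<le> 0" using s neg by (simp add: mult_nonneg_nonpos)
    qed
  qed
qed

text \<open>In the plane, \<open>v\<close> is a multiple of \<open>n\<close> turned by a right
  angle, so the cross product with \<open>v\<close> sees only the component of \<open>u\<close>
  along \<open>n\<close>.\<close>

lemma cross2_unit_normal:
  assumes "n \<bullet> n = 1" "n \<bullet> v = 0"
  shows "cross2 u v = cross2 n v * (n \<bullet> u)"
proof -
  have 1: "n $ 1 * n $ 1 + n $ 2 * n $ 2 = 1" and 2: "n $ 1 * v $ 1 + n $ 2 * v $ 2 = 0"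
    using assms by (simp_all add: inner_vec_def sum_2)
  have "cross2 n v * (n \<bullet> u) - cross2 u v * (n $ 1 * n $ 1 + n $ 2 * n $ 2)
      = (n $ 1 * v $ 1 + n $ 2 * v $ 2) * (n $ 1 * u $ 2 - n $ 2 * u $ 1)"
    by (simp add: cross2_def inner_vec_def sum_2 algebra_simps)
  then show ?thesis using 1 2 by simp
qed

lemma unit_normal_segment:
  "unit_normal (closed_segment S N) n \<longleftrightarrow> norm n = 1 \<and> n \<bullet> (N - S) = 0"
proof
  assume n: "norm n = 1 \<and> n \<bullet> (N - S) = 0"
  have "n \<bullet> (x - y) = 0" if "x \<in> closed_segment S N" "y \<in> closed_segment S N" for x y
  proof -
    obtain s t where "x = (1 - s) *\<^sub>R S + s *\<^sub>R N" "y = (1 - t) *\<^sub>R S + t *\<^sub>R N"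
      using \<open>x \<in> _\<close> \<open>y \<in> _\<close> by (auto simp: in_segment)
    then have "x - y = ((1 - s) *\<^sub>R S + s *\<^sub>R N) - ((1 - t) *\<^sub>R S + t *\<^sub>R N)" by simp
    also have "\<dots> = (s - t) *\<^sub>R (N - S)" by (simp add: algebra_simps)
    finally show ?thesis using n by simp
  qed
  then show "unit_normal (closed_segment S N) n" using n unfolding unit_normal_def by blast
next
  assume "unit_normal (closed_segment S N) n"
  then show "norm n = 1 \<and> n \<bullet> (N - S) = 0" unfolding unit_normal_def by (meson ends_in_segment)
qed

text \<open>\<open>W\<close> lies to the left of the direction from \<open>S\<close> to
  \<open>N\<close>, hence \<open>n \<bullet> (W - S)\<close> and \<open>cross2 n (N - S)\<close>
  have opposite signs. This turns \<open>points_out\<close> into a condition on the edge and its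
  normal alone.\<close>

lemma ccw_triangle_points_out_iff:
  assumes K: "ccw_triangle W S N K" and n: "unit_normal (closed_segment S N) n"
  shows "points_out K (closed_segment S N) n \<longleftrightarrow> cross2 n (N - S) > 0"
    "cross2 n (N - S) \<noteq> 0"
proof -
  have n': "n \<noteq> 0" "n \<bullet> n = 1" "n \<bullet> (N - S) = 0"
    using n unfolding unit_normal_segment by (auto simp: norm_eq_1)
  have "cross2 (W - S) (N - S) < 0" by (rule ccw_triangle_cross2(2)[OF K])
  then have "cross2 n (N - S) * (n \<bullet> (W - S)) < 0"
    using cross2_unit_normal[OF n'(2,3), of "W - S"] by simp
  then have "cross2 n (N - S) > 0 \<and> n \<bullet> (W - S) < 0 \<or> cross2 n (N - S) < 0 \<and> n \<bullet> (W - S) > 0"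
    unfolding mult_less_0_iff .
  then show "points_out K (closed_segment S N) n \<longleftrightarrow> cross2 n (N - S) > 0" "cross2 n (N - S) \<noteq> 0"
    unfolding ccw_triangle_normal(2)[OF K n'(1,3)] by linarith+
qed

section \<open>Conformity and neighbours across an edge\<close>

lemma mesh_simplex: "is_mesh \<Omega> T \<Longrightarrow> K \<in> T \<Longrightarrow> 2 simplex K"
  by (simp add: is_mesh_def)

lemma mesh_finite: "is_mesh \<Omega> T \<Longrightarrow> finite T"
  by (simp add: is_mesh_def triangulation_def)

lemma mesh_face: "is_mesh \<Omega> T \<Longrightarrow> K \<in> T \<Longrightarrow> L \<in> T \<Longrightarrow> (K \<inter> L) face_of K"
  by (simp add: is_mesh_def triangulation_def)

text \<open>Both triangles have full dimension, and a face different from the whole convex set has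
  strictly smaller dimension; so neither can be a face of the other.\<close>

lemma mesh_proper_face:
  assumes T: "is_mesh \<Omega> T" and "K \<in> T" "L \<in> T" "K \<noteq> L"
  shows "K \<inter> L \<noteq> K" "aff_dim (K \<inter> L) < 2"
proof -
  have dim: "aff_dim K = 2" "aff_dim L = 2" and conv: "convex K" "convex L"
    using aff_dim_simplex[OF mesh_simplex[OF T assms(2)]] aff_dim_simplex[OF mesh_simplex[OF T assms(3)]]
      convex_simplex[OF mesh_simplex[OF T assms(2)]] convex_simplex[OF mesh_simplex[OF T assms(3)]] .
  have f: "(K \<inter> L) face_of K" "(K \<inter> L) face_of L"
    using mesh_face[OF T assms(2,3)] mesh_face[OF T assms(3,2)] unfolding Int_commute[of L K] .
  show "K \<inter> L \<noteq> K"
  proof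
    assume "K \<inter> L = K"
    then have "K face_of L" using f(2) by (simp only:)
    then have "aff_dim K < aff_dim L" using assms(4) by (rule face_of_aff_dim_lt[OF conv(2)])
    then show False unfolding dim by (simp only: less_irrefl)
  qed
  then show "aff_dim (K \<inter> L) < 2" using face_of_aff_dim_lt[OF conv(1) f(1)] unfolding dim by iprover
qed

text \<open>The edge is a face of \<open>K \<inter> L\<close>, whose dimension is at most one; equal
  dimension forces equality.\<close>

lemma mesh_common_edge:
  assumes T: "is_mesh \<Omega> T" and KL: "K \<in> T" "L \<in> T" "K \<noteq> L" and a: "a edge_of K" "a \<subseteq> L"
  shows "K \<inter> L = a" "a edge_of L"
proof -
  have sub: "a \<subseteq> K \<inter> L" using a(2) edge_of_imp_subset[OF a(1)] by (rule Int_greatest[rotated])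
  have f: "(K \<inter> L) face_of K" "(K \<inter> L) face_of L"
    using mesh_face[OF T KL(1,2)] mesh_face[OF T KL(2,1)] unfolding Int_commute[of L K] .
  have aK: "a face_of K" "aff_dim a = 1" using a(1) unfolding edge_of_def by (rule conjunct1, rule conjunct2)
  have af: "a face_of (K \<inter> L)" by (rule face_of_subset[OF aK(1) sub Int_lower1])
  show eq: "K \<inter> L = a"
  proof (rule ccontr)
    assume "K \<inter> L \<noteq> a"
    then have "aff_dim a < aff_dim (K \<inter> L)"
      by (intro face_of_aff_dim_lt[OF face_of_imp_convex[OF f(1)] af]) (rule not_sym)
    then show False using mesh_proper_face(2)[OF T KL] aK(2) by linarith
  qed
  show "a edge_of L" unfolding edge_of_def using f(2) aK(2) unfolding eq by (rule conjI)
qed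

lemma mesh_interiors_disjoint:
  assumes "is_mesh \<Omega> T" "K \<in> T" "L \<in> T" "K \<noteq> L"
  shows "interior K \<inter> interior L = {}"
  using face_of_disjoint_interior[OF mesh_face[OF assms(1-3)] mesh_proper_face(1)[OF assms]]
    interior_subset[of K] interior_subset[of L] by blast

text \<open>Triangles are only known to lie in the closure of \<open>\<Omega>\<close>; for an open
  convex set the interior of the closure adds nothing.\<close>

lemma mesh_interior_subset:
  assumes "convex_polygonal_domain \<Omega>" "is_mesh \<Omega> T" "K \<in> T"
  shows "interior K \<subseteq> \<Omega>"
proof -
  have "K \<subseteq> closure \<Omega>" using assms(2,3) by (auto simp: is_mesh_def)
  then have "interior K \<subseteq> interior (closure \<Omega>)" by (rule interior_mono)
  also have "\<dots> = \<Omega>" using assms(1) by (simp add: convex_polygonal_domain_def convex_interior_closure interior_open)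
  finally show ?thesis .
qed

text \<open>The points z + n/(k+1) approach \<open>z\<close> from the side away from
  \<open>K\<close> and are eventually in \<open>\<Omega>\<close>. As the mesh is finite, one
  triangle \<open>L\<close> contains infinitely many of them, and therefore also their limit
  \<open>z\<close>.\<close>

lemma mesh_edge_neighbour:
  assumes \<Omega>: "convex_polygonal_domain \<Omega>" and T: "is_mesh \<Omega> T" and K: "K \<in> T" "ccw_triangle W S N K"
    and n: "n \<bullet> (N - S) = 0" "n \<bullet> (W - S) < 0" and z: "z \<in> open_segment S N" "z \<in> \<Omega>"
  obtains L where "L \<in> T" "closed_segment S N edge_of L" "\<not> points_out L (closed_segment S N) n"
proof -
  have n0: "n \<noteq> 0" using n(2) by auto
  define p where "p = (\<lambda>k. z + inverse (real (Suc k)) *\<^sub>R n)"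
  have p_lim: "p \<longlonglongrightarrow> z"
  proof -
    have "p \<longlonglongrightarrow> z + 0 *\<^sub>R n" unfolding p_def by (intro tendsto_intros LIMSEQ_inverse_real_of_nat)
    then show ?thesis by simp
  qed
  have "open \<Omega>" using \<Omega> by (simp add: convex_polygonal_domain_def)
  then have "\<forall>\<^sub>F k in sequentially. p k \<in> \<Omega>"
    using z(2) by (rule topological_tendstoD[OF p_lim])
  moreover have "\<Omega> \<subseteq> \<Union>T" using T closure_subset by (auto simp: is_mesh_def)
  ultimately have "\<forall>\<^sub>F k in sequentially. \<exists>L\<in>T. p k \<in> L" by (elim eventually_mono) blast
  then have "\<exists>\<^sub>F k in sequentially. \<exists>L\<in>T. p k \<in> L" by (intro eventually_frequently) auto
  then obtain L where L: "L \<in> T" and pL: "\<exists>\<^sub>F k in sequentially. p k \<in> L"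
    using frequently_bex_finite[OF mesh_finite[OF T], where P = "\<lambda>k L. p k \<in> L" and F = sequentially] by blast
  have zL: "z \<in> L"
  proof (rule ccontr)
    assume "z \<notin> L"
    moreover have "closed L" using closed_simplex mesh_simplex[OF T L] by blast
    ultimately have "\<forall>\<^sub>F k in sequentially. p k \<in> - L" using p_lim by (intro topological_tendstoD) auto
    then show False using pL by (simp add: frequently_def)
  qed
  have zS: "n \<bullet> (z - S) = 0"
  proof -
    obtain t where "z = (1 - t) *\<^sub>R S + t *\<^sub>R N" using z(1) by (auto simp: in_segment)
    then have "z - S = t *\<^sub>R (N - S)" by (simp add: algebra_simps)
    then show ?thesis using n(1) by simp
  qed
  have pS: "n \<bullet> (p k - S) > 0" for k
  proof -
    have "n \<bullet> (p k - S) = n \<bullet> (z - S) + inverse (real (Suc k)) * (n \<bullet> n)"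
      by (simp add: p_def inner_diff_right inner_add_right)
    moreover have "0 < inverse (real (Suc k)) * (n \<bullet> n)" using n0 by (intro mult_pos_pos) auto
    ultimately show ?thesis using zS by linarith
  qed
  obtain k where k: "p k \<in> L" using pL frequently_ex by blast
  have "p k \<notin> K" using ccw_triangle_normal(3)[OF K(2) n0 n(1) _ n(2), of "p k"] pS[of k] by linarith
  then have "K \<noteq> L" using k by blast
  have e: "closed_segment S N edge_of K" by (rule ccw_triangle_edge_of(1)[OF K(2)])
  have SN: "S \<noteq> N" using ccw_triangle_affine_independent[OF K(2)] by blast
  have zK: "z \<in> K" using open_closed_segment[OF z(1)] edge_of_imp_subset[OF e] by blast
  \<comment> \<open>A face that meets the relative interior of the edge contains the whole
    edge.\<close>
  have "closed_segment S N \<subseteq> K \<inter> L"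
  proof (rule subset_of_face_of[OF mesh_face[OF T K(1) L]])
    show "closed_segment S N \<subseteq> K" using e edge_of_imp_subset by blast
    show "K \<inter> L \<inter> rel_interior (closed_segment S N) \<noteq> {}"
      using zK zL z(1) SN by (auto simp: rel_interior_closed_segment)
  qed
  then have eL: "closed_segment S N edge_of L"
    using mesh_common_edge(2)[OF T K(1) L \<open>K \<noteq> L\<close> e] by blast
  have "\<not> points_out L (closed_segment S N) n"
  proof
    assume "points_out L (closed_segment S N) n"
    then have "n \<bullet> (p k - S) \<le> 0" using k by (simp add: points_out_def)
    then show False using pS[of k] by simp
  qed
  then show thesis using that L eL by blast
qed

text \<open>If \<open>K\<close> and \<open>L\<close> lie on the same side of the edge, both contain
  points just off its midpoint on that side, whereas distinct triangles of a conforming mesh would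
  share nothing but the edge.\<close>

lemma mesh_edge_same_side:
  assumes T: "is_mesh \<Omega> T" and KL: "K \<in> T" "L \<in> T"
    and K: "ccw_triangle W S N K" and L: "ccw_triangle E S N L"
  shows "K = L"
proof (rule ccontr)
  assume "K \<noteq> L"
  define m where "m = (1/2) *\<^sub>R (S + N)"
  \<comment> \<open>\<alpha> and \<beta> are the coordinates of W - m with respect to E - m and N -
    S; \<alpha> > 0 expresses that \<open>W\<close> and \<open>E\<close> lie on the same
    side.\<close>
  define \<alpha> where "\<alpha> = cross2 (W - S) (N - S) / cross2 (E - S) (N - S)"
  define \<beta> where "\<beta> = cross2 (E - m) (W - m) / cross2 (E - m) (N - S)"
  have neg: "cross2 (W - S) (N - S) < 0" "cross2 (E - S) (N - S) < 0"
    using ccw_triangle_cross2(2)[OF K] ccw_triangle_cross2(2)[OF L] by auto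
  then have \<alpha>: "\<alpha> > 0" by (simp add: \<alpha>_def divide_neg_neg)
  have mm: "cross2 (X - m) (N - S) = cross2 (X - S) (N - S)" for X
    by (simp add: m_def cross2_def field_simps)
  have Wm: "W - m = \<alpha> *\<^sub>R (E - m) + \<beta> *\<^sub>R (N - S)"
    using plane_decomposition[of "E - m" "N - S" "W - m"] neg(2) by (simp add: \<alpha>_def \<beta>_def mm)
  \<comment> \<open>Small enough that all barycentric coordinates of m + \<epsilon> (W - m) are
    nonnegative in both triangles; in \<open>L\<close> this amounts to \<epsilon> (\<alpha> + 2
    |\<beta>|) \<le> 1.\<close>
  define \<epsilon> where "\<epsilon> = min 1 (1 / (2 * (\<alpha> + 2 * \<bar>\<beta>\<bar> + 1)))"
  have den: "\<alpha> + 2 * \<bar>\<beta>\<bar> + 1 > 0" using \<alpha> by simp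
  have \<epsilon>: "0 < \<epsilon>" "\<epsilon> \<le> 1" "\<epsilon> * (\<alpha> + 2 * \<bar>\<beta>\<bar> + 1) \<le> 1 / 2"
  proof -
    show "0 < \<epsilon>" "\<epsilon> \<le> 1" using den by (simp_all add: \<epsilon>_def)
    have "\<epsilon> \<le> 1 / (2 * (\<alpha> + 2 * \<bar>\<beta>\<bar> + 1))" by (simp add: \<epsilon>_def)
    then have "\<epsilon> * (\<alpha> + 2 * \<bar>\<beta>\<bar> + 1) \<le> (1 / (2 * (\<alpha> + 2 * \<bar>\<beta>\<bar> + 1))) * (\<alpha> + 2 * \<bar>\<beta>\<bar> + 1)"
      using den by (intro mult_right_mono) auto
    also have "\<dots> = 1 / 2" using den by (simp add: field_simps)
    finally show "\<epsilon> * (\<alpha> + 2 * \<bar>\<beta>\<bar> + 1) \<le> 1 / 2" .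
  qed
  define p where "p = m + \<epsilon> *\<^sub>R (W - m)"
  have pK: "p \<in> K"
  proof -
    have "p = \<epsilon> *\<^sub>R W + ((1 - \<epsilon>) / 2) *\<^sub>R S + ((1 - \<epsilon>) / 2) *\<^sub>R N"
      by (rule vec_eq_iff[THEN iffD2]) (simp add: p_def m_def field_simps)
    moreover have "0 \<le> \<epsilon>" "0 \<le> (1 - \<epsilon>) / 2" "\<epsilon> + (1 - \<epsilon>) / 2 + (1 - \<epsilon>) / 2 = 1"
      using \<epsilon> by (auto simp: field_simps)
    ultimately have "p \<in> convex hull {W, S, N}" unfolding convex_hull_3 by blast
    then show ?thesis using K by (simp only: ccw_triangle_def)
  qed
  have pL: "p \<in> L"
  proof -
    have e1: "0 \<le> \<epsilon> * \<alpha>" using \<epsilon> \<alpha> by simp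
    have e2: "\<epsilon> * \<alpha> + 2 * (\<epsilon> * \<bar>\<beta>\<bar>) \<le> 1 / 2" using \<epsilon> by (simp add: algebra_simps)
    have e3: "\<bar>\<epsilon> * \<beta>\<bar> = \<epsilon> * \<bar>\<beta>\<bar>" using \<epsilon> by (simp add: abs_mult)
    have "p = (\<epsilon> * \<alpha>) *\<^sub>R E + ((1 - \<epsilon> * \<alpha>) / 2 - \<epsilon> * \<beta>) *\<^sub>R S + ((1 - \<epsilon> * \<alpha>) / 2 + \<epsilon> * \<beta>) *\<^sub>R N"
      unfolding p_def Wm by (rule vec_eq_iff[THEN iffD2]) (simp add: m_def field_simps)
    moreover have "(1 - \<epsilon> * \<alpha>) / 2 - \<epsilon> * \<beta> \<ge> 0" "(1 - \<epsilon> * \<alpha>) / 2 + \<epsilon> * \<beta> \<ge> 0"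
      using e1 e2 e3 abs_ge_self[of "\<epsilon> * \<beta>"] abs_ge_minus_self[of "\<epsilon> * \<beta>"] by (simp_all add: field_simps)
    moreover have "\<epsilon> * \<alpha> + ((1 - \<epsilon> * \<alpha>) / 2 - \<epsilon> * \<beta>) + ((1 - \<epsilon> * \<alpha>) / 2 + \<epsilon> * \<beta>) = 1"
      by (simp add: field_simps)
    ultimately have "p \<in> convex hull {E, S, N}" unfolding convex_hull_3 using e1 by blast
    then show ?thesis using L by (simp only: ccw_triangle_def)
  qed
  have "closed_segment S N \<subseteq> L" using ccw_triangle_edge_of(1)[OF L] edge_of_imp_subset by blast
  then have "p \<in> closed_segment S N"
    using mesh_common_edge(1)[OF T KL \<open>K \<noteq> L\<close> ccw_triangle_edge_of(1)[OF K]] pK pL by blast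
  then obtain t where "p = (1 - t) *\<^sub>R S + t *\<^sub>R N" by (auto simp: in_segment)
  then have "p - S = t *\<^sub>R (N - S)" by (simp add: algebra_simps)
  then have "cross2 (p - S) (N - S) = 0" by (simp add: cross2_scaleR_left cross2_self)
  moreover have "cross2 (p - S) (N - S) = \<epsilon> * cross2 (W - S) (N - S)"
  proof -
    have "p - S = \<epsilon> *\<^sub>R (W - S) + ((1 - \<epsilon>) / 2) *\<^sub>R (N - S)"
      by (rule vec_eq_iff[THEN iffD2]) (simp add: p_def m_def field_simps)
    then show ?thesis by (simp add: cross2_add_left cross2_scaleR_left cross2_self)
  qed
  ultimately show False using \<epsilon>(1) neg(1) by simp
qed

subsection \<open>Weak divergence of Raviart-Thomas fields\<close>

text \<open>Interiors are used as in \<open>raviart_thomas\<close>, so values on triangle boundaries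
  are 0 and the discrete fields have exactly this form. The local functions are defined on the whole
  plane, which allows continuity to be required globally.\<close>

definition pw :: "mesh \<Rightarrow> (triangle \<Rightarrow> plane \<Rightarrow> 'b) \<Rightarrow> plane \<Rightarrow> 'b::euclidean_space" where
  "pw T f x = (\<Sum>K\<in>T. indicator (interior K) x *\<^sub>R f K x)"

lemma pw_interior:
  assumes "is_mesh \<Omega> T" "K \<in> T" "x \<in> interior K"
  shows "pw T f x = f K x"
proof -
  have "indicator (interior L) x *\<^sub>R f L x = (if L = K then f K x else 0)" if "L \<in> T" for L
    using mesh_interiors_disjoint[OF assms(1) that assms(2)] assms(3) by (auto simp: indicator_def)
  then have "pw T f x = (\<Sum>L\<in>T. if L = K then f K x else 0)"
    unfolding pw_def by (rule sum.cong[OF refl])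
  also have "\<dots> = f K x" using assms(2) mesh_finite[OF assms(1)] by simp
  finally show ?thesis .
qed

lemma pw_outside: "(\<And>K. K \<in> T \<Longrightarrow> x \<notin> interior K) \<Longrightarrow> pw T f x = 0"
  by (simp add: pw_def)

lemma pw_cases:
  assumes "is_mesh \<Omega> T"
  obtains K where "K \<in> T" "x \<in> interior K" | "\<And>K. K \<in> T \<Longrightarrow> x \<notin> interior K"
  by blast

lemma pw_inner:
  assumes "is_mesh \<Omega> T"
  shows "pw T f x \<bullet> pw T g x = pw T (\<lambda>K x. f K x \<bullet> g K x) x"
  by (cases rule: pw_cases[OF assms, of x]) (simp_all add: pw_interior[OF assms] pw_outside)

lemma pw_inner_left: "pw T f x \<bullet> h x = pw T (\<lambda>K x. f K x \<bullet> h x) x"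
  by (simp add: pw_def inner_sum_left)

lemma domain_lmeasurable:
  assumes "convex_polygonal_domain \<Omega>"
  shows "open \<Omega>" "\<Omega> \<in> lmeasurable" "\<Omega> \<in> sets lebesgue" "convex \<Omega>" "bounded \<Omega>"
  using assms by (auto simp: convex_polygonal_domain_def bounded_set_imp_lmeasurable)

lemma simplex_interior_AE:
  fixes K :: triangle
  assumes "2 simplex K"
  shows "AE x in lebesgue. x \<in> K \<longrightarrow> x \<in> interior K"
proof -
  have "negligible (frontier K)" using negligible_convex_frontier convex_simplex[OF assms] .
  then have "AE x in lebesgue. x \<notin> frontier K" by (simp add: negligible_iff_null_sets AE_not_in)
  then show ?thesis using closure_closed[OF closed_simplex[OF assms]]
    by (auto simp: frontier_def elim: eventually_mono)
qed

lemma mesh_AE: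
  assumes "convex_polygonal_domain \<Omega>" "is_mesh \<Omega> T"
  shows "AE x in lebesgue_on \<Omega>. \<exists>K\<in>T. x \<in> interior K"
proof -
  have cover: "\<exists>K\<in>T. x \<in> K" if "x \<in> \<Omega>" for x
    using assms(2) that closure_subset[of \<Omega>] unfolding is_mesh_def by blast
  have "AE x in lebesgue. \<forall>K\<in>T. x \<in> K \<longrightarrow> x \<in> interior K"
    using mesh_finite[OF assms(2)] simplex_interior_AE[OF mesh_simplex[OF assms(2)]]
    by (intro AE_finite_allI) auto
  then have "AE x in lebesgue_on \<Omega>. \<forall>K\<in>T. x \<in> K \<longrightarrow> x \<in> interior K"
    using domain_lmeasurable(3)[OF assms(1)] by (auto simp: AE_restrict_space_iff elim: eventually_mono)
  moreover have "AE x in lebesgue_on \<Omega>. x \<in> \<Omega>" by (rule AE_I2) simp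
  ultimately show ?thesis by eventually_elim (use cover in blast)
qed

lemma pw_measurable:
  fixes f :: "triangle \<Rightarrow> plane \<Rightarrow> 'b::euclidean_space"
  assumes "\<Omega> \<in> sets lebesgue" "\<And>K. K \<in> T \<Longrightarrow> continuous_on UNIV (f K)"
  shows "pw T f \<in> borel_measurable (lebesgue_on \<Omega>)"
proof -
  have "(\<lambda>x. indicat_real (interior K) x *\<^sub>R f K x) \<in> borel_measurable (lebesgue_on \<Omega>)" if "K \<in> T" for K
  proof -
    have "(\<lambda>x. indicat_real (interior K) x *\<^sub>R f K x) \<in> borel_measurable borel"
      by (intro borel_measurable_scaleR borel_measurable_indicator borel_measurable_continuous_onI assms that) auto
    then have "(\<lambda>x. indicat_real (interior K) x *\<^sub>R f K x) \<in> borel_measurable lebesgue"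
      by (simp add: measurable_completion)
    then show ?thesis by (rule measurable_restrict_space1)
  qed
  then show ?thesis unfolding pw_def by (intro borel_measurable_sum) auto
qed

text \<open>Frontiers of triangles are null sets, so interiors may be exchanged for the triangles;
  as the interiors lie in \<open>\<Omega>\<close>, the restriction to \<open>\<Omega>\<close>
  changes nothing.\<close>

lemma pw_integral:
  fixes f :: "triangle \<Rightarrow> plane \<Rightarrow> real"
  assumes \<Omega>: "convex_polygonal_domain \<Omega>" and T: "is_mesh \<Omega> T"
    and f: "\<And>K. K \<in> T \<Longrightarrow> continuous_on UNIV (f K)"
  shows "integrable (lebesgue_on \<Omega>) (pw T f)"
    "(LINT x|lebesgue_on \<Omega>. pw T f x) = (\<Sum>K\<in>T. integral K (f K))"
proof -
  have each: "integrable (lebesgue_on \<Omega>) (\<lambda>x. indicat_real (interior K) x *\<^sub>R f K x) \<and>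
      (LINT x|lebesgue_on \<Omega>. indicat_real (interior K) x *\<^sub>R f K x) = integral K (f K)" if K: "K \<in> T" for K
  proof -
    note s = mesh_simplex[OF T K]
    have cK: "compact K" using s by (rule compact_simplex)
    have abs: "integrable lebesgue (\<lambda>x. indicat_real K x *\<^sub>R f K x)"
      using integrable_continuous_compact(2)[OF cK continuous_on_subset[OF f[OF K]]] by (simp add: set_integrable_def)
    have ae: "AE x in lebesgue. indicat_real K x *\<^sub>R f K x = indicat_real (interior K) x *\<^sub>R f K x"
      using simplex_interior_AE[OF s] interior_subset[of K] by (auto simp: indicator_def elim: eventually_mono)
    have meas: "(\<lambda>x. indicat_real (interior K) x *\<^sub>R f K x) \<in> borel_measurable lebesgue"
      by (intro borel_measurable_scaleR borel_measurable_indicator)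
        (auto intro!: measurable_completion borel_measurable_continuous_onI f K)
    have abs': "integrable lebesgue (\<lambda>x. indicat_real (interior K) x *\<^sub>R f K x)"
      by (rule integrable_cong_AE_imp[OF abs meas]) (use ae in \<open>auto elim: eventually_mono\<close>)
    have eq: "indicat_real \<Omega> x *\<^sub>R (indicat_real (interior K) x *\<^sub>R f K x) = indicat_real (interior K) x *\<^sub>R f K x" for x
      using mesh_interior_subset[OF \<Omega> T K] by (auto simp: indicator_def)
    have \<Omega>s: "\<Omega> \<inter> space lebesgue \<in> sets lebesgue" using domain_lmeasurable(3)[OF \<Omega>] by simp
    have "integrable (lebesgue_on \<Omega>) (\<lambda>x. indicat_real (interior K) x *\<^sub>R f K x)"
      unfolding integrable_restrict_space[OF \<Omega>s] eq by (rule abs')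
    moreover have "(LINT x|lebesgue_on \<Omega>. indicat_real (interior K) x *\<^sub>R f K x)
        = (LINT x|lebesgue. indicat_real (interior K) x *\<^sub>R f K x)"
      unfolding integral_restrict_space[OF \<Omega>s] eq ..
    moreover have "\<dots> = (LINT x|lebesgue. indicat_real K x *\<^sub>R f K x)"
      by (rule integral_cong_AE[OF meas]) (use abs ae in \<open>auto elim: eventually_mono\<close>)
    moreover have "\<dots> = (LINT x|lebesgue_on K. f K x)"
      using lmeasurable_compact[OF cK] by (subst integral_restrict_space) auto
    moreover have "\<dots> = integral K (f K)"
      by (rule integrable_continuous_compact(4)[OF cK continuous_on_subset[OF f[OF K]]]) auto
    ultimately show ?thesis by metis
  qed
  have "pw T f = (\<lambda>x. \<Sum>K\<in>T. indicat_real (interior K) x *\<^sub>R f K x)" by (auto simp: pw_def)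
  then show "integrable (lebesgue_on \<Omega>) (pw T f)"
    "(LINT x|lebesgue_on \<Omega>. pw T f x) = (\<Sum>K\<in>T. integral K (f K))"
    using each by (simp_all add: Bochner_Integration.integral_sum)
qed

lemma pw_L2:
  fixes f :: "triangle \<Rightarrow> plane \<Rightarrow> 'b::euclidean_space"
  assumes \<Omega>: "convex_polygonal_domain \<Omega>" and T: "is_mesh \<Omega> T"
    and f: "\<And>K. K \<in> T \<Longrightarrow> continuous_on UNIV (f K)"
  shows "pw T f \<in> L2 \<Omega>"
proof -
  have "integrable (lebesgue_on \<Omega>) (pw T (\<lambda>K x. f K x \<bullet> f K x))"
    by (intro pw_integral(1)[OF \<Omega> T] continuous_intros f)
  moreover have "pw T (\<lambda>K x. f K x \<bullet> f K x) = (\<lambda>x. (norm (pw T f x))\<^sup>2)"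
    unfolding power2_norm_eq_inner pw_inner[OF T] ..
  ultimately show ?thesis
    using pw_measurable[OF domain_lmeasurable(3)[OF \<Omega>] f] by (simp add: L2_def)
qed

lemma pw_ip:
  fixes f g :: "triangle \<Rightarrow> plane \<Rightarrow> 'b::euclidean_space"
  assumes \<Omega>: "convex_polygonal_domain \<Omega>" and T: "is_mesh \<Omega> T"
    and f: "\<And>K. K \<in> T \<Longrightarrow> continuous_on UNIV (f K)" and g: "\<And>K. K \<in> T \<Longrightarrow> continuous_on UNIV (g K)"
  shows "ip \<Omega> (pw T f) (pw T g) = (\<Sum>K\<in>T. integral K (\<lambda>x. f K x \<bullet> g K x))"
  unfolding ip_def pw_inner[OF T] by (intro pw_integral(2)[OF \<Omega> T] continuous_intros f g)

lemma pw_ip_left: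
  fixes f :: "triangle \<Rightarrow> plane \<Rightarrow> 'b::euclidean_space"
  assumes \<Omega>: "convex_polygonal_domain \<Omega>" and T: "is_mesh \<Omega> T"
    and f: "\<And>K. K \<in> T \<Longrightarrow> continuous_on UNIV (f K)" and h: "continuous_on UNIV h"
  shows "ip \<Omega> (pw T f) h = (\<Sum>K\<in>T. integral K (\<lambda>x. f K x \<bullet> h x))"
  unfolding ip_def pw_inner_left by (intro pw_integral(2)[OF \<Omega> T] continuous_intros f h)

lemma pw_const_L2_mesh:
  assumes "convex_polygonal_domain \<Omega>" "is_mesh \<Omega> T"
  shows "pw T (\<lambda>K x. c K) \<in> L2_mesh \<Omega> T"
  using pw_L2[OF assms, of "\<lambda>K x. c K"] pw_interior[OF assms(2)] by (auto simp: L2_mesh_def)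

text \<open>Members of \<open>L2_mesh\<close> are unconstrained on the triangle boundaries, hence
  agreement only almost everywhere.\<close>

lemma L2_mesh_pw:
  assumes \<Omega>: "convex_polygonal_domain \<Omega>" and T: "is_mesh \<Omega> T" and u: "u \<in> L2_mesh \<Omega> T"
  obtains c where "AE x in lebesgue_on \<Omega>. u x = pw T (\<lambda>K x. c K) x"
proof -
  obtain c where c: "\<And>K x. K \<in> T \<Longrightarrow> x \<in> interior K \<Longrightarrow> u x = c K"
    using u unfolding L2_mesh_def by simp metis
  have "AE x in lebesgue_on \<Omega>. u x = pw T (\<lambda>K x. c K) x"
    using mesh_AE[OF \<Omega> T] by eventually_elim (auto simp: pw_interior[OF T] c)
  then show thesis by (rule that)
qed

section \<open>Assembly over edges and over triangles\<close>

lemma finite_edges: "is_mesh \<Omega> T \<Longrightarrow> finite (edges T)"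
proof -
  assume T: "is_mesh \<Omega> T"
  have "edges T = (\<Union>K\<in>T. {a. a edge_of K})" by (auto simp: edges_def)
  then show ?thesis using mesh_finite[OF T] finite_edges_of_simplex[OF mesh_simplex[OF T]] by simp
qed

lemma edge_in_edges: "K \<in> T \<Longrightarrow> a edge_of K \<Longrightarrow> a \<in> edges T"
  by (auto simp: edges_def)

lemma sum_edges_swap:
  fixes h :: "edge \<Rightarrow> triangle \<Rightarrow> 'b::comm_monoid_add"
  assumes T: "is_mesh \<Omega> T"
  shows "(\<Sum>a\<in>edges T. \<Sum>K | K \<in> T \<and> a edge_of K. h a K) = (\<Sum>K\<in>T. \<Sum>a | a edge_of K. h a K)"
proof -
  have "(\<Sum>a\<in>edges T. \<Sum>K | K \<in> T \<and> a edge_of K. h a K) = (\<Sum>K\<in>T. \<Sum>a | a \<in> edges T \<and> a edge_of K. h a K)"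
    by (rule sum.swap_restrict[OF finite_edges[OF T] mesh_finite[OF T]])
  also have "\<dots> = (\<Sum>K\<in>T. \<Sum>a | a edge_of K. h a K)"
    by (intro sum.cong refl) (auto intro: edge_in_edges)
  finally show ?thesis .
qed

definition rt_sign :: "(edge \<Rightarrow> plane) \<Rightarrow> triangle \<Rightarrow> edge \<Rightarrow> real" where
  "rt_sign n K a = (if points_out K a (n a) then 1 else - 1)"

definition rt_local :: "(edge \<Rightarrow> plane) \<Rightarrow> (edge \<Rightarrow> real) \<Rightarrow> triangle \<Rightarrow> plane \<Rightarrow> plane" where
  "rt_local n c K x =
     (\<Sum>a | a edge_of K. (c a * rt_sign n K a / (2 * measure lebesgue K)) *\<^sub>R (x - opposite_vertex K a))"

text \<open>The field x - W has divergence 2, which cancels the factor 1/2 of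
  \<open>rt_local\<close>.\<close>

definition rt_div :: "(edge \<Rightarrow> plane) \<Rightarrow> (edge \<Rightarrow> real) \<Rightarrow> triangle \<Rightarrow> real" where
  "rt_div n c K = (\<Sum>a | a edge_of K. c a * rt_sign n K a / measure lebesgue K)"

lemma rt_combination:
  assumes T: "is_mesh \<Omega> T"
  shows "(\<lambda>x. \<Sum>a\<in>edges T. c a *\<^sub>R raviart_thomas T n a x) = pw T (rt_local n c)"
proof
  fix x
  have "raviart_thomas T n a x = (\<Sum>K | K \<in> T \<and> a edge_of K. indicat_real (interior K) x *\<^sub>R
      ((rt_sign n K a / (2 * measure lebesgue K)) *\<^sub>R (x - opposite_vertex K a)))" for a
    unfolding raviart_thomas_def rt_sign_def
    by (rule sum.mono_neutral_cong_left) (auto simp: mesh_finite[OF T])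
  then have "(\<Sum>a\<in>edges T. c a *\<^sub>R raviart_thomas T n a x) =
     (\<Sum>a\<in>edges T. \<Sum>K | K \<in> T \<and> a edge_of K. c a *\<^sub>R (indicat_real (interior K) x *\<^sub>R
      ((rt_sign n K a / (2 * measure lebesgue K)) *\<^sub>R (x - opposite_vertex K a))))"
    by (simp add: scaleR_sum_right)
  also have "\<dots> = (\<Sum>K\<in>T. \<Sum>a | a edge_of K. c a *\<^sub>R (indicat_real (interior K) x *\<^sub>R
      ((rt_sign n K a / (2 * measure lebesgue K)) *\<^sub>R (x - opposite_vertex K a))))"
    by (rule sum_edges_swap[OF T])
  also have "\<dots> = pw T (rt_local n c) x"
    unfolding pw_def rt_local_def scaleR_sum_right
    by (intro sum.cong refl) (simp add: mult.commute mult.left_commute)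
  finally show "(\<Sum>a\<in>edges T. c a *\<^sub>R raviart_thomas T n a x) = pw T (rt_local n c) x" .
qed

lemma rt_local_continuous: "continuous_on X (rt_local n c K)"
  unfolding rt_local_def by (intro continuous_intros)

text \<open>Ordering the end points by the normal alone fixes one orientation for both adjacent
  triangles: the one that the normal leaves has the edge in counterclockwise order, the other in
  reverse.\<close>

lemma edge_orientation:
  assumes K: "2 simplex K" "a edge_of K" and n: "unit_normal a \<nu>"
    and a: "a = closed_segment S N" "cross2 \<nu> (N - S) > 0"
  shows "points_out K a \<nu> \<Longrightarrow> ccw_triangle (opposite_vertex K a) S N K"
    "\<not> points_out K a \<nu> \<Longrightarrow> ccw_triangle (opposite_vertex K a) N S K"
proof -
  obtain S' N' where SN': "ccw_triangle (opposite_vertex K a) S' N' K" "a = closed_segment S' N'"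
    using simplex_2_edge_ccw_triangle[OF K] .
  have "{S, N} = {S', N'}" using a(1) SN'(2) by simp
  then consider "S' = S" "N' = N" | "S' = N" "N' = S" by (auto simp: doubleton_eq_iff)
  then have "(points_out K a \<nu> \<longrightarrow> ccw_triangle (opposite_vertex K a) S N K) \<and>
     (\<not> points_out K a \<nu> \<longrightarrow> ccw_triangle (opposite_vertex K a) N S K)"
  proof cases
    case 1
    then have "points_out K a \<nu>"
      using ccw_triangle_points_out_iff(1)[OF SN'(1)] n a SN'(2) by simp
    then show ?thesis using SN'(1) 1 by simp
  next
    case 2
    have "cross2 \<nu> (S - N) < 0" using a(2) by (simp add: cross2_diff_right)
    then have "\<not> points_out K a \<nu>"
      using ccw_triangle_points_out_iff(1)[OF SN'(1)] n SN'(2) 2 by simp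
    then show ?thesis using SN'(1) 2 by simp
  qed
  then show "points_out K a \<nu> \<Longrightarrow> ccw_triangle (opposite_vertex K a) S N K"
    "\<not> points_out K a \<nu> \<Longrightarrow> ccw_triangle (opposite_vertex K a) N S K" by blast+
qed

lemma edge_oriented_endpoints:
  assumes "2 simplex K" "a edge_of K" "unit_normal a \<nu>"
  obtains S N where "a = closed_segment S N" "cross2 \<nu> (N - S) > 0"
proof -
  obtain S N where SN: "ccw_triangle (opposite_vertex K a) S N K" "a = closed_segment S N"
    using simplex_2_edge_ccw_triangle[OF assms(1,2)] .
  have "cross2 \<nu> (N - S) \<noteq> 0" using ccw_triangle_points_out_iff(2)[OF SN(1)] assms(3) SN(2) by simp
  then consider "cross2 \<nu> (N - S) > 0" | "cross2 \<nu> (S - N) > 0"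
    by (cases "cross2 \<nu> (N - S) > 0") (auto simp: cross2_diff_right)
  then show thesis
    using that[of S N] that[of N S] SN(2) closed_segment_commute[of S N] by cases auto
qed

lemma unit_normal_uminus: "unit_normal a \<nu> \<Longrightarrow> unit_normal a (- \<nu>)"
  by (simp add: unit_normal_def)

text \<open>If \<psi> vanishes on the open edge, then by continuity it vanishes on the whole edge
  and every flux is 0; this covers boundary edges. Otherwise the edge has a relatively interior
  point in \<open>\<Omega>\<close>, so exactly two triangles meet along it, on opposite sides, with
  equal fluxes and opposite signs.\<close>

lemma rt_flux_edge_cancel:
  assumes \<Omega>: "convex_polygonal_domain \<Omega>" and T: "is_mesh \<Omega> T" and n: "mesh_normals \<Omega> T n"
    and a: "a \<in> edges T" and \<psi>: "test_function \<Omega> \<psi>" and G: "\<And>x. GDERIV \<psi> x :> G x"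
  shows "(\<Sum>K | K \<in> T \<and> a edge_of K. rt_sign n K a * rt_flux (opposite_vertex K a) K \<psi> G) = 0"
proof -
  define \<nu> where "\<nu> = n a"
  have \<nu>: "unit_normal a \<nu>" using n a by (simp add: mesh_normals_def \<nu>_def)
  have cG: "continuous_on UNIV G" by (rule test_function_gradient(1)[OF \<psi> G])
  obtain K0 where K0: "K0 \<in> T" "a edge_of K0" using a by (auto simp: edges_def)
  obtain S N where SN: "a = closed_segment S N" "cross2 \<nu> (N - S) > 0"
    using edge_oriented_endpoints[OF mesh_simplex[OF T K0(1)] K0(2) \<nu>] .
  have "S \<noteq> N" using SN(2) by (auto simp: cross2_zero)
  show ?thesis
  proof (cases "\<forall>x\<in>open_segment S N. \<psi> x = 0")
    case True
    have zero: "\<psi> x = 0" if "x \<in> a" for x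
    proof (rule continuous_constant_on_closure[where S = "open_segment S N"])
      show "continuous_on (closure (open_segment S N)) \<psi>" using GDERIV_imp_continuous_on[OF G] .
      show "x \<in> closure (open_segment S N)" using that SN(1) \<open>S \<noteq> N\<close> by simp
    qed (use True in auto)
    have "rt_flux (opposite_vertex K a) K \<psi> G = 0" if K: "K \<in> T" "a edge_of K" for K
    proof -
      obtain S' N' where "ccw_triangle (opposite_vertex K a) S' N' K" "a = closed_segment S' N'"
        using simplex_2_edge_ccw_triangle[OF mesh_simplex[OF T K(1)] K(2)] .
      then show ?thesis using rt_flux_zero[OF G cG, of S' N' "opposite_vertex K a"] zero
        by (simp add: ccw_triangle_def)
    qed
    then show ?thesis by simp
  next
    case False
    then obtain z where z: "z \<in> open_segment S N" "\<psi> z \<noteq> 0" by blast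
    then have "z \<in> \<Omega>" using \<psi> closure_subset[of "{x. \<psi> x \<noteq> 0}"] by (auto simp: test_function_def)
    have pos: "ccw_triangle (opposite_vertex K a) S N K" if "K \<in> T" "a edge_of K" "points_out K a \<nu>" for K
      using edge_orientation(1)[OF mesh_simplex[OF T that(1)] that(2) \<nu> SN that(3)] .
    have neg: "ccw_triangle (opposite_vertex K a) N S K" if "K \<in> T" "a edge_of K" "\<not> points_out K a \<nu>" for K
      using edge_orientation(2)[OF mesh_simplex[OF T that(1)] that(2) \<nu> SN that(3)] .
    have n\<nu>: "\<nu> \<noteq> 0" "\<nu> \<bullet> (N - S) = 0" "\<nu> \<bullet> (S - N) = 0"
      using \<nu> SN(1) unit_normal_segment[of S N \<nu>] by (auto simp: inner_diff_right)
    have zN: "z \<in> open_segment N S" using z(1) open_segment_commute[of S N] by simp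
    have aN: "a = closed_segment N S" using SN(1) closed_segment_commute[of S N] by simp
    have "\<exists>K L. K \<in> T \<and> L \<in> T \<and> a edge_of K \<and> a edge_of L \<and> points_out K a \<nu> \<and> \<not> points_out L a \<nu>"
    proof (cases "points_out K0 a \<nu>")
      case True
      have c: "ccw_triangle (opposite_vertex K0 a) S N K0" using pos K0 True by blast
      then have "\<nu> \<bullet> (opposite_vertex K0 a - S) < 0"
        using ccw_triangle_normal(2)[OF c n\<nu>(1,2)] True SN(1) by simp
      then obtain L where "L \<in> T" "closed_segment S N edge_of L" "\<not> points_out L (closed_segment S N) \<nu>"
        using mesh_edge_neighbour[OF \<Omega> T K0(1) c n\<nu>(2) _ z(1) \<open>z \<in> \<Omega>\<close>] by blast
      then show ?thesis using K0 True SN(1) by blast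
    next
      case False
      have c: "ccw_triangle (opposite_vertex K0 a) N S K0" using neg K0 False by blast
      have "\<nu> \<bullet> (opposite_vertex K0 a - N) > 0"
        using ccw_triangle_normal(1,2)[OF c n\<nu>(1,3)] False aN by auto
      \<comment> \<open>The given triangle is now the one that the normal enters; the neighbour is
        found with the reversed normal.\<close>
      then have "(- \<nu>) \<bullet> (opposite_vertex K0 a - N) < 0" "(- \<nu>) \<bullet> (S - N) = 0" using n\<nu>(3) by simp_all
      then obtain L where L: "L \<in> T" "closed_segment N S edge_of L" "\<not> points_out L (closed_segment N S) (- \<nu>)"
        using mesh_edge_neighbour[OF \<Omega> T K0(1) c _ _ zN \<open>z \<in> \<Omega>\<close>] by blast
      have "points_out L a \<nu>"
      proof (rule ccontr)
        assume "\<not> points_out L a \<nu>"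
        then have cL: "ccw_triangle (opposite_vertex L a) N S L" using neg L aN by blast
        have "cross2 (- \<nu>) (S - N) > 0" using SN(2) by (simp add: cross2_def algebra_simps)
        then show False
          using ccw_triangle_points_out_iff(1)[OF cL] unit_normal_uminus[OF \<nu>] aN L(3) by simp
      qed
      then show ?thesis using K0 False L(1,2) aN by blast
    qed
    then obtain K L where KL: "K \<in> T" "L \<in> T" "a edge_of K" "a edge_of L" "points_out K a \<nu>" "\<not> points_out L a \<nu>"
      by blast
    have cK: "ccw_triangle (opposite_vertex K a) S N K" using pos KL by blast
    have cL: "ccw_triangle (opposite_vertex L a) N S L" using neg KL by blast
    have set: "{J. J \<in> T \<and> a edge_of J} = {K, L}"
    proof
      show "{J. J \<in> T \<and> a edge_of J} \<subseteq> {K, L}"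
      proof
        fix J assume "J \<in> {J. J \<in> T \<and> a edge_of J}"
        then have J: "J \<in> T" "a edge_of J" by auto
        show "J \<in> {K, L}"
        proof (cases "points_out J a \<nu>")
          case True
          then show ?thesis using mesh_edge_same_side[OF T J(1) KL(1) pos[OF J True] cK] by simp
        next
          case False
          then show ?thesis using mesh_edge_same_side[OF T J(1) KL(2) neg[OF J False] cL] by simp
        qed
      qed
    qed (use KL in auto)
    have "K \<noteq> L" using KL by blast
    have "rt_flux (opposite_vertex K a) K \<psi> G = rt_flux (opposite_vertex L a) L \<psi> G"
    proof -
      have "cross2 (S - opposite_vertex K a) (N - opposite_vertex K a) \<noteq> 0"
        "cross2 (S - opposite_vertex L a) (N - opposite_vertex L a) \<noteq> 0"
        using cK cL cross2_swap[of "S - opposite_vertex L a" "N - opposite_vertex L a"]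
        by (auto simp: ccw_triangle_def)
      from rt_flux_neighbour[OF G cG this] show ?thesis
        using cK cL by (simp add: ccw_triangle_def insert_commute)
    qed
    moreover have "rt_sign n K a = 1" "rt_sign n L a = - 1" using KL by (simp_all add: rt_sign_def \<nu>_def)
    ultimately show ?thesis unfolding set using \<open>K \<noteq> L\<close> by simp
  qed
qed

lemma simplex_measure_pos:
  fixes K :: triangle
  assumes "2 simplex K"
  shows "measure lebesgue K > 0"
proof -
  have "interior K \<noteq> {}"
    using aff_dim_simplex[OF assms] convex_simplex[OF assms] interior_rel_interior_gen[of K]
      rel_interior_eq_empty[of K] by (auto simp: aff_dim_empty)
  then have "\<not> negligible (interior K)" by (intro open_not_negligible) auto
  then have "\<not> negligible K" using interior_subset negligible_subset by blast
  then have "measure lebesgue K \<noteq> 0"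
    using negligible_iff_measure0[OF lmeasurable_compact[OF compact_simplex[OF assms]]] by simp
  then show ?thesis using measure_nonneg[of lebesgue K] by linarith
qed

text \<open>On each triangle, q . grad \<psi> + div q \<psi> integrates to a combination of
  \<open>rt_flux\<close> terms, one for each edge. Summing by edges instead of by triangles makes
  them cancel.\<close>

lemma rt_weak_div:
  assumes \<Omega>: "convex_polygonal_domain \<Omega>" and T: "is_mesh \<Omega> T" and n: "mesh_normals \<Omega> T n"
  shows "has_weak_div \<Omega> (pw T (rt_local n c)) (pw T (\<lambda>K x. rt_div n c K))"
  unfolding has_weak_div_def
proof (intro allI impI)
  fix \<psi> G assume "test_function \<Omega> \<psi> \<and> (\<forall>x. GDERIV \<psi> x :> G x)"
  then have \<psi>: "test_function \<Omega> \<psi>" and G: "\<And>x. GDERIV \<psi> x :> G x" by auto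
  have cG: "continuous_on X G" for X using test_function_gradient(1)[OF \<psi> G] continuous_on_subset by blast
  have c\<psi>: "continuous_on X \<psi>" for X by (rule GDERIV_imp_continuous_on[OF G])
  have local: "integral K (\<lambda>x. rt_local n c K x \<bullet> G x) + integral K (\<lambda>x. rt_div n c K * \<psi> x)
     = (\<Sum>a | a edge_of K. c a / 2 * (rt_sign n K a * rt_flux (opposite_vertex K a) K \<psi> G))"
    if K: "K \<in> T" for K
  proof -
    note s = mesh_simplex[OF T K]
    have cK: "compact K" using s by (rule compact_simplex)
    have fin: "finite {a. a edge_of K}" using s by (rule finite_edges_of_simplex)
    let ?d = "\<lambda>a. c a * rt_sign n K a / (2 * measure lebesgue K)"
    have "integral K (\<lambda>x. rt_local n c K x \<bullet> G x) + integral K (\<lambda>x. rt_div n c K * \<psi> x)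
        = integral K (\<lambda>x. rt_local n c K x \<bullet> G x + rt_div n c K * \<psi> x)"
      by (intro integral_add[symmetric] integrable_continuous_compact(3)[OF cK] continuous_intros cG c\<psi> rt_local_continuous)
    also have "(\<lambda>x. rt_local n c K x \<bullet> G x + rt_div n c K * \<psi> x)
        = (\<lambda>x. \<Sum>a | a edge_of K. ?d a * ((x - opposite_vertex K a) \<bullet> G x + 2 * \<psi> x))"
      by (rule ext) (simp add: rt_local_def rt_div_def inner_sum_left sum_distrib_right distrib_left
          mult.assoc flip: sum.distrib)
    also have "integral K \<dots> = (\<Sum>a | a edge_of K. integral K (\<lambda>x. ?d a * ((x - opposite_vertex K a) \<bullet> G x + 2 * \<psi> x)))"
      by (intro integral_sum fin integrable_continuous_compact(3)[OF cK] continuous_intros cG c\<psi>)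
    also have "\<dots> = (\<Sum>a | a edge_of K. c a / 2 * (rt_sign n K a * rt_flux (opposite_vertex K a) K \<psi> G))"
      by (intro sum.cong refl) (simp add: rt_flux_def)
    finally show ?thesis .
  qed
  have "ip \<Omega> (pw T (rt_local n c)) G + ip \<Omega> (pw T (\<lambda>K x. rt_div n c K)) \<psi>
     = (\<Sum>K\<in>T. integral K (\<lambda>x. rt_local n c K x \<bullet> G x) + integral K (\<lambda>x. rt_div n c K * \<psi> x))"
    by (simp add: pw_ip_left[OF \<Omega> T] rt_local_continuous cG c\<psi> sum.distrib)
  also have "\<dots> = (\<Sum>K\<in>T. \<Sum>a | a edge_of K. c a / 2 * (rt_sign n K a * rt_flux (opposite_vertex K a) K \<psi> G))"
    by (intro sum.cong refl local)
  also have "\<dots> = (\<Sum>a\<in>edges T. \<Sum>K | K \<in> T \<and> a edge_of K. c a / 2 * (rt_sign n K a * rt_flux (opposite_vertex K a) K \<psi> G))"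
    by (rule sum_edges_swap[OF T, symmetric])
  also have "\<dots> = 0"
    by (simp only: sum_distrib_left[symmetric] rt_flux_edge_cancel[OF \<Omega> T n _ \<psi> G] mult_zero_right
        sum.neutral_const cong: sum.cong)
  finally show "ip \<Omega> (pw T (rt_local n c)) G = - ip \<Omega> (pw T (\<lambda>K x. rt_div n c K)) \<psi>" by simp
qed

subsection \<open>Angles and the kernel of the Newtonian field\<close>

text \<open>An isometry that makes winding numbers available for points of
  \<open>real^2\<close>.\<close>

definition cplx :: "plane \<Rightarrow> complex" where
  "cplx x = Complex (x $ 1) (x $ 2)"

lemma linear_cplx: "linear cplx"
  by (rule linearI) (simp_all add: cplx_def complex_eq_iff)

lemma inj_cplx: "inj cplx"
  by (auto simp: inj_def cplx_def vec_eq_iff forall_2)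

lemma norm_cplx: "norm (cplx x) = norm x"
  by (simp add: cplx_def cmod_def norm_vec_def L2_set_def sum_2)

lemma cplx_diff: "cplx x - cplx y = cplx (x - y)"
  by (simp add: linear_diff[OF linear_cplx])

lemma cplx_in_closed_segment: "cplx y \<in> closed_segment (cplx S) (cplx N) \<longleftrightarrow> y \<in> closed_segment S N"
  by (simp add: closed_segment_linear_image[OF linear_cplx] inj_image_mem_iff[OF inj_cplx])

text \<open>The angle under which the segment from \<open>S\<close> to \<open>N\<close> is seen from \<open>y\<close>, in units of \<open>2\<pi>\<close>. It is
  the flux through the segment of the gradient of the fundamental solution of the Laplacian with
  pole at \<open>y\<close>.\<close>

definition edge_angle :: "plane \<Rightarrow> plane \<Rightarrow> plane \<Rightarrow> real" where
  "edge_angle S N y =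
     (if y \<in> closed_segment S N then 0 else Re (winding_number (linepath (cplx S) (cplx N)) (cplx y)))"

lemma edge_angle_swap: "edge_angle N S y = - edge_angle S N y"
proof (cases "y \<in> closed_segment S N")
  case True
  then have "y \<in> closed_segment N S" using closed_segment_commute[of S N] by simp
  then show ?thesis using True by (simp add: edge_angle_def)
next
  case False
  then have "y \<notin> closed_segment N S" using closed_segment_commute[of S N] by simp
  moreover have "cplx y \<notin> path_image (linepath (cplx S) (cplx N))" using False cplx_in_closed_segment by simp
  then have "winding_number (reversepath (linepath (cplx S) (cplx N))) (cplx y) = - winding_number (linepath (cplx S) (cplx N)) (cplx y)"
    by (intro winding_number_reversepath) auto
  ultimately show ?thesis using False by (simp add: edge_angle_def)
qed

lemma edge_angle_half: "\<bar>edge_angle S N y\<bar> \<le> 1 / 2"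
  using winding_number_lt_half_linepath[of "cplx y" "cplx S" "cplx N"] cplx_in_closed_segment[of y S N]
  by (auto simp: edge_angle_def less_imp_le)

lemma edge_angle_measurable: "edge_angle S N \<in> borel_measurable borel"
proof -
  have "continuous_on (- closed_segment S N) (\<lambda>y. Re (winding_number (linepath (cplx S) (cplx N)) (cplx y)))"
  proof (intro continuous_on_Re continuous_on_compose2[OF continuous_on_winding_number])
    show "continuous_on (- closed_segment S N) cplx"
      using linear_cplx by (simp add: linear_continuous_on linear_linear)
    show "cplx ` (- closed_segment S N) \<subseteq> - path_image (linepath (cplx S) (cplx N))"
      using cplx_in_closed_segment by auto
  qed auto
  then show ?thesis unfolding edge_angle_def
    by (intro borel_measurable_continuous_on_if) (auto intro: borel_closed)
qed

text \<open>Up to distance 2 h the trivial bound 1/2 suffices. Farther away, every point of the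
  segment is at distance at least |x - y| / 2 from \<open>y\<close>, and the standard estimate of
  the contour integral applies; division by 2 pi leaves room.\<close>

lemma edge_angle_decay:
  assumes seg: "\<And>e. e \<in> closed_segment S N \<Longrightarrow> norm (x - e) \<le> h" and SN: "norm (N - S) \<le> h"
  shows "\<bar>edge_angle S N y\<bar> * norm (x - y) \<le> h"
proof -
  have h: "h \<ge> 0" using SN norm_ge_zero[of "N - S"] by linarith
  consider "y \<in> closed_segment S N" | "norm (x - y) \<le> 2 * h"
    | "y \<notin> closed_segment S N" "norm (x - y) > 2 * h" by linarith
  then show ?thesis
  proof cases
    case 1
    then show ?thesis using h by (simp add: edge_angle_def)
  next
    case 2
    have "\<bar>edge_angle S N y\<bar> * norm (x - y) \<le> (1 / 2) * (2 * h)"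
      using 2 edge_angle_half by (intro mult_mono) auto
    then show ?thesis by simp
  next
    case 3
    let ?\<gamma> = "linepath (cplx S) (cplx N)"
    have xy: "norm (x - y) > 0" using 3(2) h by linarith
    have nin: "cplx y \<notin> path_image ?\<gamma>" using 3(1) cplx_in_closed_segment by simp
    have "norm (2 * pi * \<i> * winding_number ?\<gamma> (cplx y)) \<le> (2 / norm (x - y)) * norm (cplx N - cplx S)"
    proof (rule has_contour_integral_bound_linepath)
      show "((\<lambda>w. 1 / (w - cplx y)) has_contour_integral 2 * pi * \<i> * winding_number ?\<gamma> (cplx y)) ?\<gamma>"
        using has_contour_integral_winding_number[OF valid_path_linepath nin] by simp
      show "0 \<le> 2 / norm (x - y)" by simp
      fix w assume "w \<in> closed_segment (cplx S) (cplx N)"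
      then obtain e where e: "e \<in> closed_segment S N" "w = cplx e"
        by (auto simp: closed_segment_linear_image[OF linear_cplx])
      have "norm (x - y) \<le> norm (x - e) + norm (e - y)"
        using norm_triangle_ineq[of "x - e" "e - y"] by simp
      then have "norm (x - y) / 2 \<le> norm (e - y)" using seg[OF e(1)] 3(2) by linarith
      moreover have "norm (w - cplx y) = norm (e - y)" by (simp add: e(2) cplx_diff norm_cplx)
      ultimately have "norm (x - y) / 2 \<le> norm (w - cplx y)" by simp
      moreover from this have "0 < norm (w - cplx y)" using xy by linarith
      ultimately have "1 / norm (w - cplx y) \<le> 1 / (norm (x - y) / 2)"
        using xy by (intro divide_left_mono mult_pos_pos) auto
      then show "norm (1 / (w - cplx y)) \<le> 2 / norm (x - y)" by (simp add: norm_divide)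
    qed
    then have "2 * pi * norm (winding_number ?\<gamma> (cplx y)) \<le> 2 / norm (x - y) * norm (N - S)"
      by (simp add: norm_mult cplx_diff norm_cplx)
    also have "\<dots> \<le> 2 / norm (x - y) * h" using SN by (intro mult_left_mono) auto
    finally have "pi * norm (winding_number ?\<gamma> (cplx y)) * norm (x - y) \<le> h"
      using xy by (simp add: field_simps)
    moreover have "1 * (norm (winding_number ?\<gamma> (cplx y)) * norm (x - y))
        \<le> pi * (norm (winding_number ?\<gamma> (cplx y)) * norm (x - y))"
      using pi_gt3 by (intro mult_right_mono) auto
    ultimately have "norm (winding_number ?\<gamma> (cplx y)) * norm (x - y) \<le> h" by (simp add: mult.assoc)
    moreover have "\<bar>edge_angle S N y\<bar> \<le> norm (winding_number ?\<gamma> (cplx y))"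
      using abs_Re_le_cmod by (simp add: edge_angle_def)
    ultimately show ?thesis
      by (meson mult_right_mono norm_ge_zero order_trans)
  qed
qed

text \<open>The three segments form a closed contour, run through counterclockwise. Points on the
  edges are excluded because winding numbers are not additive there.\<close>

lemma edge_angle_triangle:
  assumes K: "ccw_triangle W S N K"
    and y: "y \<notin> closed_segment S N" "y \<notin> closed_segment N W" "y \<notin> closed_segment W S"
  shows "edge_angle S N y + edge_angle N W y + edge_angle W S y = indicator (interior K) y"
proof -
  let ?w = "winding_number (linepath (cplx W) (cplx S) +++ linepath (cplx S) (cplx N) +++ linepath (cplx N) (cplx W)) (cplx y)"
  let ?C = "convex hull {cplx W, cplx S, cplx N}"
  have nin: "cplx y \<notin> closed_segment (cplx S) (cplx N)" "cplx y \<notin> closed_segment (cplx N) (cplx W)"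
    "cplx y \<notin> closed_segment (cplx W) (cplx S)"
    using y by (simp_all add: cplx_in_closed_segment)
  have sum: "Re ?w = edge_angle S N y + edge_angle N W y + edge_angle W S y"
    using nin y by (simp add: winding_number_join path_image_join edge_angle_def)
  have hull: "?C = cplx ` K"
    using K convex_hull_linear_image[OF linear_cplx, of "{W, S, N}"] by (simp add: ccw_triangle_def)
  have mem: "cplx y \<in> ?C \<longleftrightarrow> y \<in> K" unfolding hull by (rule inj_image_mem_iff[OF inj_cplx])
  have iK: "y \<in> interior K \<longleftrightarrow> y \<in> K"
    using K y interior_of_triangle[of W S N] by (auto simp: ccw_triangle_def)
  show ?thesis
  proof (cases "y \<in> K")
    case True
    have "cplx y \<in> interior ?C"
      using True mem nin interior_of_triangle[of "cplx W" "cplx S" "cplx N"] by auto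
    then have w: "?w = (if 0 < Im ((cplx S - cplx W) * cnj (cplx S - cplx y)) then 1 else - 1)"
      by (rule winding_number_triangle)
    obtain a b c where abc: "0 \<le> a" "0 \<le> b" "0 \<le> c" "a + b + c = 1" "y = a *\<^sub>R W + b *\<^sub>R S + c *\<^sub>R N"
      using True K unfolding ccw_triangle_def convex_hull_3 by blast
    have "c \<noteq> 0"
    proof
      assume "c = 0"
      then have "y = (1 - b) *\<^sub>R W + b *\<^sub>R S" "b \<le> 1" using abc by auto
      then have "y \<in> closed_segment W S" using abc(2) unfolding in_segment by blast
      then show False using y by blast
    qed
    then have c: "c > 0" using abc(3) by simp
    have a: "a = 1 - b - c" using abc(4) by simp
    \<comment> \<open>c is the barycentric coordinate of \<open>y\<close> belonging to
      \<open>N\<close>; it is positive because \<open>y\<close> is not on the edge from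
      \<open>W\<close> to \<open>S\<close>.\<close>
    have "Im ((cplx S - cplx W) * cnj (cplx S - cplx y)) = c * cross2 (S - W) (N - W)"
      unfolding abc(5) a by (simp add: cplx_def cross2_def algebra_simps)
    also have "\<dots> > 0" using c K by (simp add: ccw_triangle_def)
    finally have "?w = 1" using w by simp
    then show ?thesis using sum True iK by simp
  next
    case False
    have "?w = 0"
    proof (rule winding_number_zero_outside[of _ ?C])
      show "cplx y \<notin> ?C" using False mem by blast
      have "closed_segment p q \<subseteq> ?C" if "p \<in> {cplx W, cplx S, cplx N}" "q \<in> {cplx W, cplx S, cplx N}" for p q
        using that by (intro closed_segment_subset hull_inc convex_convex_hull) auto
      then show "path_image (linepath (cplx W) (cplx S) +++ linepath (cplx S) (cplx N) +++ linepath (cplx N) (cplx W)) \<subseteq> ?C"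
        by (simp add: path_image_join)
    qed (auto intro!: path_join_imp)
    then show ?thesis using sum False iK by simp
  qed
qed

text \<open>The kernel is dominated by a sum over dyadic discs around the singularity.\<close>

lemma inverse_norm_integral_bound:
  fixes y :: plane
  assumes R: "R > 0" and S: "S \<in> sets lebesgue" "S \<subseteq> cball y R"
  shows "integrable (lebesgue_on S) (\<lambda>x. inverse (norm (x - y)))"
    "(LINT x|lebesgue_on S. inverse (norm (x - y))) \<le> 4 * pi * R"
proof -
  let ?k = "\<lambda>x. inverse (norm (x - y))"
  \<comment> \<open>On the ring between the radii R / 2^(k+1) and R / 2^k the kernel is at most
    2^(k+1) / R. Extending this constant to the whole disc costs only a factor and leaves a
    geometric series.\<close>
  define b where "b = (\<lambda>(k::nat) x. ennreal (2 ^ (k + 1) / R) * indicator (cball y (R / 2 ^ k)) x)"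
  have meas: "?k \<in> borel_measurable lebesgue"
    by (intro measurable_completion borel_measurable_inverse) simp
  have dyadic: "ennreal (?k x) * indicator S x \<le> (\<Sum>k. b k x)" for x
  \<comment> \<open>At the pole the kernel is 0, since \<open>inverse 0 = 0\<close>. Elsewhere the
    least k with R / 2^k < t is positive because t \<le> R, and its predecessor is the index of the
    ring.\<close>
  proof (cases "x \<in> S \<and> x \<noteq> y")
    case True
    define t where "t = norm (x - y)"
    have t: "0 < t" "t \<le> R" using True S(2) by (auto simp: t_def dist_norm norm_minus_commute)
    obtain m where m: "R / t < 2 ^ m" using real_arch_pow[of 2 "R / t"] by auto
    define k where "k = (LEAST m. R / t < 2 ^ m)"
    have k: "R / t < 2 ^ k" using LeastI[of "\<lambda>m. R / t < 2 ^ m", OF m] by (simp add: k_def)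
    have "k \<noteq> 0" using k t by (intro notI) (simp add: field_simps)
    then obtain j where j: "k = Suc j" using not0_implies_Suc by blast
    have "\<not> R / t < 2 ^ j" using not_less_Least[of j "\<lambda>m. R / t < 2 ^ m"] j by (simp add: k_def)
    then have "t \<le> R / 2 ^ j" using t by (simp add: field_simps)
    then have x: "x \<in> cball y (R / 2 ^ j)" by (simp add: t_def dist_norm norm_minus_commute)
    have "1 / t \<le> 2 ^ (j + 1) / R" using k j t R by (simp add: field_simps)
    then have "ennreal (?k x) \<le> b j x" using x by (simp add: b_def t_def inverse_eq_divide ennreal_leI)
    also have "\<dots> \<le> (\<Sum>k. b k x)"
      using sum_le_suminf[of "\<lambda>k. b k x" "{j}"] by simp
    finally show ?thesis using True by simp
  qed auto
  have b_int: "(\<integral>\<^sup>+x. b k x \<partial>lebesgue) = ennreal (2 * pi * R * (1 / 2) ^ k)" for k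
  proof -
    have r: "0 \<le> R / 2 ^ k" using R by simp
    have "measure lebesgue (cball y (R / 2 ^ k)) = (R / 2 ^ k)\<^sup>2 * pi"
      using content_cball_conv_ball[of y "R / 2 ^ k"] circle_area[OF r, of y] by simp
    then have "emeasure lebesgue (cball y (R / 2 ^ k)) = ennreal ((R / 2 ^ k)\<^sup>2 * pi)"
      by (metis emeasure_eq_measure2 lmeasurable_cball)
    then have "(\<integral>\<^sup>+x. b k x \<partial>lebesgue) = ennreal (2 ^ (k + 1) / R) * ennreal ((R / 2 ^ k)\<^sup>2 * pi)"
      unfolding b_def by (simp add: nn_integral_cmult_indicator)
    also have "\<dots> = ennreal (2 ^ (k + 1) / R * ((R / 2 ^ k)\<^sup>2 * pi))"
      using R by (intro ennreal_mult[symmetric]) auto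
    also have "2 ^ (k + 1) / R * ((R / 2 ^ k)\<^sup>2 * pi) = 2 * pi * R * (1 / 2) ^ k"
      using R by (simp add: power2_eq_square power_divide field_simps)
    finally show ?thesis .
  qed
  have "(\<integral>\<^sup>+x. ennreal (?k x) \<partial>lebesgue_on S) = (\<integral>\<^sup>+x. ennreal (?k x) * indicator S x \<partial>lebesgue)"
    using S(1) by (simp add: nn_integral_restrict_space)
  also have "\<dots> \<le> (\<integral>\<^sup>+x. (\<Sum>k. b k x) \<partial>lebesgue)" by (intro nn_integral_mono dyadic)
  also have "\<dots> = (\<Sum>k. \<integral>\<^sup>+x. b k x \<partial>lebesgue)"
    unfolding b_def
    by (intro nn_integral_suminf borel_measurable_times_ennreal borel_measurable_const borel_measurable_indicator) simp
  also have "\<dots> = ennreal (4 * pi * R)"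
    unfolding b_int
  proof (rule suminf_ennreal_eq)
    show "0 \<le> 2 * pi * R * (1 / 2) ^ k" for k using R by simp
    have "(\<lambda>k. (1 / 2 :: real) ^ k) sums (1 / (1 - 1 / 2))" by (rule geometric_sums) simp
    from sums_mult[OF this, of "2 * pi * R"] show "(\<lambda>k. 2 * pi * R * (1 / 2) ^ k) sums (4 * pi * R)" by (simp add: mult.assoc)
  qed
  finally have le: "(\<integral>\<^sup>+x. ennreal (?k x) \<partial>lebesgue_on S) \<le> ennreal (4 * pi * R)" .
  have meas': "?k \<in> borel_measurable (lebesgue_on S)" using meas by (rule measurable_restrict_space1)
  have pos: "AE x in lebesgue_on S. 0 \<le> ?k x" by simp
  show int: "integrable (lebesgue_on S) ?k"
  proof (rule integrableI_nonneg[OF meas' pos])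
    show "(\<integral>\<^sup>+x. ennreal (?k x) \<partial>lebesgue_on S) < \<infinity>"
      using le_less_trans[OF le ennreal_less_top] by (simp add: infinity_ennreal_def)
  qed
  have "ennreal (LINT x|lebesgue_on S. ?k x) = (\<integral>\<^sup>+x. ennreal (?k x) \<partial>lebesgue_on S)"
    by (rule nn_integral_eq_integral[OF int pos, symmetric])
  then have "ennreal (LINT x|lebesgue_on S. ?k x) \<le> ennreal (4 * pi * R)" using le by simp
  then show "(LINT x|lebesgue_on S. ?k x) \<le> 4 * pi * R" using R by (simp add: ennreal_le_iff)
qed

text \<open>The condition on \<open>\<nu>\<close> determines the order of the end points: crossing \<open>a\<close> in direction \<open>\<nu>\<close>, one
  has the second end point on the left.\<close>

definition edge_flux_angle :: "plane \<Rightarrow> edge \<Rightarrow> plane \<Rightarrow> real" where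
  "edge_flux_angle \<nu> a y =
     (let p = (SOME p. a = closed_segment (fst p) (snd p) \<and> cross2 \<nu> (snd p - fst p) > 0)
      in edge_angle (fst p) (snd p) y)"

lemma edge_flux_angle_eq:
  assumes "a = closed_segment S N" "cross2 \<nu> (N - S) > 0"
  shows "edge_flux_angle \<nu> a y = edge_angle S N y"
proof -
  have "(SOME p. a = closed_segment (fst p) (snd p) \<and> cross2 \<nu> (snd p - fst p) > 0) = (S, N)"
  proof (rule some_equality)
    fix p assume p: "a = closed_segment (fst p) (snd p) \<and> cross2 \<nu> (snd p - fst p) > 0"
    then have "{S, N} = {fst p, snd p}" using assms(1) by simp
    then consider "fst p = S" "snd p = N" | "fst p = N" "snd p = S" by (auto simp: doubleton_eq_iff)
    then show "p = (S, N)"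
    proof cases
      case 2
      then have "cross2 \<nu> (S - N) > 0" using p by simp
      then show ?thesis using assms(2) by (simp add: cross2_diff_right)
    qed (simp add: prod_eq_iff)
  qed (use assms in auto)
  then show ?thesis by (simp add: edge_flux_angle_def)
qed

text \<open>Reversing the normal flips both the sign and the angle, so that only the orientation of
  \<open>K\<close> remains.\<close>

lemma rt_sign_edge_flux_angle:
  assumes K: "ccw_triangle W S N K" and n: "unit_normal (closed_segment S N) (n (closed_segment S N))"
  shows "rt_sign n K (closed_segment S N) * edge_flux_angle (n (closed_segment S N)) (closed_segment S N) y
    = edge_angle S N y"
proof (cases "cross2 (n (closed_segment S N)) (N - S) > 0")
  case True
  then show ?thesis
    using ccw_triangle_points_out_iff(1)[OF K n] edge_flux_angle_eq[OF refl True] by (simp add: rt_sign_def)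
next
  case False
  then have "cross2 (n (closed_segment S N)) (S - N) > 0"
    using ccw_triangle_points_out_iff(2)[OF K n] by (simp add: cross2_diff_right)
  then have "edge_flux_angle (n (closed_segment S N)) (closed_segment S N) y = edge_angle N S y"
    by (intro edge_flux_angle_eq) (simp_all add: closed_segment_commute)
  then show ?thesis
    using False ccw_triangle_points_out_iff(1)[OF K n] edge_angle_swap[of N S y] by (simp add: rt_sign_def)
qed

text \<open>Gauss's law: the total flux out of \<open>K\<close> of the field of a unit source at
  \<open>y\<close> is 1 if the source is inside and 0 if it is outside.\<close>

lemma sum_rt_sign_edge_flux_angle:
  assumes K: "2 simplex K" and n: "\<And>a. a edge_of K \<Longrightarrow> unit_normal a (n a)"
    and y: "\<And>a. a edge_of K \<Longrightarrow> y \<notin> a"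
  shows "(\<Sum>a | a edge_of K. rt_sign n K a * edge_flux_angle (n a) a y) = indicator (interior K) y"
proof -
  obtain W S N where c: "ccw_triangle W S N K" using simplex_2_ccw_triangle[OF K] .
  note c1 = ccw_triangle_rotate[OF c]
  note c2 = ccw_triangle_rotate[OF c1]
  have e: "closed_segment S N edge_of K" "closed_segment N W edge_of K" "closed_segment W S edge_of K"
    using ccw_triangle_edge_of(1)[OF c] ccw_triangle_edge_of(1)[OF c1] ccw_triangle_edge_of(1)[OF c2] by auto
  show ?thesis
    unfolding sum_edges_of_ccw_triangle[OF c] rt_sign_edge_flux_angle[of _ _ _ K n, OF c n[OF e(1)]]
      rt_sign_edge_flux_angle[of _ _ _ K n, OF c1 n[OF e(2)]] rt_sign_edge_flux_angle[of _ _ _ K n, OF c2 n[OF e(3)]]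
    by (rule edge_angle_triangle[OF c y[OF e(1)] y[OF e(2)] y[OF e(3)]])
qed

lemma edge_flux_angle_props:
  assumes K: "2 simplex K" "a edge_of K" and \<nu>: "unit_normal a \<nu>"
  shows "edge_flux_angle \<nu> a \<in> borel_measurable borel"
    "\<bar>edge_flux_angle \<nu> a y\<bar> \<le> 1"
    "x \<in> K \<Longrightarrow> \<bar>edge_flux_angle \<nu> a y\<bar> * norm (x - y) \<le> diameter K"
proof -
  obtain S N where SN: "a = closed_segment S N" "cross2 \<nu> (N - S) > 0"
    using edge_oriented_endpoints[OF K \<nu>] .
  have eq: "edge_flux_angle \<nu> a = edge_angle S N" using edge_flux_angle_eq[OF SN] by blast
  show "edge_flux_angle \<nu> a \<in> borel_measurable borel" unfolding eq by (rule edge_angle_measurable)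
  show "\<bar>edge_flux_angle \<nu> a y\<bar> \<le> 1" unfolding eq using edge_angle_half[of S N y] by linarith
  have sub: "closed_segment S N \<subseteq> K" using edge_of_imp_subset[OF K(2)] SN(1) by simp
  have bK: "bounded K" using compact_simplex[OF K(1)] by (rule compact_imp_bounded)
  have d: "norm (p - q) \<le> diameter K" if "p \<in> K" "q \<in> K" for p q
    using diameter_bounded_bound[OF bK that] by (simp add: dist_norm)
  show "x \<in> K \<Longrightarrow> \<bar>edge_flux_angle \<nu> a y\<bar> * norm (x - y) \<le> diameter K"
    unfolding eq using sub d by (intro edge_angle_decay) auto
qed

text \<open>A disc of radius r inside \<open>K\<close> has area at least r squared, so the inscribed
  diameter is at most twice the root of the area of \<open>K\<close>; regularity then bounds the
  diameter of \<open>K\<close>.\<close>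

lemma regular_mesh_area:
  assumes T: "T \<in> regular_meshes \<Omega> \<theta>" "K \<in> T"
  shows "(diameter K)\<^sup>2 \<le> 4 * \<theta>\<^sup>2 * measure lebesgue K"
proof -
  have mesh: "is_mesh \<Omega> T" and reg: "diameter K / inscribed_diameter K \<le> \<theta>"
    using T by (auto simp: regular_meshes_def)
  note s = mesh_simplex[OF mesh T(2)]
  have cK: "compact K" using s by (rule compact_simplex)
  have mK: "K \<in> lmeasurable" using cK by (rule lmeasurable_compact)
  have m: "measure lebesgue K > 0" using s by (rule simplex_measure_pos)
  let ?D = "{diameter (cball c r) | c r. cball c r \<subseteq> K}"
  have up: "d \<le> 2 * sqrt (measure lebesgue K)" if dD: "d \<in> ?D" for d
  proof -
    obtain c r where d: "d = diameter (cball c r)" "cball c r \<subseteq> K" using dD by blast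
    show ?thesis
    \<comment> \<open>A negative radius gives the empty disc, of diameter 0, which also belongs to
      the set.\<close>
    proof (cases "r < 0")
      case False
      then have r: "r \<ge> 0" by simp
      have "r\<^sup>2 * 1 \<le> r\<^sup>2 * pi" using pi_gt3 by (intro mult_left_mono) auto
      also have "\<dots> = measure lebesgue (cball c r)"
        using content_cball_conv_ball[of c r] circle_area[OF r, of c] by simp
      also have "\<dots> \<le> measure lebesgue K" using d(2) mK by (intro measure_mono_fmeasurable) auto
      finally have "sqrt (r\<^sup>2) \<le> sqrt (measure lebesgue K)" by (intro real_sqrt_le_mono) simp
      then show ?thesis using r d(1) by simp
    qed (use d m in auto)
  qed
  then have bdd: "bdd_above ?D" by (meson bdd_aboveI)
  \<comment> \<open>A disc of positive radius makes the inscribed diameter positive; a quotient with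
    denominator 0 would say nothing about \<open>K\<close>.\<close>
  have "interior K \<noteq> {}"
  proof
    assume "interior K = {}"
    then have "frontier K = K" using closure_closed[OF closed_simplex[OF s]] by (simp add: frontier_def)
    then have "negligible K" using negligible_convex_frontier[OF convex_simplex[OF s]] by simp
    then show False using m negligible_imp_measure0 by fastforce
  qed
  then obtain c where "c \<in> interior K" by blast
  then obtain r where r: "r > 0" "cball c r \<subseteq> K" using mem_interior_cball by blast
  then have "2 * r \<in> ?D" by (intro CollectI exI[of _ c] exI[of _ r]) simp
  then have "2 * r \<le> inscribed_diameter K" unfolding inscribed_diameter_def by (intro cSup_upper bdd)
  then have pos: "inscribed_diameter K > 0" using r by linarith
  have "inscribed_diameter K \<le> 2 * sqrt (measure lebesgue K)"
    unfolding inscribed_diameter_def using \<open>2 * r \<in> ?D\<close> up by (intro cSup_least) blast+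
  moreover have \<theta>: "\<theta> \<ge> 0"
    using reg pos diameter_ge_0[OF compact_imp_bounded[OF cK]] by (meson divide_nonneg_pos order_trans)
  moreover have "diameter K \<le> \<theta> * inscribed_diameter K" using reg pos by (simp add: pos_divide_le_eq)
  ultimately have "diameter K \<le> \<theta> * (2 * sqrt (measure lebesgue K))"
    by (meson mult_left_mono order_trans)
  then have "(diameter K)\<^sup>2 \<le> (\<theta> * (2 * sqrt (measure lebesgue K)))\<^sup>2"
    using diameter_ge_0[OF compact_imp_bounded[OF cK]] by (intro power_mono)
  also have "\<dots> = 4 * \<theta>\<^sup>2 * measure lebesgue K" using m by (simp add: power_mult_distrib)
  finally show ?thesis .
qed

text \<open>Poles in the closure are included because a point of a closed triangle may lie on the
  boundary of the domain.\<close>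

lemma domain_kernel_bound:
  assumes \<Omega>: "convex_polygonal_domain \<Omega>"
  obtains M where "M > 0"
    "\<And>y. y \<in> closure \<Omega> \<Longrightarrow> integrable (lebesgue_on \<Omega>) (\<lambda>x. inverse (norm (x - y)))"
    "\<And>y. y \<in> closure \<Omega> \<Longrightarrow> (LINT x|lebesgue_on \<Omega>. inverse (norm (x - y))) \<le> M"
proof -
  note d = domain_lmeasurable[OF \<Omega>]
  have b: "bounded (closure \<Omega>)" using d(5) by (rule bounded_closure)
  define R where "R = diameter (closure \<Omega>) + 1"
  have R: "R > 0" using diameter_ge_0[OF b] by (simp add: R_def)
  have sub: "\<Omega> \<subseteq> cball y R" if "y \<in> closure \<Omega>" for y
    using diameter_bounded_bound[OF b that] closure_subset[of \<Omega>] by (fastforce simp: R_def)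
  show thesis
  proof (rule that[of "4 * pi * R"])
    show "4 * pi * R > 0" using R by simp
  qed (use inverse_norm_integral_bound[OF R d(3) sub] in auto)
qed

lemma mesh_interior_integral:
  assumes \<Omega>: "convex_polygonal_domain \<Omega>" and T: "is_mesh \<Omega> T" and K: "K \<in> T"
  shows "integrable (lebesgue_on \<Omega>) (indicat_real (interior K))"
    "(LINT x|lebesgue_on \<Omega>. indicat_real (interior K) x) = measure lebesgue K"
proof -
  have "indicat_real (interior K) x = pw T (\<lambda>L x. if L = K then 1 else 0) x" for x
  proof -
    have "pw T (\<lambda>L x. if L = K then (1::real) else 0) x = (\<Sum>L\<in>T. if L = K then indicat_real (interior K) x else 0)"
      unfolding pw_def by (rule sum.cong) auto
    then show ?thesis using K mesh_finite[OF T] by simp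
  qed
  then have eq: "indicat_real (interior K) = pw T (\<lambda>L x. if L = K then 1 else 0)" by blast
  show "integrable (lebesgue_on \<Omega>) (indicat_real (interior K))"
    unfolding eq by (intro pw_integral(1)[OF \<Omega> T]) simp
  have "(LINT x|lebesgue_on \<Omega>. indicat_real (interior K) x) = (\<Sum>L\<in>T. integral L (\<lambda>x. if L = K then 1 else 0))"
    unfolding eq by (intro pw_integral(2)[OF \<Omega> T]) simp
  also have "\<dots> = (\<Sum>L\<in>T. if L = K then integral K (\<lambda>x. 1) else 0)"
    by (intro sum.cong) auto
  also have "\<dots> = measure lebesgue K"
    using K mesh_finite[OF T] lmeasure_integral[OF lmeasurable_compact[OF compact_simplex[OF mesh_simplex[OF T K]]]]
    by simp
  finally show "(LINT x|lebesgue_on \<Omega>. indicat_real (interior K) x) = measure lebesgue K" .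
qed

lemma AE_lebesgue_on_neq:
  fixes y :: plane
  assumes "\<Omega> \<in> sets lebesgue"
  shows "AE x in lebesgue_on \<Omega>. x \<noteq> y"
proof -
  have "AE x in lebesgue. x \<noteq> y"
    using negligible_sing[of y] AE_not_in[of "{y}" lebesgue] by (simp add: negligible_iff_null_sets)
  then show ?thesis using assms by (auto simp: AE_restrict_space_iff elim: eventually_mono)
qed

text \<open>Each angle is \<open>O(h / dist)\<close>; averaging over a triangle of area of order \<open>h\<^sup>2\<close> turns the sum
  over all triangles into an integral of the kernel \<open>1 / dist\<close>.\<close>

lemma sum_edge_flux_angle_bound:
  assumes \<Omega>: "convex_polygonal_domain \<Omega>" and T: "is_mesh \<Omega> T" and n: "mesh_normals \<Omega> T n"
    and area: "\<And>K. K \<in> T \<Longrightarrow> (diameter K)\<^sup>2 \<le> \<kappa> * measure lebesgue K" and \<kappa>: "\<kappa> \<ge> 0"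
    and int: "integrable (lebesgue_on \<Omega>) (\<lambda>x. inverse (norm (x - y)))"
    and M: "(LINT x|lebesgue_on \<Omega>. inverse (norm (x - y))) \<le> M"
  shows "(\<Sum>K\<in>T. \<Sum>a | a edge_of K. diameter K * \<bar>edge_flux_angle (n a) a y\<bar>) \<le> 3 * \<kappa> * M"
proof -
  let ?k = "\<lambda>x. inverse (norm (x - y))"
  define J where "J = (\<lambda>K. LINT x|lebesgue_on \<Omega>. indicat_real (interior K) x * ?k x)"
  have imeas: "(\<lambda>x. indicat_real (interior K) x) \<in> borel_measurable (lebesgue_on \<Omega>)" for K
    by (intro measurable_restrict_space1 measurable_completion borel_measurable_indicator) simp
  have Jint: "integrable (lebesgue_on \<Omega>) (\<lambda>x. indicat_real (interior K) x * ?k x)" for K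
    by (rule Bochner_Integration.integrable_bound[OF int])
      (use int imeas[of K] in \<open>auto simp: indicator_def intro!: borel_measurable_times\<close>)
  have sumJ: "(\<Sum>K\<in>T. J K) \<le> M"
  proof -
    have "(\<Sum>K\<in>T. J K) = (LINT x|lebesgue_on \<Omega>. (\<Sum>K\<in>T. indicat_real (interior K) x * ?k x))"
      unfolding J_def by (rule Bochner_Integration.integral_sum[symmetric]) (rule Jint)
    also have "\<dots> \<le> (LINT x|lebesgue_on \<Omega>. ?k x)"
    proof (rule integral_mono)
      show "integrable (lebesgue_on \<Omega>) (\<lambda>x. \<Sum>K\<in>T. indicat_real (interior K) x * ?k x)"
        by (intro Bochner_Integration.integrable_sum Jint)
      fix x
      have "(\<Sum>K\<in>T. indicat_real (interior K) x * ?k x) = pw T (\<lambda>K x. ?k x) x"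
        by (simp add: pw_def)
      also have "\<dots> \<le> ?k x"
        by (cases rule: pw_cases[OF T, of x]) (simp_all add: pw_interior[OF T] pw_outside)
      finally show "(\<Sum>K\<in>T. indicat_real (interior K) x * ?k x) \<le> ?k x" .
    qed (rule int)
    finally show ?thesis using M by linarith
  qed
  have each: "diameter K * \<bar>edge_flux_angle (n a) a y\<bar> \<le> \<kappa> * J K" if K: "K \<in> T" "a edge_of K" for K a
  proof -
    note s = mesh_simplex[OF T K(1)]
    have \<nu>: "unit_normal a (n a)" using n edge_in_edges[OF K] by (simp add: mesh_normals_def)
    note P = edge_flux_angle_props[OF s K(2) \<nu>]
    define h where "h = diameter K"
    define t where "t = \<bar>edge_flux_angle (n a) a y\<bar>"
    have h: "h \<ge> 0" unfolding h_def using compact_imp_bounded[OF compact_simplex[OF s]] by (rule diameter_ge_0)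
    have m: "measure lebesgue K > 0" using s by (rule simplex_measure_pos)
    note one = mesh_interior_integral[OF \<Omega> T K(1)]
    have "t * measure lebesgue K = (LINT x|lebesgue_on \<Omega>. indicat_real (interior K) x * t)"
      using one by simp
    also have "\<dots> \<le> (LINT x|lebesgue_on \<Omega>. h * (indicat_real (interior K) x * ?k x))"
    proof (rule integral_mono_AE)
      show "integrable (lebesgue_on \<Omega>) (\<lambda>x. indicat_real (interior K) x * t)" using one by simp
      show "integrable (lebesgue_on \<Omega>) (\<lambda>x. h * (indicat_real (interior K) x * ?k x))" using Jint by simp
      show "AE x in lebesgue_on \<Omega>. indicat_real (interior K) x * t \<le> h * (indicat_real (interior K) x * ?k x)"
        using AE_lebesgue_on_neq[OF domain_lmeasurable(3)[OF \<Omega>], of y]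
      proof eventually_elim
        case (elim x)
        show ?case
        proof (cases "x \<in> interior K")
          case True
          then have "t * norm (x - y) \<le> h" using P(3)[of x y] interior_subset by (auto simp: t_def h_def)
          then have "t \<le> h * ?k x" using elim by (simp add: pos_le_divide_eq divide_inverse[symmetric])
          then show ?thesis using True by simp
        qed simp
      qed
    qed
    also have "\<dots> = h * J K" by (simp add: J_def)
    \<comment> \<open>The additional factor h permits the use of
      \<open>h\<^sup>2 \<le> \<kappa> * measure lebesgue K\<close>, after which the area cancels.
      Hence the weight \<open>diameter K\<close> in the statement.\<close>
    finally have "h * (t * measure lebesgue K) \<le> h * (h * J K)" using h by (rule mult_left_mono)
    also have "\<dots> = h\<^sup>2 * J K" by (simp add: power2_eq_square)
    also have "\<dots> \<le> (\<kappa> * measure lebesgue K) * J K"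
      using area[OF K(1)] by (intro mult_right_mono) (auto simp: h_def J_def)
    finally have "(h * t) * measure lebesgue K \<le> (\<kappa> * J K) * measure lebesgue K" by (simp add: mult_ac)
    then show ?thesis using m by (simp add: h_def t_def)
  qed
  have "(\<Sum>K\<in>T. \<Sum>a | a edge_of K. diameter K * \<bar>edge_flux_angle (n a) a y\<bar>) \<le> (\<Sum>K\<in>T. 3 * (\<kappa> * J K))"
  proof (rule sum_mono)
    fix K assume K: "K \<in> T"
    have "(\<Sum>a | a edge_of K. diameter K * \<bar>edge_flux_angle (n a) a y\<bar>) \<le> of_nat (card {a. a edge_of K}) * (\<kappa> * J K)"
      using each[OF K] by (intro sum_bounded_above) auto
    then show "(\<Sum>a | a edge_of K. diameter K * \<bar>edge_flux_angle (n a) a y\<bar>) \<le> 3 * (\<kappa> * J K)"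
      using card_edges_of_simplex[OF mesh_simplex[OF T K]] by simp
  qed
  also have "\<dots> = 3 * \<kappa> * (\<Sum>K\<in>T. J K)" by (simp add: sum_distrib_left mult.assoc)
  also have "\<dots> \<le> 3 * \<kappa> * M" using sumJ \<kappa> by (intro mult_left_mono) auto
  finally show ?thesis .
qed

subsection \<open>Discrete fields with prescribed divergence\<close>

lemma bounded_measurable_integrable:
  fixes f :: "plane \<Rightarrow> real"
  assumes "\<Omega> \<in> lmeasurable" "f \<in> borel_measurable (lebesgue_on \<Omega>)" "\<And>x. \<bar>f x\<bar> \<le> B"
  shows "integrable (lebesgue_on \<Omega>) f"
  by (rule Bochner_Integration.integrable_bound[OF
        finite_measure.integrable_const[OF finite_measure_lebesgue_on[OF assms(1)], of B] assms(2)])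
    (use assms(3) in \<open>auto intro: order_trans[OF _ abs_ge_self]\<close>)

text \<open>An edge is a proper face and therefore misses the interior, while almost every point of
  \<open>K\<close> is interior.\<close>

lemma simplex_edge_AE:
  fixes K :: triangle
  assumes K: "2 simplex K"
  shows "AE x in lebesgue. \<forall>a\<in>{a. a edge_of K}. x \<notin> a"
proof -
  have "AE x in lebesgue. x \<in> K \<longrightarrow> x \<in> interior K" using K by (rule simplex_interior_AE)
  moreover have "x \<notin> a" if "x \<in> K \<longrightarrow> x \<in> interior K" "a edge_of K" for a x
  proof
    assume "x \<in> a"
    have "a \<noteq> K" using that(2) aff_dim_simplex[OF K] by (auto simp: edge_of_def)
    then have "a \<inter> interior K = {}" using that(2) face_of_disjoint_interior[of a K] by (simp add: edge_of_def)
    then show False using \<open>x \<in> a\<close> that edge_of_imp_subset by blast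
  qed
  ultimately show ?thesis by (elim eventually_mono) blast
qed

text \<open>The fluxes are those of the convolution of the piecewise constant function with the gradient of
  the fundamental solution of the Laplacian.\<close>

lemma mesh_flux_exists:
  assumes \<Omega>: "convex_polygonal_domain \<Omega>" and T: "is_mesh \<Omega> T" and n: "mesh_normals \<Omega> T n"
    and area: "\<And>K. K \<in> T \<Longrightarrow> (diameter K)\<^sup>2 \<le> \<kappa> * measure lebesgue K" and \<kappa>: "\<kappa> \<ge> 0"
    and int: "\<And>y. y \<in> closure \<Omega> \<Longrightarrow> integrable (lebesgue_on \<Omega>) (\<lambda>x. inverse (norm (x - y)))"
    and M: "\<And>y. y \<in> closure \<Omega> \<Longrightarrow> (LINT x|lebesgue_on \<Omega>. inverse (norm (x - y))) \<le> M" and M0: "M \<ge> 0"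
  obtains f where "\<And>K. K \<in> T \<Longrightarrow> rt_div n f K = c K"
    "(\<Sum>K\<in>T. \<Sum>a | a edge_of K. (f a)\<^sup>2) \<le> 3 * \<kappa> * M\<^sup>2 * (norm0 \<Omega> (pw T (\<lambda>K x. c K)))\<^sup>2"
proof -
  note D = domain_lmeasurable[OF \<Omega>]
  define g where "g = pw T (\<lambda>K x. c K)"
  define \<Theta> where "\<Theta> = (\<lambda>a. edge_flux_angle (n a) a)"
  define B where "B = (\<Sum>K\<in>T. \<bar>c K\<bar>)"
  have B: "B \<ge> 0" unfolding B_def by (rule sum_nonneg) simp
  have gB: "\<bar>g y\<bar> \<le> B" for y
  proof (cases rule: pw_cases[OF T, of y])
    case (1 K)
    then have "g y = c K" by (simp add: g_def pw_interior[OF T])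
    then show ?thesis using 1(1) mesh_finite[OF T] member_le_sum[of K T "\<lambda>K. \<bar>c K\<bar>"] by (simp add: B_def)
  next
    case 2
    then show ?thesis using B by (simp add: g_def pw_outside)
  qed
  have gm: "g \<in> borel_measurable (lebesgue_on \<Omega>)"
    unfolding g_def by (intro pw_measurable D) simp
  have unit: "unit_normal a (n a)" if "K \<in> T" "a edge_of K" for K a
    using n edge_in_edges[OF that] by (simp add: mesh_normals_def)
  have props: "\<Theta> a \<in> borel_measurable (lebesgue_on \<Omega>)" "\<bar>\<Theta> a y\<bar> \<le> 1"
    "x \<in> K \<Longrightarrow> \<bar>\<Theta> a y\<bar> * norm (x - y) \<le> diameter K"
    if K: "K \<in> T" "a edge_of K" for a y x K
  proof -
    note P = edge_flux_angle_props[OF mesh_simplex[OF T K(1)] K(2) unit[OF K]]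
    show "\<Theta> a \<in> borel_measurable (lebesgue_on \<Omega>)"
      unfolding \<Theta>_def by (intro measurable_restrict_space1 measurable_completion) (use P(1) in simp)
    show "\<bar>\<Theta> a y\<bar> \<le> 1" "x \<in> K \<Longrightarrow> \<bar>\<Theta> a y\<bar> * norm (x - y) \<le> diameter K"
      using P(2,3) by (simp_all add: \<Theta>_def)
  qed
  define f where "f = (\<lambda>a. LINT y|lebesgue_on \<Omega>. g y * \<Theta> a y)"
  have g\<Theta>: "integrable (lebesgue_on \<Omega>) (\<lambda>y. g y * \<Theta> a y)" if K: "K \<in> T" "a edge_of K" for K a
  proof (rule bounded_measurable_integrable[OF D(2), of _ "B * 1"])
    show "(\<lambda>y. g y * \<Theta> a y) \<in> borel_measurable (lebesgue_on \<Omega>)"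
      by (intro borel_measurable_times gm props(1)[OF K])
    show "\<bar>g y * \<Theta> a y\<bar> \<le> B * 1" for y
      unfolding abs_mult by (intro mult_mono gB props(2)[OF K] B) simp
  qed
  have div: "rt_div n f K = c K" if K: "K \<in> T" for K
  proof -
    note s = mesh_simplex[OF T K]
    have m: "measure lebesgue K > 0" using s by (rule simplex_measure_pos)
    \<comment> \<open>Exchanging sum and integral turns the signed angles into the indicator of
      \<open>K\<close>, so that the total outward flux is the integral of g over
      \<open>K\<close>.\<close>
    have "(\<Sum>a | a edge_of K. f a * rt_sign n K a) = (LINT y|lebesgue_on \<Omega>. (\<Sum>a | a edge_of K. g y * \<Theta> a y * rt_sign n K a))"
      unfolding f_def using g\<Theta>[OF K] by (subst Bochner_Integration.integral_sum) auto
    also have "\<dots> = (LINT y|lebesgue_on \<Omega>. c K * indicat_real (interior K) y)"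
    proof (rule integral_cong_AE)
      show "(\<lambda>y. \<Sum>a | a edge_of K. g y * \<Theta> a y * rt_sign n K a) \<in> borel_measurable (lebesgue_on \<Omega>)"
        by (intro borel_measurable_sum borel_measurable_times gm props(1)[OF K] borel_measurable_const) simp
      show "(\<lambda>y. c K * indicat_real (interior K) y) \<in> borel_measurable (lebesgue_on \<Omega>)"
        using mesh_interior_integral(1)[OF \<Omega> T K] by (intro borel_measurable_times borel_measurable_const borel_measurable_integrable)
      have "AE y in lebesgue_on \<Omega>. \<forall>a\<in>{a. a edge_of K}. y \<notin> a"
        using simplex_edge_AE[OF s] D(3) by (auto simp: AE_restrict_space_iff elim: eventually_mono)
      then show "AE y in lebesgue_on \<Omega>. (\<Sum>a | a edge_of K. g y * \<Theta> a y * rt_sign n K a) = c K * indicat_real (interior K) y"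
      proof eventually_elim
        case (elim y)
        have "(\<Sum>a | a edge_of K. g y * \<Theta> a y * rt_sign n K a) = g y * (\<Sum>a | a edge_of K. rt_sign n K a * \<Theta> a y)"
          unfolding sum_distrib_left by (intro sum.cong refl) simp
        also have "(\<Sum>a | a edge_of K. rt_sign n K a * \<Theta> a y) = indicat_real (interior K) y"
          unfolding \<Theta>_def using elim by (intro sum_rt_sign_edge_flux_angle s unit[OF K]) auto
        also have "g y * indicat_real (interior K) y = c K * indicat_real (interior K) y"
          using pw_interior[OF T K, of y "\<lambda>K x. c K"] by (simp add: g_def indicator_def)
        finally show ?case .
      qed
    qed
    also have "\<dots> = c K * measure lebesgue K" using mesh_interior_integral[OF \<Omega> T K] by simp
    finally have "(\<Sum>a | a edge_of K. f a * rt_sign n K a) = c K * measure lebesgue K" .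
    then show ?thesis using m by (simp add: rt_div_def flip: sum_divide_distrib)
  qed
  define w where "w = (\<lambda>(K::triangle) a y. (g y)\<^sup>2 * (diameter K * \<bar>\<Theta> a y\<bar>))"
  have diam: "diameter K \<ge> 0" if "K \<in> T" for K
    using compact_imp_bounded[OF compact_simplex[OF mesh_simplex[OF T that]]] by (rule diameter_ge_0)
  have w_int: "integrable (lebesgue_on \<Omega>) (w K a)" if K: "K \<in> T" "a edge_of K" for K a
  proof (rule bounded_measurable_integrable[OF D(2), of _ "B\<^sup>2 * (diameter K * 1)"])
    show "w K a \<in> borel_measurable (lebesgue_on \<Omega>)" unfolding w_def
      by (intro borel_measurable_times borel_measurable_power gm borel_measurable_abs props(1)[OF K] borel_measurable_const)
    show "\<bar>w K a y\<bar> \<le> B\<^sup>2 * (diameter K * 1)" for y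
    proof -
      have "(g y)\<^sup>2 \<le> B\<^sup>2" using gB[of y] power_mono[of "\<bar>g y\<bar>" B 2] by simp
      then have "(g y)\<^sup>2 * (diameter K * \<bar>\<Theta> a y\<bar>) \<le> B\<^sup>2 * (diameter K * 1)"
        by (intro mult_mono props(2)[OF K] diam[OF K(1)] mult_nonneg_nonneg) auto
      then show ?thesis using diam[OF K(1)] by (simp add: w_def abs_mult)
    qed
  qed
  have fbound: "(f a)\<^sup>2 \<le> M * (LINT y|lebesgue_on \<Omega>. w K a y)" if K: "K \<in> T" "a edge_of K" for K a
  proof -
    \<comment> \<open>The kernel is split evenly: \<open>r\<close> carries the root of |\<Theta>|,
      \<open>f1\<close> carries \<open>g\<close> times the signed other root. Where \<Theta>
      vanishes, division by 0 gives the required value 0.\<close>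
    define r where "r = (\<lambda>y. sqrt \<bar>\<Theta> a y\<bar>)"
    define f1 where "f1 = (\<lambda>y. g y * (\<Theta> a y / r y))"
    have rm: "r \<in> borel_measurable (lebesgue_on \<Omega>)"
      unfolding r_def using props(1)[OF K] by measurable
    have rb: "\<bar>r y\<bar> \<le> 1" for y using props(2)[OF K, of y] by (simp add: r_def)
    have rr: "r y * r y = \<bar>\<Theta> a y\<bar>" for y by (simp add: r_def)
    have qb: "\<bar>\<Theta> a y / r y\<bar> = r y" for y
      using real_div_sqrt[of "\<bar>\<Theta> a y\<bar>"] by (simp add: r_def abs_divide)
    have f1m: "f1 \<in> borel_measurable (lebesgue_on \<Omega>)"
      unfolding f1_def by (intro borel_measurable_times borel_measurable_divide gm rm props(1)[OF K])
    have f1b: "\<bar>f1 y\<bar> \<le> B * 1" for y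
      unfolding f1_def abs_mult qb using rb[of y] by (intro mult_mono gB B) (auto simp: r_def)
    have L: "f1 \<in> L2 \<Omega>" "r \<in> L2 \<Omega>"
      using L2_bounded[OF D(2) f1m, of "B * 1"] L2_bounded[OF D(2) rm, of 1] f1b rb by simp_all
    have f1r: "f1 y * r y = g y * \<Theta> a y" for y
      by (cases "\<Theta> a y = 0") (simp_all add: f1_def r_def)
    have f1f1: "f1 y * f1 y = (g y)\<^sup>2 * \<bar>\<Theta> a y\<bar>" for y
    proof -
      have "f1 y * f1 y = (g y)\<^sup>2 * ((\<Theta> a y / r y) * (\<Theta> a y / r y))"
        unfolding f1_def power2_eq_square by (simp only: mult_ac)
      also have "(\<Theta> a y / r y) * (\<Theta> a y / r y) = \<bar>\<Theta> a y\<bar>"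
        using abs_mult_self_eq[of "\<Theta> a y / r y"] by (simp only: qb rr)
      finally show ?thesis .
    qed
    have "f a = ip \<Omega> f1 r" by (simp add: f_def ip_def f1r)
    then have "\<bar>f a\<bar> \<le> norm0 \<Omega> f1 * norm0 \<Omega> r" using ip_Cauchy_Schwarz[OF L] by simp
    then have "\<bar>f a\<bar>\<^sup>2 \<le> (norm0 \<Omega> f1 * norm0 \<Omega> r)\<^sup>2" by (rule power_mono) simp
    then have "(f a)\<^sup>2 \<le> ip \<Omega> f1 f1 * ip \<Omega> r r" by (simp add: power_mult_distrib norm0_power2)
    also have "\<dots> \<le> ip \<Omega> f1 f1 * (diameter K * M)"
    proof (intro mult_left_mono ip_self_nonneg)
      \<comment> \<open>Any point of \<open>K\<close> may serve as pole: |\<Theta>_a(y)| is at most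
        h / |y - x0|, so its integral over y is at most h M. The factor h passes into the weight
        \<open>w\<close>.\<close>
      obtain x0 where x0: "x0 \<in> K"
        using simplex_measure_pos[OF mesh_simplex[OF T K(1)]] by fastforce
      then have x0': "x0 \<in> closure \<Omega>" using T K(1) by (auto simp: is_mesh_def)
      have "ip \<Omega> r r = (LINT y|lebesgue_on \<Omega>. \<bar>\<Theta> a y\<bar>)" by (simp add: ip_def rr)
      also have "\<dots> \<le> (LINT y|lebesgue_on \<Omega>. diameter K * inverse (norm (y - x0)))"
      proof (rule integral_mono_AE)
        show "integrable (lebesgue_on \<Omega>) (\<lambda>y. \<bar>\<Theta> a y\<bar>)"
          by (rule bounded_measurable_integrable[OF D(2), of _ 1]) (use props(1,2)[OF K] in auto)
        show "integrable (lebesgue_on \<Omega>) (\<lambda>y. diameter K * inverse (norm (y - x0)))"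
          using int[OF x0'] by simp
        show "AE y in lebesgue_on \<Omega>. \<bar>\<Theta> a y\<bar> \<le> diameter K * inverse (norm (y - x0))"
          using AE_lebesgue_on_neq[OF D(3), of x0]
        proof eventually_elim
          case (elim y)
          have "\<bar>\<Theta> a y\<bar> * norm (y - x0) \<le> diameter K"
            using props(3)[OF K x0, of y] by (simp add: norm_minus_commute)
          then show ?case using elim by (simp add: pos_le_divide_eq divide_inverse[symmetric])
        qed
      qed
      also have "\<dots> = diameter K * (LINT y|lebesgue_on \<Omega>. inverse (norm (y - x0)))" by simp
      also have "\<dots> \<le> diameter K * M" by (intro mult_left_mono M[OF x0'] diam[OF K(1)])
      finally show "ip \<Omega> r r \<le> diameter K * M" .
    qed
    also have "ip \<Omega> f1 f1 = (LINT y|lebesgue_on \<Omega>. (g y)\<^sup>2 * \<bar>\<Theta> a y\<bar>)" by (simp add: ip_def f1f1)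
    also have "\<dots> * (diameter K * M) = M * (LINT y|lebesgue_on \<Omega>. diameter K * ((g y)\<^sup>2 * \<bar>\<Theta> a y\<bar>))"
      by simp
    also have "(\<lambda>y. diameter K * ((g y)\<^sup>2 * \<bar>\<Theta> a y\<bar>)) = w K a" by (auto simp: w_def)
    finally show ?thesis .
  qed
  have "(\<Sum>K\<in>T. \<Sum>a | a edge_of K. (f a)\<^sup>2) \<le> (\<Sum>K\<in>T. \<Sum>a | a edge_of K. M * (LINT y|lebesgue_on \<Omega>. w K a y))"
    using fbound by (intro sum_mono) auto
  also have "\<dots> = M * (\<Sum>K\<in>T. \<Sum>a | a edge_of K. (LINT y|lebesgue_on \<Omega>. w K a y))"
    by (simp add: sum_distrib_left)
  also have "(\<Sum>K\<in>T. \<Sum>a | a edge_of K. (LINT y|lebesgue_on \<Omega>. w K a y))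
      = (\<Sum>K\<in>T. LINT y|lebesgue_on \<Omega>. (\<Sum>a | a edge_of K. w K a y))"
    using w_int by (intro sum.cong refl Bochner_Integration.integral_sum[symmetric]) auto
  also have "\<dots> = (LINT y|lebesgue_on \<Omega>. (\<Sum>K\<in>T. \<Sum>a | a edge_of K. w K a y))"
    using w_int by (intro Bochner_Integration.integral_sum[symmetric] Bochner_Integration.integrable_sum) auto
  \<comment> \<open>The other half of the Schur test: for fixed y the sum over all triangles and
    edges is bounded by a constant.\<close>
  also have "\<dots> \<le> (LINT y|lebesgue_on \<Omega>. (g y)\<^sup>2 * (3 * \<kappa> * M))"
  proof (rule integral_mono)
    show "integrable (lebesgue_on \<Omega>) (\<lambda>y. \<Sum>K\<in>T. \<Sum>a | a edge_of K. w K a y)"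
      using w_int by (intro Bochner_Integration.integrable_sum) auto
    have "g \<in> L2 \<Omega>" using L2_bounded[OF D(2) gm, of B] gB by simp
    then show "integrable (lebesgue_on \<Omega>) (\<lambda>y. (g y)\<^sup>2 * (3 * \<kappa> * M))"
      using L2D(2) by fastforce
    fix y assume "y \<in> space (lebesgue_on \<Omega>)"
    then have y: "y \<in> closure \<Omega>" using closure_subset by auto
    have "(\<Sum>K\<in>T. \<Sum>a | a edge_of K. w K a y) = (g y)\<^sup>2 * (\<Sum>K\<in>T. \<Sum>a | a edge_of K. diameter K * \<bar>\<Theta> a y\<bar>)"
      by (simp add: w_def sum_distrib_left)
    also have "\<dots> \<le> (g y)\<^sup>2 * (3 * \<kappa> * M)"
      unfolding \<Theta>_def by (intro mult_left_mono sum_edge_flux_angle_bound[OF \<Omega> T n area \<kappa> int[OF y] M[OF y]]) auto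
    finally show "(\<Sum>K\<in>T. \<Sum>a | a edge_of K. w K a y) \<le> (g y)\<^sup>2 * (3 * \<kappa> * M)" .
  qed
  also have "\<dots> = 3 * \<kappa> * M * (norm0 \<Omega> g)\<^sup>2"
    unfolding norm0_power2 by (simp add: ip_def power2_eq_square)
  finally have "(\<Sum>K\<in>T. \<Sum>a | a edge_of K. (f a)\<^sup>2) \<le> M * (3 * \<kappa> * M * (norm0 \<Omega> g)\<^sup>2)"
    using M0 by (simp add: mult_left_mono)
  also have "\<dots> = 3 * \<kappa> * M\<^sup>2 * (norm0 \<Omega> g)\<^sup>2" by (simp add: power2_eq_square)
  finally show thesis using that[of f] div by (simp add: g_def)
qed

text \<open>On \<open>K\<close> each basis function is at most h / (2 |K|). Cauchy-Schwarz for the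
  three edges and integration give the factor 3/4 times h squared over |K|, which is at most 3/4
  \<kappa> and is rounded up to \<kappa>.\<close>

lemma rt_norm_bound:
  assumes \<Omega>: "convex_polygonal_domain \<Omega>" and T: "is_mesh \<Omega> T"
    and area: "\<And>K. K \<in> T \<Longrightarrow> (diameter K)\<^sup>2 \<le> \<kappa> * measure lebesgue K"
  shows "(norm0 \<Omega> (pw T (rt_local n f)))\<^sup>2 \<le> \<kappa> * (\<Sum>K\<in>T. \<Sum>a | a edge_of K. (f a)\<^sup>2)"
proof -
  have "(norm0 \<Omega> (pw T (rt_local n f)))\<^sup>2 = (\<Sum>K\<in>T. integral K (\<lambda>x. rt_local n f K x \<bullet> rt_local n f K x))"
    unfolding norm0_power2 by (rule pw_ip[OF \<Omega> T rt_local_continuous rt_local_continuous])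
  also have "\<dots> \<le> (\<Sum>K\<in>T. \<kappa> * (\<Sum>a | a edge_of K. (f a)\<^sup>2))"
  proof (rule sum_mono)
    fix K assume K: "K \<in> T"
    note s = mesh_simplex[OF T K]
    have cK: "compact K" using s by (rule compact_simplex)
    have m: "measure lebesgue K > 0" using s by (rule simplex_measure_pos)
    define h where "h = diameter K"
    define F where "F = (\<Sum>a | a edge_of K. (f a)\<^sup>2)"
    have F: "F \<ge> 0" unfolding F_def by (rule sum_nonneg) simp
    have bound: "norm (rt_local n f K x \<bullet> rt_local n f K x) \<le> 3 * h\<^sup>2 / (4 * (measure lebesgue K)\<^sup>2) * F" if x: "x \<in> K" for x
    proof -
      have "norm (rt_local n f K x) \<le> (\<Sum>a | a edge_of K. \<bar>f a\<bar> * (h / (2 * measure lebesgue K)))"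
        unfolding rt_local_def
      proof (rule sum_norm_le)
        fix a assume "a \<in> {a. a edge_of K}"
        then obtain S N where "ccw_triangle (opposite_vertex K a) S N K"
          using simplex_2_edge_ccw_triangle[OF s] by blast
        then have "K = convex hull {opposite_vertex K a, S, N}" unfolding ccw_triangle_def by (rule conjunct1)
        moreover have "opposite_vertex K a \<in> convex hull {opposite_vertex K a, S, N}" by (simp add: hull_inc)
        ultimately have "opposite_vertex K a \<in> K" by blast
        then have "norm (x - opposite_vertex K a) \<le> h"
          using diameter_bounded_bound[OF compact_imp_bounded[OF cK] x] by (simp add: h_def dist_norm)
        moreover have "\<bar>rt_sign n K a\<bar> = 1" by (simp add: rt_sign_def)
        ultimately show "norm ((f a * rt_sign n K a / (2 * measure lebesgue K)) *\<^sub>R (x - opposite_vertex K a))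
            \<le> \<bar>f a\<bar> * (h / (2 * measure lebesgue K))"
          using m by (simp add: abs_mult divide_right_mono mult_left_mono)
      qed
      then have "(norm (rt_local n f K x))\<^sup>2 \<le> (\<Sum>a | a edge_of K. \<bar>f a\<bar> * (h / (2 * measure lebesgue K)))\<^sup>2"
        by (rule power_mono) simp
      also have "\<dots> \<le> (\<Sum>a | a edge_of K. (\<bar>f a\<bar> * (h / (2 * measure lebesgue K)))\<^sup>2) * card {a. a edge_of K}"
        by (rule sum_squared_le_sum_of_squares)
      also have "\<dots> = 3 * h\<^sup>2 / (4 * (measure lebesgue K)\<^sup>2) * F"
        by (simp add: card_edges_of_simplex[OF s] F_def power_mult_distrib power_divide flip: sum_distrib_right sum_divide_distrib)
      finally show ?thesis by (simp add: power2_norm_eq_inner)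
    qed
    have lm: "K \<in> lmeasurable" using cK by (rule lmeasurable_compact)
    have "integral K (\<lambda>x. rt_local n f K x \<bullet> rt_local n f K x)
        \<le> norm (integral K (\<lambda>x. rt_local n f K x \<bullet> rt_local n f K x))" by simp
    also have "\<dots> \<le> integral K (\<lambda>x. 3 * h\<^sup>2 / (4 * (measure lebesgue K)\<^sup>2) * F)"
      by (rule integral_norm_bound_integral[OF _ _ bound])
        (intro integrable_continuous_compact(3)[OF cK] continuous_intros rt_local_continuous)+
    also have "\<dots> = (3 * h\<^sup>2 / (4 * (measure lebesgue K)\<^sup>2) * F) * measure lebesgue K"
      using lmeasure_integral[OF lm] integral_mult_right[of K "3 * h\<^sup>2 / (4 * (measure lebesgue K)\<^sup>2) * F" "\<lambda>x. 1"] by simp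
    also have "\<dots> = (3 / 4 * F / measure lebesgue K) * h\<^sup>2" using m by (simp add: power2_eq_square)
    also have "\<dots> \<le> (3 / 4 * F / measure lebesgue K) * (\<kappa> * measure lebesgue K)"
      using area[OF K] m F by (intro mult_left_mono) (auto simp: h_def)
    also have "\<dots> = 3 / 4 * (\<kappa> * F)" using m by simp
    also have "\<dots> \<le> \<kappa> * F"
    proof -
      \<comment> \<open>The sign of \<kappa> follows from the area bound on the triangle at
        hand.\<close>
      have "0 \<le> \<kappa> * measure lebesgue K" using area[OF K] zero_le_power2[of "diameter K"] by linarith
      then have "\<kappa> \<ge> 0" using m by (simp add: zero_le_mult_iff)
      then have "0 \<le> \<kappa> * F" using F by simp
      then show ?thesis by linarith
    qed
    finally show "integral K (\<lambda>x. rt_local n f K x \<bullet> rt_local n f K x) \<le> \<kappa> * (\<Sum>a | a edge_of K. (f a)\<^sup>2)"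
      by (simp add: F_def)
  qed
  finally show ?thesis by (simp add: sum_distrib_left)
qed

lemma H_mesh_eq: "is_mesh \<Omega> T \<Longrightarrow> H_mesh T n = {pw T (rt_local n c) | c. True}"
  unfolding H_mesh_def field_span_def using rt_combination[of \<Omega> T _ n] by auto

lemma discrete_divergence_lift:
  assumes \<Omega>: "convex_polygonal_domain \<Omega>"
  obtains C where "C > 0"
    "\<And>T n u. \<lbrakk>T \<in> regular_meshes \<Omega> \<theta>; mesh_normals \<Omega> T n; u \<in> L2_mesh \<Omega> T\<rbrakk> \<Longrightarrow>
       \<exists>q\<in>H_mesh T n. (AE x in lebesgue_on \<Omega>. wdiv \<Omega> q x = u x) \<and> norm0 \<Omega> q \<le> C * norm0 \<Omega> u"
proof -
  note D = domain_lmeasurable[OF \<Omega>]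
  obtain M where M: "M > 0" "\<And>y. y \<in> closure \<Omega> \<Longrightarrow> integrable (lebesgue_on \<Omega>) (\<lambda>x. inverse (norm (x - y)))"
    "\<And>y. y \<in> closure \<Omega> \<Longrightarrow> (LINT x|lebesgue_on \<Omega>. inverse (norm (x - y))) \<le> M"
    using domain_kernel_bound[OF \<Omega>] by blast
  define \<kappa> where "\<kappa> = 4 * \<theta>\<^sup>2"
  have \<kappa>: "\<kappa> \<ge> 0" by (simp add: \<kappa>_def)
  show thesis
  \<comment> \<open>The flux and norm bounds combine to the constant sqrt 3 \<kappa> M; 2 replaces
    the root, and the summand 1 keeps the constant positive for every \<theta>.\<close>
  proof (rule that[of "2 * \<kappa> * M + 1"])
    show "2 * \<kappa> * M + 1 > 0" using \<kappa> M(1) by (simp add: add_nonneg_pos)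
    fix T n u assume T: "T \<in> regular_meshes \<Omega> \<theta>" and n: "mesh_normals \<Omega> T n" and u: "u \<in> L2_mesh \<Omega> T"
    have mesh: "is_mesh \<Omega> T" using T by (simp add: regular_meshes_def)
    have area: "\<And>K. K \<in> T \<Longrightarrow> (diameter K)\<^sup>2 \<le> \<kappa> * measure lebesgue K"
      unfolding \<kappa>_def by (rule regular_mesh_area[OF T])
    obtain c where c: "AE x in lebesgue_on \<Omega>. u x = pw T (\<lambda>K x. c K) x"
      using L2_mesh_pw[OF \<Omega> mesh u] .
    obtain f where f: "\<And>K. K \<in> T \<Longrightarrow> rt_div n f K = c K"
      "(\<Sum>K\<in>T. \<Sum>a | a edge_of K. (f a)\<^sup>2) \<le> 3 * \<kappa> * M\<^sup>2 * (norm0 \<Omega> (pw T (\<lambda>K x. c K)))\<^sup>2"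
      using mesh_flux_exists[OF \<Omega> mesh n area \<kappa> M(2,3) less_imp_le[OF M(1)], where c = c] by blast
    define q where "q = pw T (rt_local n f)"
    have qL: "q \<in> L2 \<Omega>" unfolding q_def by (rule pw_L2[OF \<Omega> mesh rt_local_continuous])
    have gL: "pw T (\<lambda>K x. c K) \<in> L2 \<Omega>" by (rule pw_L2[OF \<Omega> mesh]) simp
    have uL: "u \<in> L2 \<Omega>" using u by (simp add: L2_mesh_def)
    have "pw T (\<lambda>K x. rt_div n f K) = pw T (\<lambda>K x. c K)"
      unfolding pw_def using f(1) by (intro ext sum.cong) auto
    then have "has_weak_div \<Omega> q (pw T (\<lambda>K x. c K))"
      using rt_weak_div[OF \<Omega> mesh n, of f] by (simp add: q_def)
    then have "AE x in lebesgue_on \<Omega>. wdiv \<Omega> q x = pw T (\<lambda>K x. c K) x"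
      by (rule wdiv_AE_eq[OF D(1,2) qL gL])
    then have wu: "AE x in lebesgue_on \<Omega>. wdiv \<Omega> q x = u x" using c by eventually_elim simp
    define N where "N = norm0 \<Omega> u"
    have N: "norm0 \<Omega> (pw T (\<lambda>K x. c K)) = N" unfolding N_def using norm0_cong_AE[OF uL gL c] by simp
    have "(norm0 \<Omega> q)\<^sup>2 \<le> \<kappa> * (3 * \<kappa> * M\<^sup>2 * N\<^sup>2)"
      using rt_norm_bound[OF \<Omega> mesh area, of n f] mult_left_mono[OF f(2) \<kappa>] unfolding N q_def by linarith
    also have "\<dots> = 3 * (\<kappa> * M * N)\<^sup>2" by (simp add: power2_eq_square mult_ac)
    also have "\<dots> \<le> (2 * \<kappa> * M * N)\<^sup>2" by (simp add: power_mult_distrib)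
    finally have "norm0 \<Omega> q \<le> 2 * \<kappa> * M * N"
      by (rule power2_le_imp_le) (use \<kappa> M(1) in \<open>simp add: N_def norm0_nonneg\<close>)
    also have "\<dots> \<le> (2 * \<kappa> * M + 1) * N" by (simp add: N_def norm0_nonneg algebra_simps)
    finally have "norm0 \<Omega> q \<le> (2 * \<kappa> * M + 1) * norm0 \<Omega> u" by (simp add: N_def)
    moreover have "q \<in> H_mesh T n" using H_mesh_eq[OF mesh] by (auto simp: q_def)
    ultimately show "\<exists>q\<in>H_mesh T n. (AE x in lebesgue_on \<Omega>. wdiv \<Omega> q x = u x) \<and> norm0 \<Omega> q \<le> (2 * \<kappa> * M + 1) * norm0 \<Omega> u"
      using wu by blast
  qed
qed

subsection \<open>Lifting and stability\<close>

text \<open>\<open>wdiv \<Omega> p\<close> need not itself be constant on the triangles, being an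
  arbitrary representative; \<open>g\<close> is the version that can serve as a scalar test
  function.\<close>

lemma H_mesh_props:
  assumes \<Omega>: "convex_polygonal_domain \<Omega>" and T: "is_mesh \<Omega> T" and n: "mesh_normals \<Omega> T n"
    and p: "p \<in> H_mesh T n"
  obtains g where "g \<in> L2_mesh \<Omega> T" "AE x in lebesgue_on \<Omega>. wdiv \<Omega> p x = g x" "p \<in> Hdiv \<Omega>"
proof -
  note D = domain_lmeasurable[OF \<Omega>]
  obtain c where c: "p = pw T (rt_local n c)" using p H_mesh_eq[OF T] by auto
  have pL: "p \<in> L2 \<Omega>" unfolding c by (rule pw_L2[OF \<Omega> T rt_local_continuous])
  have g: "pw T (\<lambda>K x. rt_div n c K) \<in> L2_mesh \<Omega> T" by (rule pw_const_L2_mesh[OF \<Omega> T])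
  then have gL: "pw T (\<lambda>K x. rt_div n c K) \<in> L2 \<Omega>" by (simp add: L2_mesh_def)
  have wd: "has_weak_div \<Omega> p (pw T (\<lambda>K x. rt_div n c K))" unfolding c by (rule rt_weak_div[OF \<Omega> T n])
  show thesis
  proof (rule that[OF g wdiv_AE_eq[OF D(1,2) pL gL wd]])
    show "p \<in> Hdiv \<Omega>" using pL gL wd by (auto simp: Hdiv_def)
  qed
qed

lemma H_dual_scaleR:
  assumes "q \<in> H_dual T \<phi>"
  shows "(\<lambda>x. c *\<^sub>R q x) \<in> H_dual T \<phi>"
proof -
  obtain d where "q = (\<lambda>x. \<Sum>a\<in>edges T. d a *\<^sub>R \<phi> a x)" using assms by (auto simp: H_dual_def field_span_def)
  then have "(\<lambda>x. c *\<^sub>R q x) = (\<lambda>x. \<Sum>a\<in>edges T. (c * d a) *\<^sub>R \<phi> a x)" by (simp add: scaleR_sum_right)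
  then show ?thesis unfolding H_dual_def field_span_def
    by (intro CollectI exI[of _ "\<lambda>a. c * d a"]) simp
qed

lemma H_dual_zero: "(\<lambda>x. 0) \<in> H_dual T \<phi>"
  unfolding H_dual_def field_span_def by (intro CollectI exI[of _ "\<lambda>a. 0"]) simp

lemma H_dual_Hdiv:
  assumes "\<Omega> \<in> lmeasurable" "dual_rt_basis \<Omega> T n \<phi>" "q \<in> H_dual T \<phi>"
  shows "q \<in> Hdiv \<Omega>"
proof -
  obtain d where d: "q = (\<lambda>x. \<Sum>a\<in>edges T. d a *\<^sub>R \<phi> a x)"
    using assms(3) by (auto simp: H_dual_def field_span_def)
  have "\<phi> a \<in> Hdiv \<Omega>" if "a \<in> edges T" for a
    using assms(2) that unfolding dual_rt_basis_def by blast
  then show ?thesis unfolding d by (rule Hdiv_sum[OF assms(1) Hdiv_scaleR])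
qed

lemma wdiv_scaleR_AE:
  assumes "open \<Omega>" "\<Omega> \<in> lmeasurable" "q \<in> Hdiv \<Omega>"
  shows "AE x in lebesgue_on \<Omega>. wdiv \<Omega> (\<lambda>x. c *\<^sub>R q x) x = c *\<^sub>R wdiv \<Omega> q x"
  by (rule wdiv_AE_eq[OF assms(1,2) L2_scaleR[OF Hdiv_L2[OF assms(3)]]
        L2_scaleR[OF wdiv_props(1)[OF assms(3)]] has_weak_div_scaleR[OF wdiv_props(2)[OF assms(3)]]])

lemma wdiv_zero_AE:
  assumes "open \<Omega>" "\<Omega> \<in> lmeasurable"
  shows "AE x in lebesgue_on \<Omega>. wdiv \<Omega> (\<lambda>x. 0) x = 0"
  by (rule wdiv_AE_eq[OF assms L2_zero L2_zero has_weak_div_zero])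

lemma zero_in_Hdiv: "(\<lambda>x. 0) \<in> Hdiv \<Omega>"
proof -
  have "\<exists>g\<in>L2 \<Omega>. has_weak_div \<Omega> (\<lambda>x. 0) g" by (intro bexI) (rule has_weak_div_zero, rule L2_zero)
  then show ?thesis unfolding Hdiv_def using L2_zero by (intro CollectI conjI)
qed

lemma ip_zero_right: "ip \<Omega> f (\<lambda>x. 0) = 0"
  by (simp add: ip_def)

lemma norm0_zero: "norm0 \<Omega> (\<lambda>x. 0) = 0"
  by (simp add: norm0_def ip_zero_left)

lemma interpolation_operator:
  assumes "interpolation_hypothesis \<Omega> \<theta> n \<phi>s A B D E" "T \<in> regular_meshes \<Omega> \<theta>" "q \<in> H_mesh T (n T)"
  obtains r where "r \<in> H_dual T (\<phi>s T)" "A * (norm0 \<Omega> q)\<^sup>2 \<le> ip \<Omega> q r" "norm0 \<Omega> r \<le> B * norm0 \<Omega> q"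
    "norm0 \<Omega> (wdiv \<Omega> r) \<le> D * norm0 \<Omega> (wdiv \<Omega> q)"
    "ip \<Omega> (wdiv \<Omega> q) (wdiv \<Omega> r) \<ge> E * (norm0 \<Omega> (wdiv \<Omega> q))\<^sup>2"
proof -
  obtain P where P: "P \<in> H_mesh T (n T) \<rightarrow> H_dual T (\<phi>s T)"
    "\<forall>q\<in>H_mesh T (n T). A * (norm0 \<Omega> q)\<^sup>2 \<le> ip \<Omega> q (P q) \<and> norm0 \<Omega> (P q) \<le> B * norm0 \<Omega> q \<and>
       norm0 \<Omega> (wdiv \<Omega> (P q)) \<le> D * norm0 \<Omega> (wdiv \<Omega> q) \<and>
       ip \<Omega> (wdiv \<Omega> q) (wdiv \<Omega> (P q)) \<ge> E * (norm0 \<Omega> (wdiv \<Omega> q))\<^sup>2"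
    using bspec[OF assms(1)[unfolded interpolation_hypothesis_def] assms(2)] by (elim exE conjE)
  show thesis
    using that[of "P q"] funcset_mem[OF P(1) assms(3)] bspec[OF P(2) assms(3)] by iprover
qed

text \<open>By homogeneity, failure of stability at level \<open>\<beta>\<close> bounds the form on all test fields and
  not just on those of unit norm.\<close>

lemma unstable_bound_dual:
  assumes \<Omega>: "open \<Omega>" "\<Omega> \<in> lmeasurable" and basis: "dual_rt_basis \<Omega> T n \<phi>"
    and u: "u \<in> L2 \<Omega>" and p: "p \<in> Hdiv \<Omega>" and q: "q \<in> H_dual T \<phi>"
    and N: "N > 0" "norm_Hdiv \<Omega> q \<le> N"
    and unstable: "\<And>\<eta>. \<eta> \<in> V_dual \<Omega> T \<phi> \<Longrightarrow> norm_V \<Omega> \<eta> \<le> 1 \<Longrightarrow> \<gamma> \<Omega> (u, p) \<eta> < \<beta>"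
  shows "ip \<Omega> p q + ip \<Omega> u (wdiv \<Omega> q) < \<beta> * N"
proof -
  \<comment> \<open>Scaling by a positive upper bound of the norm, and not by the norm itself, needs
    no separate case for norm 0.\<close>
  define r where "r = (\<lambda>x. (1 / N) *\<^sub>R q x)"
  have qH: "q \<in> Hdiv \<Omega>" by (rule H_dual_Hdiv[OF \<Omega>(2) basis q])
  have rH: "r \<in> Hdiv \<Omega>" unfolding r_def using qH by (rule Hdiv_scaleR)
  have wr: "AE x in lebesgue_on \<Omega>. wdiv \<Omega> r x = (1 / N) *\<^sub>R wdiv \<Omega> q x"
    unfolding r_def by (rule wdiv_scaleR_AE[OF \<Omega> qH])
  have sL: "(\<lambda>x. (1 / N) *\<^sub>R wdiv \<Omega> q x) \<in> L2 \<Omega>" by (intro L2_scaleR wdiv_props(1)[OF qH])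
  have nr: "norm0 \<Omega> r = norm0 \<Omega> q / N" unfolding r_def norm0_scaleR using N(1) by simp
  have nwr: "norm0 \<Omega> (wdiv \<Omega> r) = norm0 \<Omega> (wdiv \<Omega> q) / N"
    using norm0_cong_AE[OF wdiv_props(1)[OF rH] sL wr] N(1) unfolding norm0_scaleR by simp
  have "((\<lambda>x. 0), r) \<in> V_dual \<Omega> T \<phi>"
    using H_dual_scaleR[OF q] L2_zero[of \<Omega>] by (auto simp: V_dual_def L2_mesh_def r_def)
  moreover have "norm_V \<Omega> ((\<lambda>x. 0), r) \<le> 1"
  proof -
    have "norm_V \<Omega> ((\<lambda>x. 0), r) = norm_Hdiv \<Omega> q / N"
      using N(1) by (simp add: norm_V_def norm_Hdiv_def norm0_zero nr nwr power_divide
          real_sqrt_divide flip: add_divide_distrib)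
    then show ?thesis using N by simp
  qed
  ultimately have "\<gamma> \<Omega> (u, p) ((\<lambda>x. 0), r) < \<beta>" by (rule unstable)
  moreover have "\<gamma> \<Omega> (u, p) ((\<lambda>x. 0), r) = (ip \<Omega> p q + ip \<Omega> u (wdiv \<Omega> q)) / N"
  proof -
    have "ip \<Omega> u (wdiv \<Omega> r) = ip \<Omega> u (\<lambda>x. (1 / N) *\<^sub>R wdiv \<Omega> q x)"
      by (rule ip_cong_AE[OF u u wdiv_props(1)[OF rH] sL _ wr]) simp
    then show ?thesis
      by (simp add: \<gamma>_def r_def ip_scaleR_right ip_zero_right add_divide_distrib del: real_scaleR_def)
  qed
  ultimately show ?thesis using N(1) by (simp add: pos_divide_less_eq)
qed

text \<open>The test pair (g / ||g||, 0), with \<open>g\<close> the piecewise constant version of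
  div p, gives the form exactly the value ||div p||.\<close>

lemma unstable_bound_scalar:
  assumes \<Omega>: "open \<Omega>" "\<Omega> \<in> lmeasurable"
    and p: "p \<in> Hdiv \<Omega>" and u: "u \<in> L2 \<Omega>"
    and g: "g \<in> L2_mesh \<Omega> T" "AE x in lebesgue_on \<Omega>. wdiv \<Omega> p x = g x" and \<beta>: "\<beta> > 0"
    and unstable: "\<And>\<eta>. \<eta> \<in> V_dual \<Omega> T \<phi> \<Longrightarrow> norm_V \<Omega> \<eta> \<le> 1 \<Longrightarrow> \<gamma> \<Omega> (u, p) \<eta> < \<beta>"
  shows "norm0 \<Omega> (wdiv \<Omega> p) \<le> \<beta>"
proof (cases "norm0 \<Omega> (wdiv \<Omega> p) = 0")
  case False
  define d where "d = norm0 \<Omega> (wdiv \<Omega> p)"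
  have d: "d > 0" using False norm0_nonneg[of \<Omega> "wdiv \<Omega> p"] by (simp add: d_def)
  define v where "v = (\<lambda>x. (1 / d) *\<^sub>R g x)"
  have gL: "g \<in> L2 \<Omega>" using g(1) by (simp add: L2_mesh_def)
  have wL: "wdiv \<Omega> p \<in> L2 \<Omega>" by (rule wdiv_props(1)[OF p])
  have gd: "norm0 \<Omega> g = d" using norm0_cong_AE[OF wL gL g(2)] by (simp add: d_def)
  \<comment> \<open>Even for the zero field \<open>wdiv\<close> is determined only up to a null
    set.\<close>
  have w0: "AE x in lebesgue_on \<Omega>. wdiv \<Omega> (\<lambda>x. 0) x = 0" by (rule wdiv_zero_AE[OF \<Omega>])
  have w0L: "wdiv \<Omega> (\<lambda>x. 0) \<in> L2 \<Omega>" by (rule wdiv_props(1)[OF zero_in_Hdiv])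
  have nw0: "norm0 \<Omega> (wdiv \<Omega> (\<lambda>x. 0)) = 0" using norm0_cong_AE[OF w0L L2_zero w0] by (simp add: norm0_zero)
  have "v \<in> L2_mesh \<Omega> T"
    unfolding L2_mesh_def v_def using g(1) L2_scaleR[OF gL] by (fastforce simp: L2_mesh_def)
  then have "(v, (\<lambda>x. 0)) \<in> V_dual \<Omega> T \<phi>" using H_dual_zero by (auto simp: V_dual_def)
  moreover have "norm_V \<Omega> (v, (\<lambda>x. 0)) \<le> 1"
  proof -
    have "norm0 \<Omega> v = 1" unfolding v_def norm0_scaleR gd using d by simp
    then show ?thesis by (simp add: norm_V_def norm0_zero nw0)
  qed
  ultimately have "\<gamma> \<Omega> (u, p) (v, (\<lambda>x. 0)) < \<beta>" by (rule unstable)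
  moreover have "\<gamma> \<Omega> (u, p) (v, (\<lambda>x. 0)) = d"
  proof -
    have "ip \<Omega> u (wdiv \<Omega> (\<lambda>x. 0)) = 0"
      using ip_cong_AE[OF u u w0L L2_zero _ w0] by (simp add: ip_zero_right)
    moreover have "ip \<Omega> (wdiv \<Omega> p) v = d"
    proof -
      have "ip \<Omega> (wdiv \<Omega> p) v = ip \<Omega> g v"
        unfolding v_def by (rule ip_cong_AE[OF wL gL L2_scaleR[OF gL] L2_scaleR[OF gL] g(2)]) simp
      also have "\<dots> = (1 / d) * (norm0 \<Omega> g)\<^sup>2" unfolding v_def ip_scaleR_right norm0_power2 ..
      also have "\<dots> = d" using d by (simp add: gd power2_eq_square)
      finally show ?thesis .
    qed
    ultimately show ?thesis by (simp add: \<gamma>_def ip_zero_right)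
  qed
  ultimately show ?thesis by (simp add: d_def)
qed (use \<beta> in simp)

text \<open>Each of the three bounds feeds the next: the one on div p limits the coupling term (u,
  div \<Pi>p), and the resulting one on p limits the term (p, q) for the lifting q of u.\<close>

lemma stability_from_lifting:
  fixes A B D E F \<beta> :: real
  assumes \<Omega>: "convex_polygonal_domain \<Omega>" and pos: "A > 0" "B > 0" "D > 0" "F > 0" "\<beta> > 0"
    and choice: "dual_choice \<Omega> \<theta> n \<phi>s" and interp: "interpolation_hypothesis \<Omega> \<theta> n \<phi>s A B D E"
    and lift: "lifting_property \<Omega> \<theta> \<phi>s F"
    and rad: "1 - (B + 2 * D) / A * \<beta> - \<beta>\<^sup>2 \<ge> 0"
    and \<beta>: "sqrt (1 - (B + 2 * D) / A * \<beta> - \<beta>\<^sup>2) \<ge> (1 + F * (1 + sqrt ((B + 2 * D) / A))) * sqrt \<beta>"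
  shows "discrete_stability \<Omega> \<theta> n \<phi>s \<beta>"
  unfolding discrete_stability_def
proof (intro ballI impI)
  fix T \<xi> assume T: "T \<in> regular_meshes \<Omega> \<theta>" and \<xi>: "\<xi> \<in> V_mesh \<Omega> T (n T)" "norm_V \<Omega> \<xi> = 1"
  note Dm = domain_lmeasurable[OF \<Omega>]
  have mesh: "is_mesh \<Omega> T" using T by (simp add: regular_meshes_def)
  have nT: "mesh_normals \<Omega> T (n T)" and basis: "dual_rt_basis \<Omega> T (n T) (\<phi>s T)"
    using choice T by (auto simp: dual_choice_def)
  obtain u p where up: "\<xi> = (u, p)" "u \<in> L2_mesh \<Omega> T" "p \<in> H_mesh T (n T)"
    using \<xi>(1) by (auto simp: V_mesh_def)
  obtain g where g: "g \<in> L2_mesh \<Omega> T" "AE x in lebesgue_on \<Omega>. wdiv \<Omega> p x = g x" and p: "p \<in> Hdiv \<Omega>"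
    using H_mesh_props[OF \<Omega> mesh nT up(3)] .
  have u: "u \<in> L2 \<Omega>" using up(2) by (simp add: L2_mesh_def)
  show "\<exists>\<eta>\<in>V_dual \<Omega> T (\<phi>s T). norm_V \<Omega> \<eta> \<le> 1 \<and> \<beta> \<le> \<gamma> \<Omega> \<xi> \<eta>"
  proof (rule ccontr)
    assume "\<not> ?thesis"
    then have unstable: "\<And>\<eta>. \<eta> \<in> V_dual \<Omega> T (\<phi>s T) \<Longrightarrow> norm_V \<Omega> \<eta> \<le> 1 \<Longrightarrow> \<gamma> \<Omega> (u, p) \<eta> < \<beta>"
    proof -
      fix \<eta> assume \<eta>: "\<eta> \<in> V_dual \<Omega> T (\<phi>s T)" "norm_V \<Omega> \<eta> \<le> 1"
      show "\<gamma> \<Omega> (u, p) \<eta> < \<beta>"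
      proof (rule ccontr)
        assume "\<not> \<gamma> \<Omega> (u, p) \<eta> < \<beta>"
        then have "\<beta> \<le> \<gamma> \<Omega> \<xi> \<eta>" by (simp add: up(1))
        with \<eta> \<open>\<not> (\<exists>\<eta>\<in>V_dual \<Omega> T (\<phi>s T). norm_V \<Omega> \<eta> \<le> 1 \<and> \<beta> \<le> \<gamma> \<Omega> \<xi> \<eta>)\<close> show False by blast
      qed
    qed
    define a where "a = norm0 \<Omega> p"
    define b where "b = norm0 \<Omega> u"
    define d where "d = norm0 \<Omega> (wdiv \<Omega> p)"
    \<comment> \<open>B + D bounds the norm of the interpolant of p, and moving the coupling term to
      the other side costs another D \<beta>; the coercivity constant A is divided out.\<close>
    define \<kappa> where "\<kappa> = (B + 2 * D) / A"
    have nonneg: "a \<ge> 0" "b \<ge> 0" "d \<ge> 0" by (simp_all add: a_def b_def d_def norm0_nonneg)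
    have \<kappa>: "\<kappa> > 0" using pos by (simp add: \<kappa>_def)
    have one: "b\<^sup>2 + a\<^sup>2 + d\<^sup>2 = 1"
      using \<xi>(2) by (simp add: up(1) norm_V_def a_def b_def d_def real_sqrt_eq_1_iff)
    have small: "x \<le> 1" if "x\<^sup>2 + y + z = 1" "y \<ge> 0" "z \<ge> 0" for x y z :: real
    proof -
      have "x\<^sup>2 \<le> 1\<^sup>2" using that by simp
      then show ?thesis by (rule power2_le_imp_le) simp
    qed
    have le1: "a \<le> 1" "b \<le> 1" "d \<le> 1"
      using small[of a "b\<^sup>2" "d\<^sup>2"] small[of b "a\<^sup>2" "d\<^sup>2"] small[of d "a\<^sup>2" "b\<^sup>2"] one by auto
    have d\<beta>: "d \<le> \<beta>"
      unfolding d_def by (rule unstable_bound_scalar[OF Dm(1,2) p u g pos(5) unstable])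
    obtain r where P: "r \<in> H_dual T (\<phi>s T)" "A * a\<^sup>2 \<le> ip \<Omega> p r" "norm0 \<Omega> r \<le> B * a"
      "norm0 \<Omega> (wdiv \<Omega> r) \<le> D * d"
      unfolding a_def d_def by (rule interpolation_operator[OF interp T up(3)]) iprover
    have PH: "r \<in> Hdiv \<Omega>" by (rule H_dual_Hdiv[OF Dm(2) basis P(1)])
    have a\<beta>: "a\<^sup>2 \<le> \<kappa> * \<beta>"
    proof -
      have n1: "norm0 \<Omega> r \<le> B" using P(3) le1 pos mult_left_mono[of a 1 B] by linarith
      have n2: "norm0 \<Omega> (wdiv \<Omega> r) \<le> D" using P(4) le1 pos mult_left_mono[of d 1 D] by linarith
      have "norm_Hdiv \<Omega> r \<le> norm0 \<Omega> r + norm0 \<Omega> (wdiv \<Omega> r)"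
        unfolding norm_Hdiv_def by (rule sqrt_sum_squares_le_sum[OF norm0_nonneg norm0_nonneg])
      then have "norm_Hdiv \<Omega> r \<le> B + D" using n1 n2 by linarith
      then have "ip \<Omega> p r + ip \<Omega> u (wdiv \<Omega> r) < \<beta> * (B + D)"
        using pos by (intro unstable_bound_dual[OF Dm(1,2) basis u p P(1) _ _ unstable]) auto
      moreover have "\<bar>ip \<Omega> u (wdiv \<Omega> r)\<bar> \<le> D * \<beta>"
      proof -
        have "\<bar>ip \<Omega> u (wdiv \<Omega> r)\<bar> \<le> b * norm0 \<Omega> (wdiv \<Omega> r)"
          unfolding b_def by (rule ip_Cauchy_Schwarz[OF u wdiv_props(1)[OF PH]])
        also have "\<dots> \<le> 1 * (D * \<beta>)"
        proof (rule mult_mono)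
          show "norm0 \<Omega> (wdiv \<Omega> r) \<le> D * \<beta>"
            using P(4) mult_left_mono[OF d\<beta>, of D] pos by linarith
        qed (use le1 norm0_nonneg in auto)
        finally show ?thesis by simp
      qed
      ultimately have "A * a\<^sup>2 \<le> \<beta> * (B + D) + D * \<beta>" using P(2) by linarith
      then have "A * a\<^sup>2 \<le> (B + 2 * D) * \<beta>" by (simp add: algebra_simps)
      then show ?thesis using pos by (simp add: \<kappa>_def pos_le_divide_eq mult.commute)
    qed
    have a_le: "a \<le> sqrt \<kappa> * sqrt \<beta>"
      using real_sqrt_le_mono[OF a\<beta>] nonneg by (simp add: real_sqrt_mult)
    have b_le: "b \<le> F * (\<beta> + a)"
    \<comment> \<open>The scaling bound F b of the lifting has to be positive, so u = 0 is treated
      apart.\<close>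
    proof (cases "b = 0")
      case False
      then have bpos: "b > 0" using nonneg by simp
      obtain q where q: "q \<in> H_dual T (\<phi>s T)" "norm_Hdiv \<Omega> q \<le> F * b" "ip \<Omega> u (wdiv \<Omega> q) \<ge> b\<^sup>2"
        using lift T up(2) unfolding lifting_property_def b_def by blast
      have qH: "q \<in> Hdiv \<Omega>" by (rule H_dual_Hdiv[OF Dm(2) basis q(1)])
      have Fb: "F * b > 0" using pos bpos by simp
      have "norm0 \<Omega> q \<le> norm_Hdiv \<Omega> q"
        unfolding norm_Hdiv_def by (rule real_le_rsqrt) simp
      then have qn: "norm0 \<Omega> q \<le> F * b" using q(2) by linarith
      have "ip \<Omega> p q + ip \<Omega> u (wdiv \<Omega> q) < \<beta> * (F * b)"
        by (rule unstable_bound_dual[OF Dm(1,2) basis u p q(1) Fb q(2) unstable])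
      moreover have "\<bar>ip \<Omega> p q\<bar> \<le> a * (F * b)"
        using ip_Cauchy_Schwarz[OF Hdiv_L2[OF p] Hdiv_L2[OF qH]] mult_left_mono[OF qn nonneg(1)]
        by (simp add: a_def)
      ultimately have "b\<^sup>2 \<le> \<beta> * (F * b) + a * (F * b)" using q(3) by linarith
      then have "b * b \<le> (F * (\<beta> + a)) * b" by (simp add: power2_eq_square algebra_simps)
      then show ?thesis using bpos by simp
    qed (use pos nonneg in simp)
    \<comment> \<open>Nonnegativity of the radicand forces \<beta> \<le> 1, hence \<beta> \<le> sqrt
      \<beta>, and both contributions to b become multiples of sqrt \<beta>.\<close>
    have "\<kappa> * \<beta> > 0" using \<kappa> pos by simp
    then have "\<beta>\<^sup>2 \<le> 1\<^sup>2" using rad unfolding \<kappa>_def[symmetric] by simp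
    then have \<beta>1: "\<beta> \<le> 1" by (rule power2_le_imp_le) simp
    have "\<beta> = sqrt \<beta> * sqrt \<beta>" using pos by simp
    also have "\<dots> \<le> 1 * sqrt \<beta>" using \<beta>1 pos by (intro mult_right_mono) auto
    finally have \<beta>s: "\<beta> \<le> sqrt \<beta>" by simp
    have "1 - \<kappa> * \<beta> - \<beta>\<^sup>2 \<le> b\<^sup>2" using one a\<beta> power_mono[OF d\<beta> nonneg(3), of 2] by linarith
    then have "sqrt (1 - \<kappa> * \<beta> - \<beta>\<^sup>2) \<le> b" using nonneg(2) by (intro real_le_lsqrt) auto
    also have "\<dots> \<le> F * (sqrt \<beta> + sqrt \<kappa> * sqrt \<beta>)"
      using b_le mult_left_mono[of "\<beta> + a" "sqrt \<beta> + sqrt \<kappa> * sqrt \<beta>" F] a_le \<beta>s pos by linarith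
    \<comment> \<open>The leading 1 in the factor 1 + F (1 + sqrt \<kappa>) supplies the strictness
      needed for the contradiction.\<close>
    also have "\<dots> < sqrt \<beta> + F * (sqrt \<beta> + sqrt \<kappa> * sqrt \<beta>)" using pos by simp
    also have "\<dots> = (1 + F * (1 + sqrt \<kappa>)) * sqrt \<beta>" by (simp add: algebra_simps)
    finally show False using \<beta> by (simp add: \<kappa>_def)
  qed
qed

lemma admissible_beta_exists:
  fixes \<kappa> s :: real
  assumes "\<kappa> > 0" "s > 0"
  obtains \<beta> where "\<beta> > 0" "1 - \<kappa> * \<beta> - \<beta>\<^sup>2 \<ge> 0" "sqrt (1 - \<kappa> * \<beta> - \<beta>\<^sup>2) \<ge> s * sqrt \<beta>"
proof -
  \<comment> \<open>With this choice \<kappa> \<beta> + \<beta> + \<open>s\<^sup>2 * \<beta>\<close>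
    equals 1, and \<beta> dominates its own square.\<close>
  define \<beta> where "\<beta> = 1 / (\<kappa> + 1 + s\<^sup>2)"
  have den: "\<kappa> + 1 + s\<^sup>2 > 1" using assms by (simp add: add_pos_pos)
  then have \<beta>: "\<beta> > 0" "\<beta> \<le> 1" by (simp_all add: \<beta>_def)
  have "\<beta> * (\<kappa> + 1 + s\<^sup>2) = 1" using den by (simp add: \<beta>_def)
  moreover have "\<beta>\<^sup>2 \<le> \<beta>" using \<beta> by (simp add: power2_eq_square mult_left_le)
  ultimately have le: "s\<^sup>2 * \<beta> \<le> 1 - \<kappa> * \<beta> - \<beta>\<^sup>2" by (simp add: algebra_simps)
  have "0 \<le> s\<^sup>2 * \<beta>" using \<beta> by simp
  then have "1 - \<kappa> * \<beta> - \<beta>\<^sup>2 \<ge> 0" using le by linarith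
  moreover have "s * sqrt \<beta> = sqrt (s\<^sup>2 * \<beta>)" using assms by (simp add: real_sqrt_mult)
  then have "sqrt (1 - \<kappa> * \<beta> - \<beta>\<^sup>2) \<ge> s * sqrt \<beta>" using real_sqrt_le_mono[OF le] by simp
  ultimately show thesis using that \<beta>(1) by blast
qed

text \<open>The order of quantifiers matters: \<open>F\<close> is fixed before the normals and the
  dual bases, so it depends only on the domain, \<theta> and the interpolation constants.\<close>

lemma lifting_constant_exists:
  fixes A B D E :: real
  assumes \<Omega>: "convex_polygonal_domain \<Omega>" and pos: "B > 0" "D > 0" "E > 0"
  shows "\<exists>F>0. \<forall>n \<phi>s. dual_choice \<Omega> \<theta> n \<phi>s \<and> interpolation_hypothesis \<Omega> \<theta> n \<phi>s A B D E \<longrightarrow>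
    lifting_property \<Omega> \<theta> \<phi>s F"
proof -
  note Dm = domain_lmeasurable[OF \<Omega>]
  obtain C where C: "C > 0"
    "\<And>T n u. \<lbrakk>T \<in> regular_meshes \<Omega> \<theta>; mesh_normals \<Omega> T n; u \<in> L2_mesh \<Omega> T\<rbrakk> \<Longrightarrow>
       \<exists>q\<in>H_mesh T n. (AE x in lebesgue_on \<Omega>. wdiv \<Omega> q x = u x) \<and> norm0 \<Omega> q \<le> C * norm0 \<Omega> u"
    using discrete_divergence_lift[OF \<Omega>] by blast
  \<comment> \<open>C bounds the discrete field by its divergence, B and D bound the interpolant and
    its divergence, and 1 / E is the scaling of the data.\<close>
  define F where "F = (B * C + D) / E"
  have F: "F > 0" using pos C(1) by (simp add: F_def add_pos_pos)
  have "lifting_property \<Omega> \<theta> \<phi>s F"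
    if choice: "dual_choice \<Omega> \<theta> n \<phi>s" and interp: "interpolation_hypothesis \<Omega> \<theta> n \<phi>s A B D E" for n \<phi>s
    unfolding lifting_property_def
  proof (intro ballI)
    fix T u assume T: "T \<in> regular_meshes \<Omega> \<theta>" and u: "u \<in> L2_mesh \<Omega> T"
    have mesh: "is_mesh \<Omega> T" using T by (simp add: regular_meshes_def)
    have nT: "mesh_normals \<Omega> T (n T)" and basis: "dual_rt_basis \<Omega> T (n T) (\<phi>s T)"
      using choice T by (auto simp: dual_choice_def)
    have uL: "u \<in> L2 \<Omega>" using u by (simp add: L2_mesh_def)
    \<comment> \<open>With div q = v the interpolation bound reads (v, div \<Pi>q) \<ge> E ||v||^2;
      for v = u / E this is the lifting inequality with constant 1.\<close>
    define v where "v = (\<lambda>x. (1 / E) *\<^sub>R u x)"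
    have vL: "v \<in> L2 \<Omega>" unfolding v_def using uL by (rule L2_scaleR)
    have "v \<in> L2_mesh \<Omega> T" unfolding L2_mesh_def using vL u by (fastforce simp: L2_mesh_def v_def)
    then obtain q where q: "q \<in> H_mesh T (n T)" "AE x in lebesgue_on \<Omega>. wdiv \<Omega> q x = v x"
      "norm0 \<Omega> q \<le> C * norm0 \<Omega> v"
      using C(2)[OF T nT] by blast
    have qH: "q \<in> Hdiv \<Omega>" using H_mesh_props[OF \<Omega> mesh nT q(1)] by blast
    have wL: "wdiv \<Omega> q \<in> L2 \<Omega>" by (rule wdiv_props(1)[OF qH])
    have nv: "norm0 \<Omega> v = norm0 \<Omega> u / E" unfolding v_def norm0_scaleR using pos by simp
    have nw: "norm0 \<Omega> (wdiv \<Omega> q) = norm0 \<Omega> u / E" using norm0_cong_AE[OF wL vL q(2)] nv by simp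
    obtain r where P: "r \<in> H_dual T (\<phi>s T)" "norm0 \<Omega> r \<le> B * norm0 \<Omega> q"
      "norm0 \<Omega> (wdiv \<Omega> r) \<le> D * norm0 \<Omega> (wdiv \<Omega> q)"
      "ip \<Omega> (wdiv \<Omega> q) (wdiv \<Omega> r) \<ge> E * (norm0 \<Omega> (wdiv \<Omega> q))\<^sup>2"
      by (rule interpolation_operator[OF interp T q(1)]) iprover
    have PL: "wdiv \<Omega> r \<in> L2 \<Omega>" by (rule wdiv_props(1)[OF H_dual_Hdiv[OF Dm(2) basis P(1)]])
    have "norm_Hdiv \<Omega> r \<le> norm0 \<Omega> r + norm0 \<Omega> (wdiv \<Omega> r)"
      unfolding norm_Hdiv_def by (rule sqrt_sum_squares_le_sum[OF norm0_nonneg norm0_nonneg])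
    also have "\<dots> \<le> B * (C * (norm0 \<Omega> u / E)) + D * (norm0 \<Omega> u / E)"
      using P(2,3) mult_left_mono[OF q(3), of B] pos by (simp add: nw nv)
    also have "\<dots> = F * norm0 \<Omega> u" by (simp add: F_def algebra_simps add_divide_distrib)
    finally have norm: "norm_Hdiv \<Omega> r \<le> F * norm0 \<Omega> u" .
    have "ip \<Omega> (wdiv \<Omega> q) (wdiv \<Omega> r) = ip \<Omega> v (wdiv \<Omega> r)"
      by (rule ip_cong_AE[OF wL vL PL PL q(2)]) simp
    also have "\<dots> = ip \<Omega> u (wdiv \<Omega> r) / E" unfolding v_def ip_scaleR_left by simp
    finally have "ip \<Omega> u (wdiv \<Omega> r) / E \<ge> E * (norm0 \<Omega> u / E)\<^sup>2" using P(4) by (simp add: nw)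
    then have "ip \<Omega> u (wdiv \<Omega> r) / E \<ge> (norm0 \<Omega> u)\<^sup>2 / E" using pos by (simp add: power2_eq_square)
    then have "ip \<Omega> u (wdiv \<Omega> r) \<ge> (norm0 \<Omega> u)\<^sup>2" using pos by (simp add: divide_le_cancel)
    then show "\<exists>q\<in>H_dual T (\<phi>s T). norm_Hdiv \<Omega> q \<le> F * norm0 \<Omega> u \<and> (norm0 \<Omega> u)\<^sup>2 \<le> ip \<Omega> u (wdiv \<Omega> q)"
      using P(1) norm by blast
  qed
  then show ?thesis using F by blast
qed

theorem proposition2:
  fixes \<Omega> :: "plane set" and \<theta> A B D E :: real
  assumes "convex_polygonal_domain \<Omega>"
    and "\<theta> > 0" and "A > 0" and "B > 0" and "D > 0" and "E > 0"
  shows "(\<exists>F>0. \<forall>n \<phi>s. dual_choice \<Omega> \<theta> n \<phi>s \<and> interpolation_hypothesis \<Omega> \<theta> n \<phi>s A B D E \<longrightarrow>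
             lifting_property \<Omega> \<theta> \<phi>s F) \<and>
         (\<forall>n \<phi>s F. dual_choice \<Omega> \<theta> n \<phi>s \<and> interpolation_hypothesis \<Omega> \<theta> n \<phi>s A B D E \<and>
             F > 0 \<and> lifting_property \<Omega> \<theta> \<phi>s F \<longrightarrow>
             (\<exists>\<beta>>0. discrete_stability \<Omega> \<theta> n \<phi>s \<beta>) \<and>
             (\<forall>\<beta>>0. 1 - (B + 2 * D) / A * \<beta> - \<beta>\<^sup>2 \<ge> 0 \<and>
                sqrt (1 - (B + 2 * D) / A * \<beta> - \<beta>\<^sup>2)
                  \<ge> (1 + F * (1 + sqrt ((B + 2 * D) / A))) * sqrt \<beta> \<longrightarrow>
                discrete_stability \<Omega> \<theta> n \<phi>s \<beta>))"
proof (intro conjI allI impI)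
  show "\<exists>F>0. \<forall>n \<phi>s. dual_choice \<Omega> \<theta> n \<phi>s \<and> interpolation_hypothesis \<Omega> \<theta> n \<phi>s A B D E \<longrightarrow>
      lifting_property \<Omega> \<theta> \<phi>s F"
    by (rule lifting_constant_exists[OF assms(1,4,5,6)])
next
  fix n \<phi>s F
  assume H: "dual_choice \<Omega> \<theta> n \<phi>s \<and> interpolation_hypothesis \<Omega> \<theta> n \<phi>s A B D E \<and>
    F > 0 \<and> lifting_property \<Omega> \<theta> \<phi>s F"
  have stable: "discrete_stability \<Omega> \<theta> n \<phi>s \<beta>"
    if "\<beta> > 0" "1 - (B + 2 * D) / A * \<beta> - \<beta>\<^sup>2 \<ge> 0"
      "sqrt (1 - (B + 2 * D) / A * \<beta> - \<beta>\<^sup>2) \<ge> (1 + F * (1 + sqrt ((B + 2 * D) / A))) * sqrt \<beta>" for \<beta>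
    using stability_from_lifting[OF assms(1,3,4,5) _ that(1) _ _ _ that(2,3)] H by blast
  then show "discrete_stability \<Omega> \<theta> n \<phi>s \<beta>"
    if "\<beta> > 0" "1 - (B + 2 * D) / A * \<beta> - \<beta>\<^sup>2 \<ge> 0 \<and>
      sqrt (1 - (B + 2 * D) / A * \<beta> - \<beta>\<^sup>2) \<ge> (1 + F * (1 + sqrt ((B + 2 * D) / A))) * sqrt \<beta>" for \<beta>
    using that by blast
  have "(B + 2 * D) / A > 0" "1 + F * (1 + sqrt ((B + 2 * D) / A)) > 0"
    using assms H by (simp_all add: add_pos_nonneg)
  then obtain \<beta> where "\<beta> > 0" "1 - (B + 2 * D) / A * \<beta> - \<beta>\<^sup>2 \<ge> 0"
    "sqrt (1 - (B + 2 * D) / A * \<beta> - \<beta>\<^sup>2) \<ge> (1 + F * (1 + sqrt ((B + 2 * D) / A))) * sqrt \<beta>"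
    using admissible_beta_exists by blast
  then show "\<exists>\<beta>>0. discrete_stability \<Omega> \<theta> n \<phi>s \<beta>"
    using stable by blast
qed

end
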